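(* Let $n=2m-1$ be a positive odd integer. Let $\Sigma(n)$ be the full simplex on vertex set $\binom{[n]}{2}$, let $\mathrm{NFC}_n$ be its subcomplex consisting of the edge sets of all graphs on $[n]$ that are not factor critical, and let $\mathrm{FC}_n=\Sigma(n)/\mathrm{NFC}_n$ be the quotient CW-complex. Then $\mathrm{FC}_n$ has the homotopy type of a wedge of $(n-2)!!^2$ spheres of dimension $3m-4$.
   Context: Graphs are simple and loopless on vertex set $[n]$ and are identified with their edge sets (faces of $\Sigma(n)$, the empty face being the edgeless graph). A graph $G$ on an odd number of vertices is factor critical if for every vertex $v$, the graph $G-v$ obtained by deleting $v$ and all incident edges has a perfect matching. For a subcomplex $\Gamma$ of a simplex $\Delta$: if $\Gamma$ is empty then $\Delta/\Gamma=\Delta$; otherwise $\Delta/\Gamma$ is the CW-complex with one point $p_0$ and one $k$-cell for each $k$-dimensional face of $\Delta$ not in $\Gamma$, with boundary portions glued to faces of $\Gamma$ now glued to $p_0$. For odd $j\ge1$, $j!!$ is the product of the odd positive integers $\le j$, and $(-1)!!=1$. *)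

theory Defs
  imports "HOL-Analysis.Analysis"
begin

subsection \<open>Graphs, identified with their edge sets\<close>

definition all_edges :: "nat \<Rightarrow> nat set set" where
  "all_edges n = {e. e \<subseteq> {1..n} \<and> card e = 2}"

definition perfect_matching :: "'a set \<Rightarrow> 'a set set \<Rightarrow> 'a set set \<Rightarrow> bool" where
  "perfect_matching V G M \<longleftrightarrow> M \<subseteq> G \<and> (\<forall>v\<in>V. \<exists>!e. e \<in> M \<and> v \<in> e)"

definition factor_critical :: "'a set \<Rightarrow> 'a set set \<Rightarrow> bool" where
  "factor_critical V G \<longleftrightarrow>
     odd (card V) \<and> (\<forall>v\<in>V. \<exists>M. perfect_matching (V - {v}) {e \<in> G. v \<notin> e} M)"

subsection \<open>Simplicial complexes and quotients\<close>

text \<open>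
  A simplicial complex is the set of its faces, which are finite sets of vertices. The empty face
  is a face like any other, so the complex \<open>{{}}\<close> differs from the empty complex \<open>{}\<close>.
  A point of the geometric realization is given by its barycentric coordinates. The topology is
  that of pointwise convergence, which is the usual one for finite complexes, the only ones
  occurring here.
\<close>

definition realization :: "'v set set \<Rightarrow> ('v \<Rightarrow> real) topology" where
  "realization K = subtopology (powertop_real UNIV)
     {x. \<exists>F\<in>K. (\<forall>v. 0 \<le> x v) \<and> (\<forall>v. v \<notin> F \<longrightarrow> x v = 0) \<and> (\<Sum>v\<in>F. x v) = 1}"

text \<open>The finest topology on the set \<open>Y\<close> that makes \<open>f\<close> continuous on \<open>X\<close>
  (\<open>f\<close> is meant to map \<open>topspace X\<close> into \<open>Y\<close>).\<close>

definition final_topology :: "'a topology \<Rightarrow> 'b set \<Rightarrow> ('a \<Rightarrow> 'b) \<Rightarrow> 'b topology" where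
  "final_topology X Y f = topology (\<lambda>U. U \<subseteq> Y \<and> openin X {x \<in> topspace X. f x \<in> U})"

lemma openin_final_topology:
  assumes "f ` topspace X \<subseteq> Y"
  shows "openin (final_topology X Y f) U \<longleftrightarrow> U \<subseteq> Y \<and> openin X {x \<in> topspace X. f x \<in> U}"
proof -
  have "istopology (\<lambda>U. U \<subseteq> Y \<and> openin X {x \<in> topspace X. f x \<in> U})"
  proof -
    have 1: "{x \<in> topspace X. f x \<in> S \<inter> T} =
        {x \<in> topspace X. f x \<in> S} \<inter> {x \<in> topspace X. f x \<in> T}" for S T
      by auto
    have 2: "{x \<in> topspace X. f x \<in> \<Union>\<K>} = (\<Union>K\<in>\<K>. {x \<in> topspace X. f x \<in> K})" for \<K>
      by auto
    show ?thesis
      unfolding istopology_def 1 2 by blast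
  qed
  then show ?thesis
    by (simp add: final_topology_def)
qed

lemma topspace_final_topology:
  assumes "f ` topspace X \<subseteq> Y"
  shows "topspace (final_topology X Y f) = Y"
proof -
  have "{x \<in> topspace X. f x \<in> Y} = topspace X"
    using assms by auto
  then have "openin (final_topology X Y f) Y"
    using assms by (simp add: openin_final_topology)
  then show ?thesis
    using assms by (metis openin_final_topology openin_subset openin_topspace subset_antisym)
qed

text \<open>The disjoint union of \<open>X\<close> with a point \<open>None\<close>, in which all points of \<open>A\<close> are then
  identified with \<open>None\<close>. For \<open>A\<close> disjoint from \<open>topspace X\<close> the point \<open>None\<close> is isolated.\<close>

definition collapse :: "'a topology \<Rightarrow> 'a set \<Rightarrow> 'a option topology" where
  "collapse X A = final_topology X (insert None (Some ` (topspace X - A)))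
     (\<lambda>x. if x \<in> A then None else Some x)"

text \<open>The quotient of a complex by a subcomplex. In the first case it is just a copy of the
  realization of \<open>K\<close>, moved to the option type.\<close>

definition complex_quotient :: "'v set set \<Rightarrow> 'v set set \<Rightarrow> ('v \<Rightarrow> real) option topology" where
  "complex_quotient K L =
     (if L = {} then final_topology (realization K) (Some ` topspace (realization K)) Some
      else collapse (realization K) (topspace (realization L)))"

definition full_simplex :: "nat \<Rightarrow> nat set set set" where
  "full_simplex n = Pow (all_edges n)"

definition NFC :: "nat \<Rightarrow> nat set set set" where
  "NFC n = {G \<in> full_simplex n. \<not> factor_critical {1..n} G}"

definition FC :: "nat \<Rightarrow> (nat set \<Rightarrow> real) option topology" where
  "FC n = complex_quotient (full_simplex n) (NFC n)"

lemma NFC_subcomplex: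
  assumes "G \<in> NFC n" "H \<subseteq> G"
  shows "H \<in> NFC n"
proof -
  have "perfect_matching V {e \<in> G. v \<notin> e} M" if "perfect_matching V {e \<in> H. v \<notin> e} M" for V v M
    using that \<open>H \<subseteq> G\<close> by (auto simp: perfect_matching_def)
  then have mono: "factor_critical V G" if "factor_critical V H" for V
    using that unfolding factor_critical_def by meson
  show ?thesis
    using assms mono by (auto simp: NFC_def full_simplex_def)
qed

subsection \<open>Wedges of spheres and double factorials\<close>

text \<open>
  All spheres are glued at their points $(1,0,\ldots,0)$; a wedge of no spheres is a point.
  The sphere of dimension $-1$ is the empty space, the realization of the complex \<open>{{}}\<close>. It has
  no base point, and a wedge of copies of it (only a single copy is ever needed) is read as the
  empty space.
\<close>

definition wedge_of_spheres :: "nat \<Rightarrow> int \<Rightarrow> (nat \<times> (nat \<Rightarrow> real)) option topology" where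
  "wedge_of_spheres k d =
     (if d < 0 then trivial_topology
      else collapse (sum_topology (\<lambda>_. nsphere (nat d)) {..<k})
             ({..<k} \<times> {\<lambda>i. if i = 0 then 1 else 0}))"

definition double_factorial :: "int \<Rightarrow> nat" where
  "double_factorial j = \<Prod>{i::nat. odd i \<and> int i \<le> j}"

end

theory Submission
  imports Defs
begin

text \<open>
  The proof is by discrete Morse theory. Fix two vertices \<open>x\<close> and \<open>y\<close>. Toggling the edge \<open>xy\<close> matches
  all factor critical graphs except those that contain \<open>xy\<close> and are no longer factor critical
  without it. For such a graph, delete \<open>xy\<close>, let \<open>D\<close> be the set of vertices missed by some
  near-perfect matching, and \<open>A\<close> the set of the neighbours of \<open>D\<close> outside \<open>D\<close>. Edges inside \<open>A\<close> are
  never needed in the relevant matchings, so if \<open>A\<close> has two elements one can toggle the edge between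
  them. If \<open>A = {z}\<close>, the graph consists of \<open>xy\<close>, of factor critical graphs on three disjoint sets
  \<open>X\<close>, \<open>Y\<close>, \<open>Z\<close> containing \<open>x\<close>, \<open>y\<close>, \<open>z\<close> and covering all vertices, and of nonempty sets of edges from
  \<open>z\<close> to \<open>X\<close> and to \<open>Y\<close>. By induction the unmatched graphs on \<open>2k + 1\<close> vertices are cacti of \<open>k\<close>
  triangles, and their number \<open>f\<^sub>k\<close> satisfies
  \<open>f\<^sub>k = (2k - 1) \<Sum> (2k - 2)! / ((2a)! (2b)! (2c)!) f\<^sub>a f\<^sub>b f\<^sub>c\<close>, summed over \<open>a + b + c = k - 1\<close>. Since
  \<open>(2a - 1)!!\<^sup>2 / (2a)!\<close> is the coefficient of \<open>t\<^sup>a\<close> in \<open>(1 - t) powr (-1/2)\<close>, this gives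
  \<open>f\<^sub>k = (2k - 1)!!\<^sup>2\<close>.

  All unmatched cells have the same dimension, so the matched pairs of lower dimension can be collapsed
  into the subcomplex, after which the unmatched cells are attached along their whole boundary.
\<close>

section \<open>Acyclic matchings on families of finite sets\<close>

text \<open>Acyclicity comes from sorting the graphs without \<open>xy\<close> by monotone
  invariants: first D, then A among graphs with the same D, then the part Y of D outside the
  component of \<open>x\<close>. Matchings of the single fibres then fit together, and a toggle only
  has to preserve these invariants.

  A is never empty: \<open>x\<close> and \<open>y\<close> lie in different components of D, all
  components of D have odd order, and a matching that misses \<open>x\<close> must leave the
  component of \<open>y\<close>, which is possible only through A. If A = {z}, then \<open>z\<close>
  has only one partner, so a matching that misses \<open>x\<close> can serve only one further
  component. Hence D has exactly two components, and this is where the three parts come from.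

  The Gallai-Edmonds theorem is not invoked. What is needed of it follows from one exchange property
  of the vertex sets missed by matchings, proved with alternating paths.

  Parts of orders 2a+1, 2b+1, 2c+1 contribute 3a+3b+3c edges to an unmatched graph, each of the two
  stars one edge, and \<open>xy\<close> one more. The total is 3(a+b+c+1) = 3k, whatever the split.
  The factor 2k-1 in the recursion is the choice of \<open>z\<close>.\<close>

text \<open>\<open>morse_family S c k\<close>: the cells in \<open>S\<close> admit an acyclic matching with \<open>k\<close> unmatched cells,
  all of cardinality \<open>c\<close>. In a union the cells of \<open>T\<close> are attached after those of \<open>S\<close>.\<close>

inductive morse_family :: "'a set set \<Rightarrow> nat \<Rightarrow> nat \<Rightarrow> bool" where
  empty: "morse_family {} c 0"
| critical: "finite \<sigma> \<Longrightarrow> card \<sigma> = c \<Longrightarrow> morse_family {\<sigma>} c 1"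
| pair: "finite \<tau> \<Longrightarrow> f \<notin> \<tau> \<Longrightarrow> morse_family {\<tau>, insert f \<tau>} c 0"
| union: "morse_family S c k \<Longrightarrow> morse_family T c l \<Longrightarrow> (\<And>s t. s \<in> S \<Longrightarrow> t \<in> T \<Longrightarrow> \<not> t \<subseteq> s)
    \<Longrightarrow> morse_family (S \<union> T) c (k + l)"

text \<open>Expansions in the sense of simple homotopy theory: when a pair is attached,
  \<open>\<tau>\<close> is a free face of \<open>insert f \<tau>\<close>, so the homotopy type does
  not change.\<close>

inductive expansion :: "'a set set \<Rightarrow> bool" where
  empty: "expansion {}"
| pair: "finite \<tau> \<Longrightarrow> f \<notin> \<tau> \<Longrightarrow> expansion {\<tau>, insert f \<tau>}"
| union: "expansion S \<Longrightarrow> expansion T \<Longrightarrow> (\<And>s t. s \<in> S \<Longrightarrow> t \<in> T \<Longrightarrow> \<not> t \<subseteq> s)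
    \<Longrightarrow> expansion (S \<union> T)"

lemma morse_family_finite:
  assumes "morse_family S c k"
  shows "finite S" and "\<And>s. s \<in> S \<Longrightarrow> finite s"
  using assms by (induction rule: morse_family.induct) auto

text \<open>Cells of equal cardinality do not contain each other, so when all unmatched cells have the same
  cardinality the attaching order may be changed: a matched pair goes before or after all of them,
  according to its cardinalities.\<close>

lemma morse_family_split:
  assumes "morse_family S c k"
  shows "\<exists>S1 C S2. S = S1 \<union> C \<union> S2 \<and> expansion S1 \<and> expansion S2 \<and>
    finite C \<and> card C = k \<and> (\<forall>\<sigma>\<in>C. finite \<sigma> \<and> card \<sigma> = c) \<and>
    (\<forall>\<sigma>\<in>S1. card \<sigma> \<le> c) \<and> (\<forall>\<sigma>\<in>S2. c \<le> card \<sigma>) \<and>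
    S1 \<inter> C = {} \<and> S1 \<inter> S2 = {} \<and> C \<inter> S2 = {}"
  using assms
  proof (induction rule: morse_family.induct)
    case (empty c)
    then show ?case
      by - (rule exI[of _ "{}"], rule exI[of _ "{}"], rule exI[of _ "{}"], simp add: expansion.empty)
  next
    case (critical \<sigma> c)
    then show ?case
      by - (rule exI[of _ "{}"], rule exI[of _ "{\<sigma>}"], rule exI[of _ "{}"], simp add: expansion.empty)
  next
    case (pair \<tau> f c)
    show ?case
    \<comment> \<open>The two cardinalities of a pair are consecutive, so both are at least
      \<open>c\<close> or both are at most \<open>c\<close>.\<close>
    proof (cases "c \<le> card \<tau>")
      case True
      with pair show ?thesis
        by - (rule exI[of _ "{}"], rule exI[of _ "{}"], rule exI[of _ "{\<tau>, insert f \<tau>}"], simp add: expansion.intros)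
    next
      case False
      with pair show ?thesis
        by - (rule exI[of _ "{\<tau>, insert f \<tau>}"], rule exI[of _ "{}"], rule exI[of _ "{}"], simp add: expansion.intros)
    qed
  next
    case (union S c k T l)
    obtain S1 C S2 where S: "S = S1 \<union> C \<union> S2" "expansion S1" "expansion S2"
      "finite C" "card C = k" "\<forall>\<sigma>\<in>C. finite \<sigma> \<and> card \<sigma> = c"
      "\<forall>\<sigma>\<in>S1. card \<sigma> \<le> c" "\<forall>\<sigma>\<in>S2. c \<le> card \<sigma>"
      "S1 \<inter> C = {}" "S1 \<inter> S2 = {}" "C \<inter> S2 = {}"
      using union.IH(1) by (elim exE conjE) (rule that; assumption)
    obtain T1 D T2 where T: "T = T1 \<union> D \<union> T2" "expansion T1" "expansion T2"
      "finite D" "card D = l" "\<forall>\<sigma>\<in>D. finite \<sigma> \<and> card \<sigma> = c"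
      "\<forall>\<sigma>\<in>T1. card \<sigma> \<le> c" "\<forall>\<sigma>\<in>T2. c \<le> card \<sigma>"
      "T1 \<inter> D = {}" "T1 \<inter> T2 = {}" "D \<inter> T2 = {}"
      using union.IH(2) by (elim exE conjE) (rule that; assumption)
    have disj: "S \<inter> T = {}"
      using union.hyps by blast
    have sub: "S1 \<subseteq> S" "C \<subseteq> S" "S2 \<subseteq> S" "T1 \<subseteq> T" "D \<subseteq> T" "T2 \<subseteq> T"
      using S(1) T(1) by auto
    have "expansion (S1 \<union> T1)"
      using S(2) T(2) by (rule expansion.union) (use union.hyps(3) sub in blast)
    moreover have "expansion (S2 \<union> T2)"
      using S(3) T(3) by (rule expansion.union) (use union.hyps(3) sub in blast)
    moreover have "C \<inter> D = {}"
      using sub disj by blast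
    then have "card (C \<union> D) = k + l"
      using S(4,5) T(4,5) by (simp add: card_Un_disjoint)
    moreover have "S \<union> T = (S1 \<union> T1) \<union> (C \<union> D) \<union> (S2 \<union> T2)"
      unfolding S(1) T(1) by (simp only: Un_ac)
    moreover have "(S1 \<union> T1) \<inter> (C \<union> D) = {}"
      using S(9) T(9) sub(1,2,4,5) disj by (simp add: Int_Un_distrib Int_Un_distrib2) blast
    moreover have "(S1 \<union> T1) \<inter> (S2 \<union> T2) = {}"
      using S(10) T(10) sub(1,3,4,6) disj by (simp add: Int_Un_distrib Int_Un_distrib2) blast
    moreover have "(C \<union> D) \<inter> (S2 \<union> T2) = {}"
      using S(11) T(11) sub(2,3,5,6) disj by (simp add: Int_Un_distrib Int_Un_distrib2) blast
    moreover have "\<forall>\<sigma>\<in>C \<union> D. finite \<sigma> \<and> card \<sigma> = c" "\<forall>\<sigma>\<in>S1 \<union> T1. card \<sigma> \<le> c"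
      "\<forall>\<sigma>\<in>S2 \<union> T2. c \<le> card \<sigma>" "finite (C \<union> D)"
      using S(4,6-8) T(4,6-8) by (simp_all add: ball_Un)
    ultimately show ?case
      by - (rule exI[of _ "S1 \<union> T1"], rule exI[of _ "C \<union> D"], rule exI[of _ "S2 \<union> T2"], intro conjI)
qed

text \<open>The patchwork principle for acyclic matchings. The fibre of a maximal value
  \<open>i\<close> is attached last: by monotonicity, a cell of it contained in a cell with another
  value would put that value above \<open>i\<close>.\<close>

lemma morse_family_fibers:
  fixes \<phi> :: "'a set \<Rightarrow> 'i::order"
  assumes "finite I" and "\<phi> ` S \<subseteq> I"
    and mono: "\<And>s t. s \<in> S \<Longrightarrow> t \<in> S \<Longrightarrow> s \<subseteq> t \<Longrightarrow> \<phi> s \<le> \<phi> t"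
    and fiber: "\<And>i. i \<in> I \<Longrightarrow> morse_family {s \<in> S. \<phi> s = i} c (k i)"
  shows "morse_family S c (sum k I)"
  using assms
proof (induction "card I" arbitrary: I S)
  case 0
  then show ?case by (simp add: morse_family.empty)
next
  case (Suc n)
  then obtain i where i: "i \<in> I" "\<And>j. j \<in> I \<Longrightarrow> i \<le> j \<Longrightarrow> j = i"
    using finite_has_maximal[of I] by (metis card.empty nat.distinct(1))
  let ?S = "{s \<in> S. \<phi> s \<noteq> i}" and ?T = "{s \<in> S. \<phi> s = i}"
  have "morse_family ?S c (sum k (I - {i}))"
  proof (rule Suc.hyps(1))
    show "n = card (I - {i})"
      using Suc.hyps(2) i(1) by simp
    fix j assume j: "j \<in> I - {i}"
    then have "{s \<in> ?S. \<phi> s = j} = {s \<in> S. \<phi> s = j}"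
      by auto
    then show "morse_family {s \<in> ?S. \<phi> s = j} c (k j)"
      using Suc.prems(4) j by simp
  next
    show "\<phi> ` ?S \<subseteq> I - {i}" "finite (I - {i})"
      using Suc.prems(1,2) by auto
    show "\<phi> s \<le> \<phi> t" if "s \<in> ?S" "t \<in> ?S" "s \<subseteq> t" for s t
      using that Suc.prems(3) by simp
  qed
  moreover have "morse_family ?T c (k i)"
    by (rule Suc.prems(4)[OF i(1)])
  moreover have "\<not> t \<subseteq> s" if "s \<in> ?S" "t \<in> ?T" for s t
  proof
    assume "t \<subseteq> s"
    then have "i \<le> \<phi> s"
      using that Suc.prems(3)[of t s] by auto
    moreover have "\<phi> s \<in> I" "\<phi> s \<noteq> i"
      using that Suc.prems(2) by auto
    ultimately show False
      using i(2) by blast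
  qed
  ultimately have "morse_family (?S \<union> ?T) c (sum k (I - {i}) + k i)"
    by (rule morse_family.union)
  moreover have "?S \<union> ?T = S"
    by auto
  moreover have "sum k (I - {i}) + k i = sum k I"
    using Suc.prems(1) i(1) by (simp add: sum.remove add.commute)
  ultimately show ?case
    by simp
qed

text \<open>The fibres of the monotone map that removes \<open>f\<close> are exactly the pairs to be
  matched, so acyclicity is an instance of the patchwork principle.\<close>

lemma morse_family_toggle:
  assumes "finite S" and "\<And>s. s \<in> S \<Longrightarrow> finite s"
    and "\<And>s. s \<in> S \<Longrightarrow> insert f s \<in> S" and "\<And>s. s \<in> S \<Longrightarrow> s - {f} \<in> S"
  shows "morse_family S c 0"
proof -
  have "morse_family S c (\<Sum>i\<in>(\<lambda>s. s - {f}) ` S. 0)"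
  proof (rule morse_family_fibers)
    fix \<tau> assume "\<tau> \<in> (\<lambda>s. s - {f}) ` S"
    then obtain s where s: "s \<in> S" "\<tau> = s - {f}"
      by blast
    have "\<tau> \<in> S" "insert f \<tau> \<in> S" "f \<notin> \<tau>"
      using s assms(3)[of \<tau>] assms(4)[of s] by auto
    moreover have "u = \<tau> \<or> u = insert f \<tau>" if "u - {f} = \<tau>" for u
      using that by blast
    ultimately have "{u \<in> S. u - {f} = \<tau>} = {\<tau>, insert f \<tau>}"
      by (intro subset_antisym subsetI) auto
    then show "morse_family {u \<in> S. u - {f} = \<tau>} c 0"
      using morse_family.pair[OF assms(2)[OF \<open>\<tau> \<in> S\<close>] \<open>f \<notin> \<tau>\<close>] by simp
  qed (use assms in auto)
  then show ?thesis
    by simp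
qed

lemma morse_family_join_face:
  assumes "morse_family T c l" and "finite \<sigma>" and "\<And>t. t \<in> T \<Longrightarrow> \<sigma> \<inter> t = {}"
  shows "morse_family ((\<lambda>t. \<sigma> \<union> t) ` T) (card \<sigma> + c) l"
  using assms
proof (induction rule: morse_family.induct)
  case (empty c)
  show ?case
    by (simp add: morse_family.empty)
next
  case (critical \<tau> c)
  have "card (\<sigma> \<union> \<tau>) = card \<sigma> + c"
    using critical.hyps critical.prems by (simp add: card_Un_disjoint)
  then have "morse_family {\<sigma> \<union> \<tau>} (card \<sigma> + c) 1"
    using critical.hyps(1) critical.prems(1) by (intro morse_family.critical) simp_all
  then show ?case
    by simp
next
  case (pair \<tau> f c)
  have "f \<notin> \<sigma> \<union> \<tau>"
    using pair.hyps(2) pair.prems(2)[of "insert f \<tau>"] by auto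
  then have "morse_family {\<sigma> \<union> \<tau>, insert f (\<sigma> \<union> \<tau>)} (card \<sigma> + c) 0"
    using pair.hyps(1) pair.prems(1) by (intro morse_family.pair) simp_all
  then show ?case
    by simp
next
  case (union S c k T l)
  have "\<not> \<sigma> \<union> t \<subseteq> \<sigma> \<union> s" if "s \<in> S" "t \<in> T" for s t
    using that union.hyps(3)[OF that] union.prems(2)[of t] by blast
  then show ?case
    unfolding image_Un using union.IH[OF union.prems(1)] union.prems(2)
    by (intro morse_family.union) auto
qed

section \<open>Joins of families on disjoint vertex sets\<close>

definition join :: "'a set set \<Rightarrow> 'a set set \<Rightarrow> 'a set set" where
  "join S T = {s \<union> t |s t. s \<in> S \<and> t \<in> T}"

lemma joinI: "s \<in> S \<Longrightarrow> t \<in> T \<Longrightarrow> s \<union> t \<in> join S T"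
  by (auto simp: join_def)

lemma joinE:
  assumes "u \<in> join S T"
  obtains s t where "u = s \<union> t" "s \<in> S" "t \<in> T"
  using assms by (auto simp: join_def)

lemma join_empty: "S = {} \<or> T = {} \<Longrightarrow> join S T = {}"
  by (auto simp: join_def)

text \<open>Only the matching of \<open>S\<close> is taken apart. A critical cell of
  \<open>S\<close> carries a shifted copy of the matching of \<open>T\<close>; a matched pair of
  \<open>S\<close> lets its vertex \<open>f\<close> be toggled in everything built on it, whatever
  \<open>T\<close> is. The sets \<open>B\<close> and \<open>B'\<close> guarantee that
  \<open>f\<close> does not occur in \<open>T\<close>.\<close>

lemma morse_family_join:
  assumes "morse_family S c k" and "morse_family T d l"
    and "\<And>s. s \<in> S \<Longrightarrow> s \<subseteq> B" and B': "\<And>t. t \<in> T \<Longrightarrow> t \<subseteq> B'" "B \<inter> B' = {}"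
  shows "morse_family (join S T) (c + d) (k * l)"
proof -
  have tB: "t \<inter> B = {}" if "t \<in> T" for t
    using B'(1)[OF that] B'(2) by blast
  show ?thesis
    unfolding join_def using assms(1,3)
  proof (induction rule: morse_family.induct)
    case (empty c)
    show ?case
      by (simp add: morse_family.empty)
  next
    case (critical \<sigma> c)
    have "{s \<union> t |s t. s \<in> {\<sigma>} \<and> t \<in> T} = (\<lambda>t. \<sigma> \<union> t) ` T"
      by auto
    moreover have "\<sigma> \<inter> t = {}" if "t \<in> T" for t
      using critical.prems tB[OF that] by blast
    ultimately show ?case
      using morse_family_join_face[OF assms(2) critical.hyps(1)] critical.hyps by simp
  next
    case (pair \<tau> f c)
    have f: "f \<in> B"
      using pair.prems by auto
    show ?case
      unfolding mult_0
    proof (rule morse_family_toggle[where f = f])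
      have "{s \<union> t |s t. s \<in> {\<tau>, insert f \<tau>} \<and> t \<in> T} = (\<lambda>(s,t). s \<union> t) ` ({\<tau>, insert f \<tau>} \<times> T)"
        by auto
      then show "finite {s \<union> t |s t. s \<in> {\<tau>, insert f \<tau>} \<and> t \<in> T}"
        using morse_family_finite[OF assms(2)] by simp
      fix u assume "u \<in> {s \<union> t |s t. s \<in> {\<tau>, insert f \<tau>} \<and> t \<in> T}"
      then obtain t where t: "t \<in> T" "u = \<tau> \<union> t \<or> u = insert f \<tau> \<union> t"
        by blast
      show "finite u"
        using t morse_family_finite[OF assms(2)] pair.hyps by auto
      have "insert f u = insert f \<tau> \<union> t"
        using t by auto
      then show "insert f u \<in> {s \<union> t |s t. s \<in> {\<tau>, insert f \<tau>} \<and> t \<in> T}"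
        using t(1) by blast
      have "f \<notin> t"
        using tB[OF t(1)] f by blast
      then have "u - {f} = \<tau> \<union> t"
        using t(2) pair.hyps(2) by auto
      then show "u - {f} \<in> {s \<union> t |s t. s \<in> {\<tau>, insert f \<tau>} \<and> t \<in> T}"
        using t(1) by blast
    qed
  next
    case (union S c k S' l')
    have eq: "{s \<union> t |s t. s \<in> S \<union> S' \<and> t \<in> T} =
        {s \<union> t |s t. s \<in> S \<and> t \<in> T} \<union> {s \<union> t |s t. s \<in> S' \<and> t \<in> T}"
      by blast
    show ?case
      unfolding eq distrib_right
    proof (rule morse_family.union)
      fix u u' assume "u \<in> {s \<union> t |s t. s \<in> S \<and> t \<in> T}" "u' \<in> {s \<union> t |s t. s \<in> S' \<and> t \<in> T}"
      then obtain s t s' t' where *: "u = s \<union> t" "u' = s' \<union> t'" "s \<in> S" "t \<in> T" "s' \<in> S'" "t' \<in> T"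
        by blast
      show "\<not> u' \<subseteq> u"
        using * union.hyps(3)[of s s'] union.prems[of s'] tB[of t] by blast
    next
      show "morse_family {s \<union> t |s t. s \<in> S \<and> t \<in> T} (c + d) (k * l)"
        by (rule union.IH(1)) (use union.prems in blast)
      show "morse_family {s \<union> t |s t. s \<in> S' \<and> t \<in> T} (c + d) (l' * l)"
        by (rule union.IH(2)) (use union.prems in blast)
    qed
  qed
qed

text \<open>Toggling \<open>b\<close> matches everything except \<open>{b}\<close>, whose partner is
  the excluded empty set. This supplies one critical edge for each star of edges at
  \<open>z\<close>.\<close>

lemma morse_family_nonempty_subsets:
  assumes "finite B" and "b \<in> B"
  shows "morse_family {s. s \<subseteq> B \<and> s \<noteq> {}} 1 1"
proof -
  have "morse_family ({{b}} \<union> {s. s \<subseteq> B \<and> s \<noteq> {} \<and> s \<noteq> {b}}) 1 (1 + 0)"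
  proof (rule morse_family.union)
    show "morse_family {{b}} 1 1"
      by (rule morse_family.critical) auto
    show "morse_family {s. s \<subseteq> B \<and> s \<noteq> {} \<and> s \<noteq> {b}} 1 0"
      using assms by (intro morse_family_toggle[where f = b]) (auto intro: finite_subset)
  qed auto
  moreover have "{{b}} \<union> {s. s \<subseteq> B \<and> s \<noteq> {} \<and> s \<noteq> {b}} = {s. s \<subseteq> B \<and> s \<noteq> {}}"
    using assms by auto
  ultimately show ?thesis
    by simp
qed

section \<open>Collapsing matched pairs of cells\<close>

abbreviation collapse_map :: "'a set \<Rightarrow> 'a \<Rightarrow> 'a option" where
  "collapse_map A \<equiv> \<lambda>x. if x \<in> A then None else Some x"

lemma topspace_collapse: "topspace (collapse X A) = insert None (Some ` (topspace X - A))"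
  unfolding collapse_def by (rule topspace_final_topology) auto

lemma openin_collapse:
  "openin (collapse X A) U \<longleftrightarrow>
    U \<subseteq> insert None (Some ` (topspace X - A)) \<and> openin X {x \<in> topspace X. collapse_map A x \<in> U}"
  unfolding collapse_def by (rule openin_final_topology) auto

lemma quotient_map_collapse:
  assumes "topspace X \<inter> A \<noteq> {}"
  shows "quotient_map X (collapse X A) (collapse_map A)"
proof -
  have "collapse_map A ` topspace X = insert None (Some ` (topspace X - A))"
    using assms by (auto simp: image_iff)
  then show ?thesis
    by (simp add: quotient_map_def topspace_collapse openin_collapse)
qed

definition collapse_induced :: "'b set \<Rightarrow> ('a \<Rightarrow> 'b) \<Rightarrow> 'a option \<Rightarrow> 'b option" where
  "collapse_induced B f z = (case z of None \<Rightarrow> None | Some x \<Rightarrow> collapse_map B (f x))"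

text \<open>A homotopy is continuous on the product with the interval, and must be pushed down to
  the collapsed space. This works because the interval is locally compact, so its product with the
  quotient map is again a quotient map. The nonemptiness conditions make the collapse maps
  surjective: otherwise \<open>None\<close> would be an additional isolated point.\<close>

lemma homotopic_collapse_induced:
  assumes "homotopic_with (\<lambda>h. h ` A \<subseteq> B) X Y f g" and "topspace X \<inter> A \<noteq> {}" "topspace Y \<inter> B \<noteq> {}"
  shows "homotopic_with (\<lambda>_. True) (collapse X A) (collapse Y B)
    (collapse_induced B f) (collapse_induced B g)"
proof -
  let ?I = "top_of_set {0..1::real}"
  obtain h where h: "continuous_map (prod_topology ?I X) Y h"
    "\<And>x. h (0, x) = f x" "\<And>x. h (1, x) = g x"
    "\<And>t. t \<in> {0..1} \<Longrightarrow> (\<lambda>x. h (t, x)) ` A \<subseteq> B"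
    using assms(1) unfolding homotopic_with_def by blast
  define k where "k = (\<lambda>(t, z). collapse_induced B (\<lambda>x. h (t, x)) z)"
  have q: "quotient_map (prod_topology ?I X) (prod_topology ?I (collapse X A))
      (\<lambda>(t, x). (t, collapse_map A x))"
  proof (rule quotient_map_prod_right)
    show "locally_compact_space ?I"
      by (intro compact_imp_locally_compact_space) (simp add: compact_space_subtopology)
    show "Hausdorff_space ?I \<or> regular_space ?I"
      by (simp add: Hausdorff_space_subtopology)
    show "quotient_map X (collapse X A) (collapse_map A)"
      by (rule quotient_map_collapse[OF assms(2)])
  qed
  have "continuous_map (prod_topology ?I X) (collapse Y B) (collapse_map B \<circ> h)"
    using h(1) quotient_imp_continuous_map[OF quotient_map_collapse[OF assms(3)]]
    by (rule continuous_map_compose)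
  then have "continuous_map (prod_topology ?I X) (collapse Y B)
      (k \<circ> (\<lambda>(t, x). (t, collapse_map A x)))"
  proof (rule continuous_map_eq)
    fix p assume "p \<in> topspace (prod_topology ?I X)"
    then obtain t x where p: "p = (t, x)" "t \<in> {0..1}"
      by auto
    then have "h (t, x) \<in> B" if "x \<in> A"
      using that h(4)[of t] by blast
    then show "(collapse_map B \<circ> h) p = (k \<circ> (\<lambda>(t, x). (t, collapse_map A x))) p"
      by (simp add: p k_def collapse_induced_def)
  qed
  then have "continuous_map (prod_topology ?I (collapse X A)) (collapse Y B) k"
    by (rule continuous_compose_quotient_map[OF q])
  moreover have "k (0, z) = collapse_induced B f z" "k (1, z) = collapse_induced B g z" for z
    by (simp_all add: k_def h)
  ultimately show ?thesis
    unfolding homotopic_with_def by blast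
qed

text \<open>A homotopy equivalence of pairs, with homotopies respecting the subspaces, descends to
  the quotients.\<close>

lemma collapse_homotopy_equivalent:
  assumes f: "continuous_map X Y f" "f ` A \<subseteq> B" and g: "continuous_map Y X g" "g ` B \<subseteq> A"
    and gf: "homotopic_with (\<lambda>h. h ` A \<subseteq> A) X X (g \<circ> f) id"
    and fg: "homotopic_with (\<lambda>h. h ` B \<subseteq> B) Y Y (f \<circ> g) id"
    and ne: "topspace X \<inter> A \<noteq> {}" "topspace Y \<inter> B \<noteq> {}"
  shows "collapse X A homotopy_equivalent_space collapse Y B"
proof -
  have cont: "continuous_map (collapse X A) (collapse Y B) (collapse_induced B f)"
    if "continuous_map X Y f" "f ` A \<subseteq> B" "topspace X \<inter> A \<noteq> {}" "topspace Y \<inter> B \<noteq> {}"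
    for X :: "'x topology" and Y :: "'y topology" and f A B
  proof -
    have "homotopic_with (\<lambda>h. h ` A \<subseteq> B) X Y f f"
      using that by (simp add: homotopic_with_refl)
    from homotopic_collapse_induced[OF this that(3,4)] show ?thesis
      by (simp add: homotopic_with_refl)
  qed
  have comp: "collapse_induced A g \<circ> collapse_induced B f = collapse_induced A (g \<circ> f)"
    if "g ` B \<subseteq> A" for A :: "'x set" and B :: "'y set" and f g
    using that by (auto simp: collapse_induced_def fun_eq_iff split: option.splits)
  \<comment> \<open>\<open>collapse_induced A id\<close> differs from \<open>id\<close> at
    \<open>Some x\<close> for \<open>x\<close> in \<open>A\<close>, but such values lie outside the
    collapsed space.\<close>
  have idc: "homotopic_with (\<lambda>_. True) (collapse X A) (collapse X A) h id"
    if "homotopic_with (\<lambda>_. True) (collapse X A) (collapse X A) h (collapse_induced A id)"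
    for X :: "'x topology" and A h
    using that
    by (rule homotopic_with_eq) (auto simp: topspace_collapse collapse_induced_def)
  show ?thesis
    unfolding homotopy_equivalent_space_def
  proof (intro exI conjI)
    show "continuous_map (collapse X A) (collapse Y B) (collapse_induced B f)"
      by (rule cont[OF f ne])
    show "continuous_map (collapse Y B) (collapse X A) (collapse_induced A g)"
      by (rule cont[OF g ne(2,1)])
    show "homotopic_with (\<lambda>_. True) (collapse X A) (collapse X A)
        (collapse_induced A g \<circ> collapse_induced B f) id"
      unfolding comp[OF g(2)] by (rule idc[OF homotopic_collapse_induced[OF gf ne(1) ne(1)]])
    show "homotopic_with (\<lambda>_. True) (collapse Y B) (collapse Y B)
        (collapse_induced B f \<circ> collapse_induced A g) id"
      unfolding comp[OF f(2)] by (rule idc[OF homotopic_collapse_induced[OF fg ne(2) ne(2)]])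
  qed
qed

section \<open>Points of a realization and their supports\<close>

abbreviation points :: "'v set set \<Rightarrow> ('v \<Rightarrow> real) set" where
  "points K \<equiv> topspace (realization K)"

definition down_closed :: "'v set set \<Rightarrow> bool" where
  "down_closed K \<longleftrightarrow> (\<forall>F\<in>K. \<forall>F'. F' \<subseteq> F \<longrightarrow> F' \<in> K)"

lemma down_closedD: "down_closed K \<Longrightarrow> F \<in> K \<Longrightarrow> F' \<subseteq> F \<Longrightarrow> F' \<in> K"
  by (auto simp: down_closed_def)

text \<open>Replaces the unspecified face by the support of the point. Membership in different
  subcomplexes of one simplex then differs only in the condition on the support, while the sum
  always runs over the same set \<open>E\<close>.\<close>

lemma in_realization_iff:
  assumes "finite E" "K \<subseteq> Pow E" "down_closed K"
  shows "x \<in> points K \<longleftrightarrow>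
    (\<forall>v. 0 \<le> x v) \<and> (\<forall>v. v \<notin> E \<longrightarrow> x v = 0) \<and> sum x E = 1 \<and> {v. x v \<noteq> 0} \<in> K"
    (is "?l \<longleftrightarrow> ?r")
proof
  assume ?l
  then obtain F where F: "F \<in> K" "\<forall>v. 0 \<le> x v" "\<forall>v. v \<notin> F \<longrightarrow> x v = 0" "sum x F = 1"
    by (auto simp: realization_def)
  have "{v. x v \<noteq> 0} \<subseteq> F"
    using F(3) by auto
  then have "{v. x v \<noteq> 0} \<in> K"
    using down_closedD[OF assms(3) F(1)] by blast
  moreover have "sum x F = sum x E"
    using assms F(1,3) by (intro sum.mono_neutral_left) auto
  ultimately show ?r
    using F assms(2) by auto
next
  assume r: ?r
  have "sum x {v. x v \<noteq> 0} = sum x E"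
    using assms(1) r by (intro sum.mono_neutral_left) auto
  then have "{v. x v \<noteq> 0} \<in> K \<and> (\<forall>v. 0 \<le> x v) \<and> (\<forall>v. v \<notin> {v. x v \<noteq> 0} \<longrightarrow> x v = 0)
      \<and> sum x {v. x v \<noteq> 0} = 1"
    using r by simp
  then show ?l
    unfolding realization_def by (simp; blast)
qed

lemma continuous_map_realization_coordinate:
  "continuous_map (realization K) euclideanreal (\<lambda>x. x v)"
  unfolding realization_def
  by (intro continuous_map_from_subtopology continuous_map_product_projection) simp

lemma continuous_map_Min:
  assumes "finite T" "T \<noteq> {}" "\<And>v. v \<in> T \<Longrightarrow> continuous_map X euclideanreal (g v)"
  shows "continuous_map X euclideanreal (\<lambda>x. Min ((\<lambda>v. g v x) ` T))"
  using assms
proof (induction rule: finite_ne_induct)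
  case (singleton v)
  then show ?case by simp
next
  case (insert v T)
  then have "continuous_map X euclideanreal (\<lambda>x. min (g v x) (Min ((\<lambda>v. g v x) ` T)))"
    by (intro continuous_map_real_min) auto
  then show ?case
    using insert.hyps by simp
qed

lemma continuous_map_into_realization_iff:
  "continuous_map X (realization K) g \<longleftrightarrow>
    continuous_map X (powertop_real UNIV) g \<and> g ` topspace X \<subseteq> points K"
  unfolding realization_def
  by (simp add: continuous_map_in_subtopology image_subset_iff_funcset topspace_subtopology
      Int_absorb1)

lemma realization_mono: "K \<subseteq> L \<Longrightarrow> points K \<subseteq> points L"
  by (auto simp: realization_def)

text \<open>The map moves a point of the simplex \<open>insert f \<tau>\<close> away from its free face \<open>\<tau>\<close>. It is the identity
  wherever a coordinate in \<open>\<tau>\<close> vanishes, in particular on every subcomplex not containing \<open>\<tau>\<close>, and it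
  is defined on the full simplex; this replaces the homotopy extension property.\<close>

definition push :: "'v set \<Rightarrow> 'v \<Rightarrow> real \<Rightarrow> ('v \<Rightarrow> real) \<Rightarrow> 'v \<Rightarrow> real" where
  "push \<tau> f t x v = x v + t * Min (x ` \<tau>) * (if v \<in> \<tau> then -1 else if v = f then real (card \<tau>) else 0)"

lemma push_eq_self:
  assumes "finite \<tau>" "\<tau> \<noteq> {}" "\<And>v. 0 \<le> x v" "\<not> \<tau> \<subseteq> {v. x v \<noteq> 0}"
  shows "push \<tau> f t x = x"
proof -
  obtain v where "v \<in> \<tau>" "x v = 0"
    using assms(4) by auto
  then have "Min (x ` \<tau>) = 0"
    using assms by (intro Min_eqI) (auto simp: rev_image_eqI)
  then show ?thesis
    by (simp add: push_def fun_eq_iff)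
qed

text \<open>Each vertex of \<open>\<tau>\<close> loses the same amount, and the weight
  \<open>card \<tau>\<close> at \<open>f\<close> collects exactly these losses.\<close>

lemma sum_push:
  assumes "finite E" "\<tau> \<subseteq> E" "f \<in> E" "f \<notin> \<tau>"
  shows "sum (push \<tau> f t x) E = sum x E"
proof -
  have "(\<Sum>v\<in>E. if v \<in> \<tau> then -1 else if v = f then real (card \<tau>) else 0) =
      (\<Sum>v\<in>insert f \<tau>. if v \<in> \<tau> then -1 else if v = f then real (card \<tau>) else 0)"
    using assms by (intro sum.mono_neutral_right) auto
  also have "\<dots> = 0"
    using assms finite_subset[OF assms(2,1)] by (simp add: sum.If_cases Int_absorb1 flip: sum.cong)
  finally show ?thesis
    by (simp add: push_def sum.distrib flip: sum_distrib_left)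
qed

text \<open>The support can grow only by \<open>f\<close>, and only if all coordinates in
  \<open>\<tau>\<close> are positive; this is the situation covered by the last hypothesis. No
  coordinate becomes negative, since at most the minimum is subtracted.\<close>

lemma push_in_realization:
  assumes E: "finite E" "K \<subseteq> Pow E" "down_closed K"
    and \<tau>: "\<tau> \<noteq> {}" "\<tau> \<subseteq> E" "f \<in> E" "f \<notin> \<tau>" and t: "0 \<le> t" "t \<le> 1"
    and x: "x \<in> points K"
    and ins: "\<tau> \<subseteq> {v. x v \<noteq> 0} \<Longrightarrow> insert f {v. x v \<noteq> 0} \<in> K"
  shows "push \<tau> f t x \<in> points K"
proof (cases "\<tau> \<subseteq> {v. x v \<noteq> 0}")
  case False
  have "push \<tau> f t x = x"
    using x False finite_subset[OF \<tau>(2) E(1)] \<tau>(1) unfolding in_realization_iff[OF E]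
    by (intro push_eq_self) auto
  then show ?thesis
    using x by simp
next
  case True
  have fin: "finite \<tau>"
    using finite_subset[OF \<tau>(2) E(1)] .
  note x = x[unfolded in_realization_iff[OF E]]
  let ?m = "Min (x ` \<tau>)"
  have m0: "0 \<le> ?m"
    using x fin \<tau>(1) by simp
  have m: "?m \<le> x v" if "v \<in> \<tau>" for v
    using that fin by simp
  have "t * ?m \<le> x v" if "v \<in> \<tau>" for v
    using mult_right_mono[OF t(2) m0] m[OF that] by simp
  then have "0 \<le> push \<tau> f t x v" for v
    using x t m0 by (auto simp: push_def)
  moreover have "push \<tau> f t x v = 0" if "v \<notin> E" for v
    using that x \<tau> by (auto simp: push_def)
  moreover have "{v. push \<tau> f t x v \<noteq> 0} \<subseteq> insert f {v. x v \<noteq> 0}"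
    using True by (auto simp: push_def split: if_splits)
  then have "{v. push \<tau> f t x v \<noteq> 0} \<in> K"
    using down_closedD[OF E(3) ins[OF True]] by blast
  ultimately show ?thesis
    unfolding in_realization_iff[OF E] using x sum_push[OF E(1) \<tau>(2-4)] by simp
qed

text \<open>At time 1 a coordinate that attains the minimum over \<open>\<tau>\<close> has become
  zero. The support therefore no longer contains \<open>\<tau>\<close>, and the point has left both
  cells of the pair.\<close>

lemma push_1_in_realization:
  assumes E: "finite E" "K \<subseteq> Pow E" "down_closed K" "down_closed L"
    and \<tau>: "\<tau> \<noteq> {}" "\<tau> \<subseteq> E" "f \<in> E" "f \<notin> \<tau>"
    and K: "K = L \<union> {\<tau>, insert f \<tau>}" and L: "\<tau> \<notin> L"
    and x: "x \<in> points K"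
  shows "push \<tau> f 1 x \<in> points L"
proof -
  have LE: "L \<subseteq> Pow E"
    using E(2) K by blast
  have fin: "finite \<tau>"
    using finite_subset[OF \<tau>(2) E(1)] .
  have supp: "{v. x v \<noteq> 0} \<in> K"
    using x unfolding in_realization_iff[OF E(1-3)] by blast
  have pK: "push \<tau> f 1 x \<in> points K"
  proof (rule push_in_realization[OF E(1-3) \<tau> _ _ x])
    assume "\<tau> \<subseteq> {v. x v \<noteq> 0}"
    then have "{v. x v \<noteq> 0} \<notin> L"
      using L down_closedD[OF E(4)] by blast
    then have "{v. x v \<noteq> 0} = \<tau> \<or> {v. x v \<noteq> 0} = insert f \<tau>"
      using supp K by blast
    then show "insert f {v. x v \<noteq> 0} \<in> K"
      using K by auto
  qed auto
  have "Min (x ` \<tau>) \<in> x ` \<tau>"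
    using fin \<tau>(1) by (intro Min_in) auto
  then obtain v where v: "v \<in> \<tau>" "x v = Min (x ` \<tau>)"
    by auto
  then have "push \<tau> f 1 x v = 0"
    by (simp add: push_def)
  then have "{v. push \<tau> f 1 x v \<noteq> 0} \<notin> {\<tau>, insert f \<tau>}"
    using v(1) by auto
  then show ?thesis
    using pK K unfolding in_realization_iff[OF E(1) E(2,3)] in_realization_iff[OF E(1) LE E(4)]
    by blast
qed

lemma homotopic_push:
  assumes "finite \<tau>" "\<tau> \<noteq> {}"
    and "\<And>t x. 0 \<le> t \<Longrightarrow> t \<le> 1 \<Longrightarrow> x \<in> points K \<Longrightarrow>
      push \<tau> f t x \<in> points K"
    and "\<And>t. 0 \<le> t \<Longrightarrow> t \<le> 1 \<Longrightarrow> P (push \<tau> f t)"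
  shows "homotopic_with P (realization K) (realization K) (push \<tau> f 1) id"
proof -
  let ?I = "top_of_set {0..1::real}"
  let ?X = "prod_topology ?I (realization K)"
  have coord: "continuous_map ?X euclideanreal (\<lambda>p. snd p v)" for v
    using continuous_map_compose[OF continuous_map_snd continuous_map_realization_coordinate]
    by (simp add: o_def)
  have time: "continuous_map ?X euclideanreal fst"
    using continuous_map_compose[OF continuous_map_fst continuous_map_from_subtopology[OF continuous_map_id]]
    by (simp add: o_def)
  have "continuous_map ?X (powertop_real UNIV) (\<lambda>p. push \<tau> f (fst p) (snd p))"
    unfolding continuous_map_componentwise_UNIV push_def
    by (intro allI continuous_map_add continuous_map_real_mult coord time continuous_map_Min assms)
      auto
  then have "continuous_map ?X (realization K) (\<lambda>p. push \<tau> f (fst p) (snd p))"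
    using assms(3) unfolding continuous_map_into_realization_iff by auto
  moreover have "push \<tau> f 0 x = x" for x
    by (simp add: push_def fun_eq_iff)
  ultimately have "homotopic_with P (realization K) (realization K) id (push \<tau> f 1)"
    unfolding homotopic_with_def using assms(4)
    by (intro exI[of _ "\<lambda>p. push \<tau> f (fst p) (snd p)"]) auto
  then show ?thesis
    by (rule homotopic_with_symD)
qed

text \<open>The closure condition is vacuous for complexes without a face containing
  \<open>\<tau>\<close>, such as \<open>L\<close> and \<open>L0\<close> below, and holds for
  \<open>K\<close> and the full simplex.\<close>

lemma push_invariant:
  assumes E: "finite E" "M \<subseteq> Pow E" "down_closed M"
    and \<tau>: "\<tau> \<noteq> {}" "\<tau> \<subseteq> E" "f \<in> E" "f \<notin> \<tau>" and t: "0 \<le> t" "t \<le> 1"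
    and M: "\<And>F. F \<in> M \<Longrightarrow> \<tau> \<subseteq> F \<Longrightarrow> insert f F \<in> M"
  shows "push \<tau> f t ` points M \<subseteq> points M"
proof (rule image_subsetI)
  fix x assume x: "x \<in> points M"
  show "push \<tau> f t x \<in> points M"
    by (rule push_in_realization[OF E \<tau> t x]) (use M x in \<open>simp add: in_realization_iff[OF E]\<close>)
qed

text \<open>In both cases \<open>push \<tau> f 1\<close> is inverse, up to homotopy, to the map
  induced by the identity. The first equivalence absorbs a pair into the subcomplex that is
  collapsed; the second removes a pair from the total space while the collapsed subcomplex
  \<open>L0\<close> is kept.\<close>

lemma pair_collapse_equivalences:
  fixes L L0 :: "'v set set" and \<tau> :: "'v set" and f :: 'v
  defines "K \<equiv> L \<union> {\<tau>, insert f \<tau>}"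
  assumes E: "finite E" "K \<subseteq> Pow E" "down_closed K" "down_closed L" "down_closed L0" "L0 \<subseteq> L"
    and disj: "\<tau> \<notin> L" "f \<notin> \<tau>" and ne: "points L0 \<noteq> {}"
  shows "collapse (realization (Pow E)) (points L) homotopy_equivalent_space
      collapse (realization (Pow E)) (points K)" (is ?th1)
    and "collapse (realization L) (points L0) homotopy_equivalent_space
      collapse (realization K) (points L0)" (is ?th2)
proof -
  have LE: "L \<subseteq> Pow E" and L0E: "L0 \<subseteq> Pow E"
    using E by (auto simp: K_def)
  have \<tau>: "\<tau> \<subseteq> E" "f \<in> E" "finite \<tau>"
    using E(1,2) finite_subset by (auto simp: K_def)
  have L0L: "points L0 \<subseteq> points L"
    by (rule realization_mono[OF E(6)])
  have LK: "points L \<subseteq> points K"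
    by (rule realization_mono) (auto simp: K_def)
  have KP: "points K \<subseteq> points (Pow E)"
    by (rule realization_mono[OF E(2)])
  obtain x0 where x0: "x0 \<in> points L0"
    using ne by blast
  \<comment> \<open>The empty face lies in \<open>L\<close>, so \<open>\<tau>\<close> is not empty
    and the minimum over \<open>\<tau>\<close> makes sense.\<close>
  then have "L0 \<noteq> {}"
    by (auto simp: realization_def)
  then have "{} \<in> L"
    using down_closedD[OF E(5)] E(6) by blast
  then have \<tau>0: "\<tau> \<noteq> {}"
    using disj(1) by blast
  have notL: "\<not> \<tau> \<subseteq> F" if "F \<in> L" for F
    using that disj(1) down_closedD[OF E(4)] by blast
  have insK: "insert f F \<in> K" if "F \<in> K" "\<tau> \<subseteq> F" for F
    using that notL[of F] by (auto simp: K_def)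
  have invL: "push \<tau> f t ` points L \<subseteq> points L"
    if "0 \<le> t" "t \<le> 1" for t
    by (rule push_invariant[OF E(1) LE E(4) \<tau>0 \<tau>(1,2) disj(2) that]) (use notL in blast)
  have invL0: "push \<tau> f t ` points L0 \<subseteq> points L0"
    if "0 \<le> t" "t \<le> 1" for t
    by (rule push_invariant[OF E(1) L0E E(5) \<tau>0 \<tau>(1,2) disj(2) that]) (use notL E(6) in blast)
  have invK: "push \<tau> f t ` points K \<subseteq> points K"
    if "0 \<le> t" "t \<le> 1" for t
    by (rule push_invariant[OF E(1-3) \<tau>0 \<tau>(1,2) disj(2) that]) (use insK in blast)
  have invP: "push \<tau> f t ` points (Pow E) \<subseteq> points (Pow E)"
    if "0 \<le> t" "t \<le> 1" for t
    by (rule push_invariant[OF E(1) _ _ \<tau>0 \<tau>(1,2) disj(2) that])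
       (use \<tau>(2) in \<open>auto simp: down_closed_def\<close>)
  have onto: "push \<tau> f 1 ` points K \<subseteq> points L"
    using push_1_in_realization[OF E(1-4) \<tau>0 \<tau>(1,2) disj(2) _ disj(1)] by (auto simp: K_def)
  have hP: "homotopic_with (\<lambda>h. h ` points M \<subseteq> points M)
      (realization (Pow E)) (realization (Pow E)) (push \<tau> f 1) id" if "M \<in> {K, L}" for M
  proof (rule homotopic_push[OF \<tau>(3) \<tau>0])
    fix t :: real assume t: "0 \<le> t" "t \<le> 1"
    show "push \<tau> f t x \<in> points (Pow E)"
      if "x \<in> points (Pow E)" for x
      using invP[OF t] that by (rule subsetD[OF _ imageI])
    show "push \<tau> f t ` points M \<subseteq> points M"
      using \<open>M \<in> {K, L}\<close> invL[OF t] invK[OF t] by (elim insertE) simp_all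
  qed
  have hM: "homotopic_with (\<lambda>h. h ` points L0 \<subseteq> points L0)
      (realization M) (realization M) (push \<tau> f 1) id" if "M \<in> {K, L}" for M
  proof (rule homotopic_push[OF \<tau>(3) \<tau>0])
    fix t :: real assume t: "0 \<le> t" "t \<le> 1"
    have "push \<tau> f t ` points M \<subseteq> points M"
      using \<open>M \<in> {K, L}\<close> invL[OF t] invK[OF t] by (elim insertE) simp_all
    then show "push \<tau> f t x \<in> points M" if "x \<in> points M" for x
      using that by (rule subsetD[OF _ imageI])
    show "push \<tau> f t ` points L0 \<subseteq> points L0"
      by (rule invL0[OF t])
  qed
  show ?th1
  proof (rule collapse_homotopy_equivalent[where f = id and g = "push \<tau> f 1"])
    show "continuous_map (realization (Pow E)) (realization (Pow E)) (push \<tau> f 1)"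
      using hP by (blast dest: homotopic_with_imp_continuous_maps)
    show "homotopic_with (\<lambda>h. h ` points L \<subseteq> points L)
      (realization (Pow E)) (realization (Pow E)) (push \<tau> f 1 \<circ> id) id"
      "homotopic_with (\<lambda>h. h ` points K \<subseteq> points K)
      (realization (Pow E)) (realization (Pow E)) (id \<circ> push \<tau> f 1) id"
      using hP by simp_all
    show "points (Pow E) \<inter> points L \<noteq> {}"
      "points (Pow E) \<inter> points K \<noteq> {}"
      using x0 L0L LK KP by blast+
  qed (use LK onto in simp_all)
  have cont: "continuous_map (realization L) (realization K) id"
    using LK continuous_map_id[of "realization L"]
    unfolding continuous_map_into_realization_iff by auto
  have contp: "continuous_map (realization K) (realization L) (push \<tau> f 1)"
    using onto homotopic_with_imp_continuous_maps[OF hM[of K]]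
    unfolding continuous_map_into_realization_iff by blast
  show ?th2
  proof (rule collapse_homotopy_equivalent[where f = id and g = "push \<tau> f 1", OF cont _ contp])
    show "homotopic_with (\<lambda>h. h ` points L0 \<subseteq> points L0)
      (realization L) (realization L) (push \<tau> f 1 \<circ> id) id"
      "homotopic_with (\<lambda>h. h ` points L0 \<subseteq> points L0)
      (realization K) (realization K) (id \<circ> push \<tau> f 1) id"
      using hM by simp_all
    show "points L \<inter> points L0 \<noteq> {}"
      "points K \<inter> points L0 \<noteq> {}"
      using x0 L0L LK by blast+
  qed (use invL0[of 1] in simp_all)
qed

text \<open>The attaching order is what keeps every intermediate stage a complex: no face of a cell
  in \<open>S\<close> can belong to \<open>T\<close>.\<close>

lemma down_closed_Un_initial:
  assumes "down_closed (L \<union> (S \<union> T))" "down_closed L" "L \<inter> T = {}"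
    and "\<And>s t. s \<in> S \<Longrightarrow> t \<in> T \<Longrightarrow> \<not> t \<subseteq> s"
  shows "down_closed (L \<union> S)"
  unfolding down_closed_def
proof (intro ballI allI impI)
  fix F F' assume F: "F \<in> L \<union> S" "F' \<subseteq> F"
  then have "F' \<in> L \<union> (S \<union> T)"
    using down_closedD[OF assms(1)] by blast
  moreover have "F' \<notin> T"
    using F assms(3,4) down_closedD[OF assms(2), of F F'] by blast
  ultimately show "F' \<in> L \<union> S"
    by blast
qed

text \<open>The pairs are attached one at a time. \<open>L\<close> grows along the induction, while
  the ambient simplex and \<open>L0\<close> stay fixed.\<close>

lemma expansion_collapse_equivalences:
  assumes "expansion S" and E: "finite E" "L \<union> S \<subseteq> Pow E" "down_closed (L \<union> S)" "down_closed L"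
    "down_closed L0" "L0 \<subseteq> L" and disj: "L \<inter> S = {}" and ne: "points L0 \<noteq> {}"
  shows "collapse (realization (Pow E)) (points L) homotopy_equivalent_space
      collapse (realization (Pow E)) (points (L \<union> S))
    \<and> collapse (realization L) (points L0) homotopy_equivalent_space
      collapse (realization (L \<union> S)) (points L0)"
  using assms(1) E(2-4,6) disj
proof (induction arbitrary: L rule: expansion.induct)
  case empty
  then show ?case
    by (simp add: homotopy_equivalent_space_refl)
next
  case (pair \<tau> f)
  then have "\<tau> \<notin> L"
    by blast
  note P = pair_collapse_equivalences[OF E(1) pair.prems(1-3) E(5) pair.prems(4) this pair.hyps(2) ne]
  show ?case
    using P by blast
next
  case (union S T)
  have "down_closed (L \<union> S)"
    using union.prems(2,3,5) union.hyps(3) by (intro down_closed_Un_initial[of L S T]) auto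
  note S = union.IH(1)[OF _ this union.prems(3,4)]
  note T = union.IH(2)[of "L \<union> S", OF _ _ \<open>down_closed (L \<union> S)\<close>]
  have "S \<inter> T = {}"
    using union.hyps(3) by blast
  then have "L \<union> S \<union> T \<subseteq> Pow E" "L0 \<subseteq> L \<union> S" "(L \<union> S) \<inter> T = {}" "down_closed (L \<union> S \<union> T)"
    "L \<union> S \<subseteq> Pow E" "L \<inter> S = {}"
    using union.prems by (auto simp: Un_assoc)
  note S = S[OF this(5,6)] and T = T[OF this(1,4,2,3)]
  show ?case
    using S T unfolding Un_assoc
    by (blast intro: homotopy_eqv_trans)
qed

section \<open>Attached cells and wedges of spheres\<close>

abbreviation base_point :: "nat \<Rightarrow> real" where
  "base_point \<equiv> \<lambda>i. if i = 0 then 1 else 0"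

text \<open>The universal property of the collapse. It also covers the case that \<open>A\<close>
  misses \<open>X\<close>, in which the value at the isolated point \<open>None\<close> must be
  controlled separately.\<close>

lemma continuous_map_from_collapse:
  assumes "F None \<in> topspace Z" and "continuous_map X Z (F \<circ> collapse_map A)"
  shows "continuous_map (collapse X A) Z F"
  unfolding continuous_map_def
proof (intro conjI allI impI)
  have im: "F (collapse_map A x) \<in> topspace Z" if "x \<in> topspace X" for x
    using funcset_mem[OF continuous_map_funspace[OF assms(2)] that] by (simp add: o_def)
  have "F (Some x) \<in> topspace Z" if "x \<in> topspace X" "x \<notin> A" for x
    using im[OF that(1)] that(2) by simp
  then show "F \<in> topspace (collapse X A) \<rightarrow> topspace Z"
    using assms(1) by (auto simp: topspace_collapse)
  fix U assume U: "openin Z U"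
  have "{x \<in> topspace X. collapse_map A x \<in> {z \<in> topspace (collapse X A). F z \<in> U}} =
      {x \<in> topspace X. (F \<circ> collapse_map A) x \<in> U}"
    by (auto simp: topspace_collapse)
  then show "openin (collapse X A) {z \<in> topspace (collapse X A). F z \<in> U}"
    using openin_continuous_map_preimage[OF assms(2) U]
    unfolding openin_collapse by (auto simp: topspace_collapse)
qed

lemma continuous_map_from_sum_topology:
  assumes "\<And>i. i \<in> I \<Longrightarrow> continuous_map (X i) Y (\<lambda>x. f (i, x))"
  shows "continuous_map (sum_topology X I) Y f"
  unfolding continuous_map_def
proof (intro conjI allI impI)
  show "f \<in> topspace (sum_topology X I) \<rightarrow> topspace Y"
    using continuous_map_funspace[OF assms] by (fastforce simp: Pi_iff)
  fix U assume U: "openin Y U"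
  have "{x. (i, x) \<in> {z \<in> topspace (sum_topology X I). f z \<in> U}} = {x \<in> topspace (X i). f (i, x) \<in> U}"
    if "i \<in> I" for i
    using that by auto
  then show "openin (sum_topology X I) {z \<in> topspace (sum_topology X I). f z \<in> U}"
    using openin_continuous_map_preimage[OF assms U]
    unfolding openin_sum_topology by auto
qed

abbreviation sphere_bouquet :: "nat \<Rightarrow> nat \<Rightarrow> (nat \<times> (nat \<Rightarrow> real)) option topology" where
  "sphere_bouquet k d \<equiv> collapse (sum_topology (\<lambda>_. nsphere d) {..<k}) ({..<k} \<times> {base_point})"

text \<open>The bouquet maps continuously and injectively into a product of lines: each sphere is
  translated so that its base point becomes the origin, and different spheres use disjoint blocks of
  coordinates.\<close>

lemma Hausdorff_sphere_bouquet: "Hausdorff_space (sphere_bouquet k d)"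
proof -
  let ?F = "\<lambda>z (j, i). case z of None \<Rightarrow> 0
    | Some (l, p) \<Rightarrow> if l = j then p i - base_point i else (0::real)"
  have "continuous_map (sphere_bouquet k d) (powertop_real UNIV) ?F"
  proof (rule continuous_map_from_collapse)
    show "continuous_map (sum_topology (\<lambda>_. nsphere d) {..<k}) (powertop_real UNIV)
        (?F \<circ> collapse_map ({..<k} \<times> {base_point}))"
    proof (rule continuous_map_from_sum_topology)
      fix l assume l: "l \<in> {..<k}"
      show "continuous_map (nsphere d) (powertop_real UNIV)
        (\<lambda>p. (?F \<circ> collapse_map ({..<k} \<times> {base_point})) (l, p))"
        unfolding continuous_map_componentwise_UNIV
      proof
        fix ji :: "nat \<times> nat"
        obtain j i where ji: "ji = (j, i)"
          by (cases ji)
        have "continuous_map (nsphere d) euclideanreal (\<lambda>p. if l = j then p i - base_point i else 0)"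
          by (simp add: continuous_map_diff continuous_map_nsphere_projection)
        then show "continuous_map (nsphere d) euclideanreal
            (\<lambda>p. (?F \<circ> collapse_map ({..<k} \<times> {base_point})) (l, p) ji)"
          by (rule continuous_map_eq) (simp add: ji l)
      qed
    qed
  qed simp
  moreover have "inj_on ?F (topspace (sphere_bouquet k d))"
  proof (rule inj_onI)
    have none: "?F (Some (j, p)) \<noteq> ?F None" if p: "p \<noteq> base_point" for j p
    proof -
      obtain i where "p i \<noteq> base_point i"
        using p ext[of p base_point] by blast
      then have "?F (Some (j, p)) (j, i) \<noteq> ?F None (j, i)"
        by simp
      then show ?thesis
        by metis
    qed
    have some_eq: "j = l \<and> p = q" if p: "p \<noteq> base_point" "?F (Some (j, p)) = ?F (Some (l, q))" for j l p q
    proof -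
      obtain i where i: "p i \<noteq> base_point i"
        using p(1) ext[of p base_point] by blast
      have eq: "?F (Some (j, p)) (j, i) = ?F (Some (l, q)) (j, i)" for i
        by (rule fun_cong[OF p(2)])
      have jl: "j = l"
      proof (rule ccontr)
        assume "j \<noteq> l"
        then have "p i - base_point i = 0"
          using eq[of i] by simp
        then show False
          using i by simp
      qed
      have "p i = q i" for i
        using eq[of i] jl by simp
      then show ?thesis
        using jl by auto
    qed
    fix z w assume z: "z \<in> topspace (sphere_bouquet k d)" "w \<in> topspace (sphere_bouquet k d)"
      and eq: "?F z = ?F w"
    have base: "p \<noteq> base_point" if "Some (j, p) \<in> topspace (sphere_bouquet k d)" for j p
      using that unfolding topspace_collapse by auto
    show "z = w"
    proof (cases z)
      case None
      show ?thesis
      proof (cases w)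
        case (Some jp)
        obtain j p where jp: "jp = (j, p)"
          by (cases jp)
        have "p \<noteq> base_point"
          using z(2) unfolding Some jp by (rule base)
        then have "?F (Some (j, p)) \<noteq> ?F None"
          by (rule none)
        moreover have "?F None = ?F (Some (j, p))"
          using eq unfolding None Some jp .
        ultimately show ?thesis
          by (elim notE) (rule sym)
      qed (use None in simp)
    next
      case (Some jp)
      obtain j p where jp: "jp = (j, p)"
        by (cases jp)
      have p: "p \<noteq> base_point"
        using z(1) unfolding Some jp by (rule base)
      show ?thesis
      proof (cases w)
        case None
        have "?F (Some (j, p)) = ?F None"
          using eq unfolding None Some jp .
        then show ?thesis
          by (rule notE[OF none[OF p]])
      next
        case (Some lq)
        obtain l q where lq: "lq = (l, q)"
          by (cases lq)
        have "?F (Some (j, p)) = ?F (Some (l, q))"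
          using eq unfolding \<open>z = Some jp\<close> Some jp lq .
        from some_eq[OF p this] show ?thesis
          unfolding \<open>z = Some jp\<close> Some jp lq by simp
      qed
    qed
  qed
  ultimately show ?thesis
    by (rule Hausdorff_space_injective_preimage[rotated]) (simp add: Hausdorff_space_product_topology)
qed

section \<open>A simplex modulo its boundary is a sphere\<close>

lemma compact_closed_realization:
  fixes K :: "'v set set"
  assumes "finite K" "\<And>F. F \<in> K \<Longrightarrow> finite F"
  shows "compactin (powertop_real UNIV) (points K)"
    and "closedin (powertop_real UNIV) (points K)"
proof -
  let ?C = "\<lambda>F. {x. (\<forall>v. 0 \<le> x v) \<and> (\<forall>v. v \<notin> F \<longrightarrow> x v = 0) \<and> sum x F = (1::real)}"
  have "closed (?C F)" for F :: "'v set"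
  proof -
    have "?C F = (\<Inter>v. {x. 0 \<le> x v}) \<inter> (\<Inter>v\<in>-F. {x. x v = 0}) \<inter> {x. sum x F = 1}"
      by auto
    then show ?thesis
      by (auto intro!: closed_Int closed_INT closed_Collect_le closed_Collect_eq continuous_intros)
  qed
  moreover have eq: "points K = (\<Union>F\<in>K. ?C F)"
    by (auto simp: realization_def)
  ultimately show cl: "closedin (powertop_real UNIV) (points K)"
    using assms(1) unfolding euclidean_product_topology by (simp add: closed_UN)
  have "compactin (powertop_real UNIV) (\<Pi>\<^sub>E v\<in>UNIV. {0..1})"
    unfolding compactin_PiE by simp
  moreover have "points K \<subseteq> (\<Pi>\<^sub>E v\<in>UNIV. {0..1})"
  proof
    fix x assume "x \<in> points K"
    then obtain F where F: "F \<in> K" "x \<in> ?C F"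
      unfolding eq by blast
    have "x v \<le> 1" for v
    proof (cases "v \<in> F")
      case True
      then show ?thesis
        using member_le_sum[of v F x] F assms(2) by auto
    qed (use F in auto)
    then show "x \<in> (\<Pi>\<^sub>E v\<in>UNIV. {0..1})"
      using F by auto
  qed
  ultimately show "compactin (powertop_real UNIV) (points K)"
    using cl by (rule closed_compactin)
qed

text \<open>The quotient of a simplex by its boundary, written in barycentric coordinates. Inverse
  stereographic projection from \<open>base_point\<close> is applied to the differences
  \<open>y i - y 0\<close> divided by the minimum \<open>s\<close>; clearing the denominators
  \<open>s\<close> makes the formula meaningful on the boundary too, where \<open>s = 0\<close> and
  the value is \<open>base_point\<close>.\<close>

definition stereo :: "nat \<Rightarrow> (nat \<Rightarrow> real) \<Rightarrow> nat \<Rightarrow> real" where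
  "stereo d y i =
    (let s = Min (y ` {..d}); q = (\<Sum>j\<le>d. (y j - y 0)\<^sup>2) in
     if i = 0 then (q - s\<^sup>2) / (q + s\<^sup>2) else if i \<le> d then 2 * s * (y i - y 0) / (q + s\<^sup>2) else 0)"

text \<open>If both squares vanish, all coordinates are equal and their minimum is zero, which
  contradicts the sum 1.\<close>

lemma stereo_denominator_pos:
  fixes y :: "nat \<Rightarrow> real"
  assumes "(\<Sum>j\<le>d. y j) = 1"
  shows "0 < (\<Sum>j\<le>d. (y j - y 0)\<^sup>2) + (Min (y ` {..d}))\<^sup>2"
proof (rule ccontr)
  let ?q = "\<Sum>j\<le>d. (y j - y 0)\<^sup>2" and ?s = "Min (y ` {..d})"
  assume "\<not> ?thesis"
  then have neg: "?q + ?s\<^sup>2 \<le> 0"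
    by simp
  have q: "0 \<le> ?q"
    by (simp add: sum_nonneg)
  have s2: "0 \<le> ?s\<^sup>2"
    by (rule zero_le_power2)
  have "?q + ?s\<^sup>2 = 0"
    using neg add_nonneg_nonneg[OF q s2] by (rule order_antisym)
  then have "?q = 0" and s20: "?s\<^sup>2 = 0"
    using add_nonneg_eq_0_iff[OF q s2] by blast+
  have s: "?s = 0"
    by (rule iffD1[OF zero_eq_power2 s20])
  have y: "y j = y 0" if "j \<le> d" for j
  proof -
    have "(y j - y 0)\<^sup>2 = 0"
      using that \<open>?q = 0\<close> sum_nonneg_eq_0_iff[of "{..d}" "\<lambda>j. (y j - y 0)\<^sup>2"]
      by (meson atMost_iff finite_atMost zero_le_power2)
    then show ?thesis
      by simp
  qed
  have "y ` {..d} = (\<lambda>_. y 0) ` {..d}"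
    by (rule image_cong[OF refl], rule y, rule iffD1[OF atMost_iff])
  then have "y 0 = 0"
    using s by simp
  have "y j = 0" if "j \<in> {..d}" for j
    using y[OF iffD1[OF atMost_iff that]] \<open>y 0 = 0\<close> by (rule trans)
  then have "(\<Sum>j\<le>d. y j) = 0"
    by (rule sum.neutral[OF ballI])
  then show False
    using assms by simp
qed

lemma stereo_in_nsphere:
  assumes "(\<Sum>j\<le>d. y j) = 1"
  shows "stereo d y \<in> topspace (nsphere d)"
proof -
  define s where "s = Min (y ` {..d})"
  define q where "q = (\<Sum>j\<le>d. (y j - y 0)\<^sup>2)"
  have pos: "0 < q + s\<^sup>2"
    using stereo_denominator_pos[OF assms] by (simp add: s_def q_def)
  have q: "q = (\<Sum>i\<in>{1..d}. (y i - y 0)\<^sup>2)"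
    unfolding q_def by (rule sum.mono_neutral_right) (auto simp: Suc_le_eq)
  have "{..d} = insert 0 {1..d}"
    by auto
  then have "(\<Sum>i\<le>d. (stereo d y i)\<^sup>2) = (stereo d y 0)\<^sup>2 + (\<Sum>i\<in>{1..d}. (stereo d y i)\<^sup>2)"
    by simp
  also have "(\<Sum>i\<in>{1..d}. (stereo d y i)\<^sup>2) = (\<Sum>i\<in>{1..d}. (2 * s / (q + s\<^sup>2))\<^sup>2 * (y i - y 0)\<^sup>2)"
    by (rule sum.cong) (auto simp: stereo_def power_mult_distrib power_divide simp flip: s_def q_def)
  also have "\<dots> = (2 * s / (q + s\<^sup>2))\<^sup>2 * q"
    by (simp add: q sum_distrib_left)
  also have "(stereo d y 0)\<^sup>2 = ((q - s\<^sup>2) / (q + s\<^sup>2))\<^sup>2"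
    by (simp add: stereo_def flip: s_def q_def)
  also have "((q - s\<^sup>2) / (q + s\<^sup>2))\<^sup>2 + (2 * s / (q + s\<^sup>2))\<^sup>2 * q
      = ((q - s\<^sup>2)\<^sup>2 + 4 * s\<^sup>2 * q) / (q + s\<^sup>2)\<^sup>2"
    by (simp add: power_divide power_mult_distrib add_divide_distrib)
  also have "(q - s\<^sup>2)\<^sup>2 + 4 * s\<^sup>2 * q = (q + s\<^sup>2)\<^sup>2"
    by (simp add: power2_eq_square algebra_simps)
  finally have "(\<Sum>i\<le>d. (stereo d y i)\<^sup>2) = 1"
    using pos by simp
  then show ?thesis
    by (simp add: nsphere stereo_def)
qed

lemma stereo_eq_base_point_iff:
  assumes "(\<Sum>j\<le>d. y j) = 1"
  shows "stereo d y = base_point \<longleftrightarrow> Min (y ` {..d}) = 0"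
proof -
  note pos = stereo_denominator_pos[OF assms]
  show ?thesis
  proof
    assume "stereo d y = base_point"
    then have "stereo d y 0 = 1"
      by simp
    then show "Min (y ` {..d}) = 0"
      using pos by (simp add: stereo_def Let_def field_simps)
  next
    assume "Min (y ` {..d}) = 0"
    then show "stereo d y = base_point"
      using pos by (auto simp: stereo_def fun_eq_iff)
  qed
qed

text \<open>Where the minimum \<open>s\<close> of the coordinates is positive, \<open>stereo\<close> is the inverse stereographic
  projection of the vector with entries \<open>(y i - y 0) / s\<close>.\<close>

lemma stereo_ratio:
  assumes "(\<Sum>j\<le>d. y j) = 1" "0 < Min (y ` {..d})" "i \<le> d"
  shows "(y i - y 0) / Min (y ` {..d}) = (if i = 0 then 0 else stereo d y i / (1 - stereo d y 0))"
proof -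
  define s where "s = Min (y ` {..d})"
  define q where "q = (\<Sum>j\<le>d. (y j - y 0)\<^sup>2)"
  have s: "0 < s" and pos: "0 < q + s\<^sup>2"
    using stereo_denominator_pos[OF assms(1)] assms(2) by (simp_all add: s_def q_def)
  have "1 - stereo d y 0 = 2 * s\<^sup>2 / (q + s\<^sup>2)"
    using pos by (simp add: stereo_def field_simps flip: s_def q_def)
  moreover have "stereo d y i = 2 * s * (y i - y 0) / (q + s\<^sup>2)" if "i \<noteq> 0"
    using that assms(3) by (simp add: stereo_def flip: s_def q_def)
  ultimately show ?thesis
    using s pos unfolding s_def[symmetric] by (simp add: power2_eq_square)
qed

lemma Min_image_scale_shift:
  fixes w :: "nat \<Rightarrow> real"
  assumes "0 < c"
  shows "Min ((\<lambda>i. c * w i + a) ` {..d}) = c * Min (w ` {..d}) + a"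
  using mono_Min_commute[of "\<lambda>x. c * x + a" "w ` {..d}"] assms
  by (simp add: image_image monoI)

text \<open>The image determines the ratios \<open>w i\<close> of \<open>y i - y 0\<close> to the
  minimum \<open>s\<close>. Comparing minima gives \<open>y 0 = s - s * Min w\<close>, so
  \<open>y\<close> is known up to the factor \<open>s\<close>, and the sum 1 fixes
  \<open>s\<close>.\<close>

lemma stereo_inj:
  assumes y: "(\<Sum>j\<le>d. y j) = 1" "0 < Min (y ` {..d})" and z: "(\<Sum>j\<le>d. z j) = 1" "0 < Min (z ` {..d})"
    and eq: "stereo d y = stereo d z" and "i \<le> d"
  shows "y i = z i"
proof -
  define w where "w i = (if i = 0 then 0 else stereo d y i / (1 - stereo d y 0))" for i
  have main: "x i = (w i + 1 - Min (w ` {..d})) * s \<and> s * (\<Sum>j\<le>d. w j + 1 - Min (w ` {..d})) = 1"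
    if x: "(\<Sum>j\<le>d. x j) = 1" "0 < Min (x ` {..d})" "stereo d x = stereo d y" "i \<le> d"
      "s = Min (x ` {..d})" for x s i
  proof -
    have r: "(x j - x 0) / s = w j" if "j \<le> d" for j
      using stereo_ratio[OF x(1,2) that] x(3,5) by (simp add: w_def)
    have xj: "x j = s * w j + x 0" if "j \<le> d" for j
      using r[OF that] x(2,5) by (simp add: field_simps)
    have "x ` {..d} = (\<lambda>j. s * w j + x 0) ` {..d}"
      by (rule image_cong[OF refl], rule xj, rule iffD1[OF atMost_iff])
    then have "Min (x ` {..d}) = s * Min (w ` {..d}) + x 0"
      using Min_image_scale_shift[of s w "x 0" d] x(2,5) by simp
    then have x0: "x 0 = s - s * Min (w ` {..d})"
      using x(5) by linarith
    have xs: "x j = (w j + 1 - Min (w ` {..d})) * s" if "j \<le> d" for j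
      using xj[OF that] x0 by (simp add: algebra_simps)
    have "(\<Sum>j\<le>d. (w j + 1 - Min (w ` {..d})) * s) = 1"
      using x(1) xs by simp
    then show ?thesis
      using xs[OF x(4)] by (simp add: sum_distrib_left mult.commute)
  qed
  define s t where "s = Min (y ` {..d})" and "t = Min (z ` {..d})"
  note a = main[OF y refl assms(6) s_def] and b = main[OF z eq[symmetric] assms(6) t_def]
  let ?c = "\<Sum>j\<le>d. w j + 1 - Min (w ` {..d})"
  have "s * ?c = 1" "t * ?c = 1"
    using a b by blast+
  then have "s = t"
    using mult_right_cancel[of ?c s t] by force
  then show ?thesis
    using a b by simp
qed

text \<open>The point \<open>p\<close> is projected stereographically to \<open>w\<close>;
  \<open>u\<close> is the translate of \<open>w\<close> with minimum 1, and division by its total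
  \<open>S\<close> gives barycentric coordinates with minimum \<open>1 / S\<close>.\<close>

lemma stereo_surj:
  assumes p: "p \<in> topspace (nsphere d)" "p \<noteq> base_point"
  obtains y where "\<And>i. 0 < y i" "(\<Sum>j\<le>d. y j) = 1" "stereo d y = p"
proof -
  have sp: "(\<Sum>i\<le>d. (p i)\<^sup>2) = 1" and p0: "\<And>i. d < i \<Longrightarrow> p i = 0"
    using p(1) by (auto simp: nsphere)
  have split: "(\<Sum>i\<le>d. h i) = h 0 + (\<Sum>i\<in>{1..d}. h i)" for h :: "nat \<Rightarrow> real"
  proof -
    have "{..d} = insert 0 {1..d}"
      by auto
    then show ?thesis
      by simp
  qed
  have rest: "(\<Sum>i\<in>{1..d}. (p i)\<^sup>2) = 1 - (p 0)\<^sup>2"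
    using sp split[of "\<lambda>i. (p i)\<^sup>2"] by simp
  have "0 \<le> (\<Sum>i\<in>{1..d}. (p i)\<^sup>2)"
    by (simp add: sum_nonneg)
  then have "(p 0)\<^sup>2 \<le> 1"
    using rest by simp
  then have le: "p 0 \<le> 1"
    using power2_le_imp_le[of "p 0" 1] by simp
  have "p 0 \<noteq> 1"
  proof
    assume one: "p 0 = 1"
    then have "(\<Sum>i\<in>{1..d}. (p i)\<^sup>2) = 0"
      using rest by simp
    then have "p i = 0" if "i \<in> {1..d}" for i
      using that sum_nonneg_eq_0_iff[of "{1..d}" "\<lambda>i. (p i)\<^sup>2"] by simp
    then have "p i = base_point i" for i
      using one p0[of i] by (cases "i = 0"; cases "i \<le> d") auto
    then show False
      using p(2) by blast
  qed
  with le have lt: "p 0 < 1"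
    by simp
  define w where "w i = (if i = 0 \<or> d < i then 0 else p i / (1 - p 0))" for i
  define u where "u i = w i + (1 - Min (w ` {..d}))" for i
  define S where "S = (\<Sum>j\<le>d. u j)"
  \<comment> \<open>The value 1 beyond \<open>d\<close> is a mere filler that keeps \<open>y\<close>
    positive everywhere.\<close>
  define y where "y i = (if i \<le> d then u i / S else 1)" for i
  have u1: "1 \<le> u i" if "i \<le> d" for i
  proof -
    have "Min (w ` {..d}) \<le> w i"
      using that by (intro Min_le) auto
    then show ?thesis
      unfolding u_def by linarith
  qed
  have "(\<Sum>j\<le>d. (1::real)) \<le> S"
    unfolding S_def using u1 by (intro sum_mono) simp
  then have S: "0 < S"
    by simp
  have Minu: "Min (u ` {..d}) = 1"
    using Min_image_scale_shift[of 1 w "1 - Min (w ` {..d})" d] unfolding u_def[abs_def] mult_1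
    by linarith
  have "y ` {..d} = (\<lambda>j. (1 / S) * u j + 0) ` {..d}"
    by (intro image_cong) (auto simp: y_def)
  then have Miny: "Min (y ` {..d}) = 1 / S"
    using Min_image_scale_shift[of "1 / S" u 0 d] S Minu by simp
  have sumy: "(\<Sum>j\<le>d. y j) = 1"
    using S by (simp add: y_def S_def flip: sum_divide_distrib)
  have diff: "y j - y 0 = w j / S" if "j \<le> d" for j
    using that by (simp add: y_def u_def w_def flip: diff_divide_distrib)
  have "(\<Sum>j\<le>d. (y j - y 0)\<^sup>2) = (\<Sum>j\<le>d. (w j)\<^sup>2) / S\<^sup>2"
    using diff by (simp add: power_divide sum_divide_distrib)
  also have "(\<Sum>j\<le>d. (w j)\<^sup>2) = (\<Sum>i\<in>{1..d}. (p i)\<^sup>2 / (1 - p 0)\<^sup>2)"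
    unfolding split by (simp add: w_def power_divide)
  also have "\<dots> = (1 - (p 0)\<^sup>2) / (1 - p 0)\<^sup>2"
    by (simp only: rest sum_divide_distrib[symmetric])
  also have "\<dots> = (1 + p 0) / (1 - p 0)"
  proof -
    have "1 - (p 0)\<^sup>2 = (1 - p 0) * (1 + p 0)"
      by (simp add: power2_eq_square algebra_simps)
    then show ?thesis
      unfolding power2_eq_square using lt by simp
  qed
  finally have q: "(\<Sum>j\<le>d. (y j - y 0)\<^sup>2) = (1 + p 0) / (1 - p 0) / S\<^sup>2" .
  have den: "(1 + p 0) / (1 - p 0) / S\<^sup>2 + (1 / S)\<^sup>2 = 2 / (1 - p 0) / S\<^sup>2"
  proof -
    have "(1 + p 0) / (1 - p 0) + 1 = 2 / (1 - p 0)"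
      using lt by (simp add: field_simps)
    then show ?thesis
      by (metis add_divide_distrib power_divide power_one)
  qed
  have num: "(1 + p 0) / (1 - p 0) / S\<^sup>2 - (1 / S)\<^sup>2 = 2 * p 0 / (1 - p 0) / S\<^sup>2"
  proof -
    have "(1 + p 0) / (1 - p 0) - 1 = 2 * p 0 / (1 - p 0)"
      using lt by (simp add: field_simps)
    then show ?thesis
      by (metis diff_divide_distrib power_divide power_one)
  qed
  have "stereo d y i = p i" for i
  proof (cases "i = 0")
    case True
    then show ?thesis
      using lt S unfolding stereo_def Let_def q Miny den num by simp
  next
    case False
    then show ?thesis
      using lt S p0[of i] diff[of i]
      unfolding stereo_def Let_def q Miny den by (auto simp: w_def power2_eq_square)
  qed
  moreover have "0 < y i" for i
    using S u1[of i] by (auto simp: y_def intro!: divide_pos_pos)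
  ultimately show thesis
    using that[of y] sumy by blast
qed

text \<open>All cells in \<open>C\<close> have the same cardinality, so their proper faces lie in
  \<open>L\<close> and every cell is attached along its whole boundary. Its interior is sent by
  \<open>stereo\<close> onto its own sphere without base point, and \<open>L\<close> to the common
  point. The result is a continuous bijection from a compact space to a Hausdorff space.\<close>

lemma collapse_homeomorphic_sphere_bouquet:
  fixes L C :: "'v set set"
  assumes L: "finite L" "\<And>F. F \<in> L \<Longrightarrow> finite F" "down_closed L" "points L \<noteq> {}"
    and C: "finite C" "\<And>F. F \<in> C \<Longrightarrow> finite F \<and> card F = Suc d"
    and LC: "down_closed (L \<union> C)" "L \<inter> C = {}"
  shows "collapse (realization (L \<union> C)) (points L) homeomorphic_space
    sphere_bouquet (card C) d"
proof -
  let ?K = "L \<union> C" and ?W = "sphere_bouquet (card C) d"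
  let ?E = "\<Union>(L \<union> C)"
  let ?supp = "\<lambda>x. {v. x v \<noteq> (0::real)}"
  have E: "finite ?E" "?K \<subseteq> Pow ?E" "L \<subseteq> Pow ?E"
    using L(1,2) C by auto
  note inK = in_realization_iff[OF E(1,2) LC(1)] and inL = in_realization_iff[OF E(1,3) L(3)]
  obtain idx where idx: "bij_betw idx C {..<card C}"
    using finite_same_card_bij[of C "{..<card C}"] C(1) by auto
  have "\<exists>b. bij_betw b {..d} F" if "F \<in> C" for F
    using finite_same_card_bij[of "{..d}" F] C(2)[OF that] by auto
  then obtain od where od: "\<And>F. F \<in> C \<Longrightarrow> bij_betw (od F) {..d} F"
    by metis
  define \<Phi> where "\<Phi> F x = stereo d (x \<circ> od F)" for F and x :: "'v \<Rightarrow> real"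
  define g where "g x = (if x \<in> points L then None
    else Some (idx (?supp x), \<Phi> (?supp x) x))" for x
  have sum1: "(\<Sum>j\<le>d. (x \<circ> od F) j) = 1"
    if "F \<in> C" "x \<in> points ?K" "?supp x \<subseteq> F" for F and x :: "'v \<Rightarrow> real"
  proof -
    have "(\<Sum>j\<le>d. (x \<circ> od F) j) = sum x F"
      using sum.reindex_bij_betw[OF od[OF that(1)], of x] by (simp add: o_def)
    also have "\<dots> = sum x ?E"
      using E that by (intro sum.mono_neutral_left) auto
    finally show ?thesis
      using that(2) unfolding inK by simp
  qed
  have supp_mem: "?supp x \<in> C" if "x \<in> points ?K" "x \<notin> points L" for x
    using that unfolding inK inL by blast
  have min_pos: "0 < Min ((x \<circ> od F) ` {..d}) \<longleftrightarrow> ?supp x = F"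
    and min_0: "Min ((x \<circ> od F) ` {..d}) \<noteq> 0 \<longleftrightarrow> ?supp x = F"
    if "F \<in> C" "x \<in> points ?K" "?supp x \<subseteq> F" for F and x :: "'v \<Rightarrow> real"
  proof -
    have nonneg: "0 \<le> x v" for v
      using that(2) unfolding inK by blast
    have im: "(x \<circ> od F) ` {..d} = x ` F"
      using bij_betw_imp_surj_on[OF od[OF that(1)]] by (metis image_comp)
    have fin: "finite F" "F \<noteq> {}"
      using C(2)[OF that(1)] by auto
    have "0 < Min (x ` F) \<longleftrightarrow> (\<forall>v\<in>F. 0 < x v)"
      using fin by simp
    also have "\<dots> \<longleftrightarrow> ?supp x = F"
      using that(3) nonneg by (auto simp: less_le)
    finally show 1: "0 < Min ((x \<circ> od F) ` {..d}) \<longleftrightarrow> ?supp x = F"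
      unfolding im .
    have "0 \<le> Min (x ` F)"
      using fin nonneg by simp
    then show "Min ((x \<circ> od F) ` {..d}) \<noteq> 0 \<longleftrightarrow> ?supp x = F"
      using 1 unfolding im by linarith
  qed
  have base_iff: "\<Phi> F x = base_point \<longleftrightarrow> x \<in> points L"
    if "F \<in> C" "x \<in> points ?K" "?supp x \<subseteq> F" for F x
  proof -
    have "\<Phi> F x = base_point \<longleftrightarrow> ?supp x \<noteq> F"
      unfolding \<Phi>_def stereo_eq_base_point_iff[OF sum1[OF that]] using min_0[OF that] by blast
    also have "\<dots> \<longleftrightarrow> ?supp x \<in> L"
    proof
      assume "?supp x \<noteq> F"
      then have "card (?supp x) < Suc d"
        using that(3) C(2)[OF that(1)] by (metis psubsetI psubset_card_mono)
      then have "?supp x \<notin> C"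
        using C(2) by fastforce
      then show "?supp x \<in> L"
        using that(2) unfolding inK by blast
    next
      assume "?supp x \<in> L"
      then show "?supp x \<noteq> F"
        using that(1) LC(2) by blast
    qed
    also have "\<dots> \<longleftrightarrow> x \<in> points L"
      using that(2) unfolding inK inL by blast
    finally show ?thesis .
  qed
  \<comment> \<open>On the whole closed simplex \<open>F\<close>, boundary included,
    \<open>g\<close> is given by one formula; this is what makes pasting possible.\<close>
  have g_eq: "g x = collapse_map ({..<card C} \<times> {base_point}) (idx F, \<Phi> F x)"
    if "F \<in> C" "x \<in> points ?K" "?supp x \<subseteq> F" for F x
  proof (cases "x \<in> points L")
    case True
    then show ?thesis
      using base_iff[OF that] bij_betwE[OF idx] that(1) by (simp add: g_def)
  next
    case False
    then have "?supp x = F"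
      using min_0[OF that] base_iff[OF that] stereo_eq_base_point_iff[OF sum1[OF that]]
      unfolding \<Phi>_def by blast
    then show ?thesis
      using base_iff[OF that] False by (simp add: g_def)
  qed
  have \<Phi>_in: "\<Phi> F x \<in> topspace (nsphere d)"
    if "F \<in> C" "x \<in> points ?K" "?supp x \<subseteq> F" for F x
    unfolding \<Phi>_def by (rule stereo_in_nsphere[OF sum1[OF that]])
  \<comment> \<open>A finite closed cover for the pasting lemma: \<open>None\<close> stands for the
    subcomplex, \<open>Some F\<close> for the closed simplex \<open>F\<close>.\<close>
  define T where "T i = (case i of None \<Rightarrow> points L
    | Some F \<Rightarrow> points ?K \<inter> points (Pow F))" for i :: "'v set option"
  define h where "h i x = (case i of None \<Rightarrow> None
    | Some F \<Rightarrow> collapse_map ({..<card C} \<times> {base_point}) (idx F, \<Phi> F x))" for i :: "'v set option" and x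
  have T_Some: "x \<in> T (Some F) \<longleftrightarrow> x \<in> points ?K \<and> ?supp x \<subseteq> F" if "F \<in> C" for x F
  proof -
    have dc: "down_closed (Pow F)"
      by (auto simp: down_closed_def)
    note inF = in_realization_iff[of F "Pow F", OF _ subset_refl dc]
    show ?thesis
    proof
      assume "x \<in> T (Some F)"
      then show "x \<in> points ?K \<and> ?supp x \<subseteq> F"
        using C(2)[OF that] by (auto simp: T_def inF)
    next
      assume x: "x \<in> points ?K \<and> ?supp x \<subseteq> F"
      have "sum x F = sum x ?E"
        using E that x by (intro sum.mono_neutral_left) auto
      then show "x \<in> T (Some F)"
        using C(2)[OF that] x inK[of x] by (auto simp: T_def inF)
    qed
  qed
  have closedT: "closedin (realization ?K) (T i)" if "i \<in> insert None (Some ` C)" for i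
  proof -
    have rel: "closedin (realization ?K) (points ?K \<inter> S)"
      if S: "closedin (powertop_real UNIV) S" for S
    proof -
      have eq: "realization ?K = subtopology (powertop_real UNIV) (points ?K)"
        by (simp add: realization_def)
      show ?thesis
        by (subst eq, unfold closedin_subtopology) (use S in blast)
    qed
    have "closedin (realization ?K) (points ?K \<inter> points (Pow F))"
      if "F \<in> C" for F
      using C(2)[OF that] by (intro rel compact_closed_realization) (auto intro: finite_subset)
    moreover have "closedin (realization ?K) (points L)"
      using rel[of "points L"] compact_closed_realization(2)[of L] L(1,2)
        realization_mono[of L ?K] by (simp add: Int_absorb1)
    ultimately show ?thesis
      using that unfolding T_def by (auto split: option.splits)
  qed
  have cont_h: "continuous_map (subtopology (realization ?K) (T i)) ?W (h i)"
    if "i \<in> insert None (Some ` C)" for i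
  proof (cases i)
    case None
    have "h None = (\<lambda>_. None)"
      by (simp add: h_def fun_eq_iff)
    moreover have "None \<in> topspace ?W"
      by (simp add: topspace_collapse)
    ultimately show ?thesis
      unfolding None by (simp only: continuous_map_const simp_thms)
  next
    case (Some F)
    with that have F: "F \<in> C"
      by auto
    let ?X = "subtopology (realization ?K) (T i)"
    have inT: "x \<in> points ?K" "?supp x \<subseteq> F" if "x \<in> topspace ?X" for x
      using that T_Some[OF F] Some by auto
    have coord: "continuous_map ?X euclideanreal (\<lambda>x. (x \<circ> od F) j)" for j
      unfolding o_def by (intro continuous_map_from_subtopology continuous_map_realization_coordinate)
    have pos: "(\<Sum>j\<le>d. ((x \<circ> od F) j - (x \<circ> od F) 0)\<^sup>2) + (Min ((x \<circ> od F) ` {..d}))\<^sup>2 \<noteq> 0"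
      if "x \<in> topspace ?X" for x
      using stereo_denominator_pos[OF sum1[OF F inT[OF that]]] by (rule less_imp_neq[symmetric])
    have "continuous_map ?X euclideanreal (\<lambda>x. \<Phi> F x i)" for i
    proof -
      have Minc: "continuous_map ?X euclideanreal (\<lambda>x. Min ((x \<circ> od F) ` {..d}))"
        by (rule continuous_map_Min) (use coord in auto)
      consider "i = 0" | "i \<noteq> 0" "i \<le> d" | "d < i"
        by linarith
      then show ?thesis
      proof cases
        case 1
        show ?thesis
          unfolding \<Phi>_def stereo_def Let_def 1 if_P[OF refl]
          by (intro continuous_map_real_divide continuous_map_add continuous_map_diff
              continuous_map_sum continuous_map_real_pow Minc coord pos) auto
      next
        case 2
        then show ?thesis
          unfolding \<Phi>_def stereo_def Let_def if_not_P[OF 2(1)] if_P[OF 2(2)]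
          by (intro continuous_map_real_divide continuous_map_add continuous_map_diff
              continuous_map_sum continuous_map_real_pow continuous_map_real_mult Minc coord pos) auto
      next
        case 3
        then show ?thesis
          by (simp add: \<Phi>_def stereo_def)
      qed
    qed
    then have "continuous_map ?X (powertop_real UNIV) (\<Phi> F)"
      unfolding continuous_map_componentwise_UNIV by blast
    then have "continuous_map ?X (nsphere d) (\<Phi> F)"
      using \<Phi>_in[OF F inT] unfolding nsphere continuous_map_in_subtopology
      by (auto simp: nsphere)
    moreover have "continuous_map (nsphere d) (sum_topology (\<lambda>_. nsphere d) {..<card C}) (\<lambda>p. (idx F, p))"
      using bij_betwE[OF idx] F by (intro continuous_map_component_injection) blast
    moreover have "topspace (sum_topology (\<lambda>_. nsphere d) {..<card C}) \<inter> ({..<card C} \<times> {base_point}) \<noteq> {}"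
      using bij_betwE[OF idx] F in_topspace_nsphere[of d] by fastforce
    note quotient_imp_continuous_map[OF quotient_map_collapse[OF this]]
    ultimately have "continuous_map ?X ?W
        (collapse_map ({..<card C} \<times> {base_point}) \<circ> ((\<lambda>p. (idx F, p)) \<circ> \<Phi> F))"
      by (intro continuous_map_compose)
    moreover have "h i = collapse_map ({..<card C} \<times> {base_point}) \<circ> ((\<lambda>p. (idx F, p)) \<circ> \<Phi> F)"
      by (simp add: Some h_def fun_eq_iff)
    ultimately show ?thesis
      by simp
  qed
  have g_h: "g x = h i x" if "i \<in> insert None (Some ` C)" "x \<in> points ?K" "x \<in> T i" for x i
  proof (cases i)
    case None
    then show ?thesis
      using that(3) by (simp add: g_def h_def T_def)
  next
    case (Some F)
    with that have F: "F \<in> C"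
      by auto
    show ?thesis
      using g_eq[OF F that(2)] T_Some[OF F] that(3) by (simp add: Some h_def)
  qed
  have cont_g: "continuous_map (realization ?K) ?W g"
  proof (rule pasting_lemma_closed[where I = "insert None (Some ` C)" and T = T and f = h])
    show "\<exists>j. j \<in> insert None (Some ` C) \<and> x \<in> T j \<and> g x = h j x"
      if x: "x \<in> points ?K" for x
    proof (cases "x \<in> points L")
      case True
      then have "x \<in> T None"
        by (simp add: T_def)
      then show ?thesis
        using g_h[of None x] x by blast
    next
      case False
      then have "x \<in> T (Some (?supp x))" "Some (?supp x) \<in> insert None (Some ` C)"
        using supp_mem[OF x False] T_Some[OF supp_mem[OF x False]] x by blast+
      then show ?thesis
        using g_h x by blast
    qed
    show "h i x = h j x" if "i \<in> insert None (Some ` C)" "j \<in> insert None (Some ` C)"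
      "x \<in> points ?K \<inter> T i \<inter> T j" for i j x
      using g_h[of i x] g_h[of j x] that by (metis IntE)
  qed (use C(1) closedT cont_h in blast)+
  define G where "G z = (case z of None \<Rightarrow> None | Some x \<Rightarrow> g x)" for z
  let ?Q = "collapse (realization ?K) (points L)"
  have neq: "points ?K \<inter> points L \<noteq> {}"
    using L(4) realization_mono[of L ?K] by blast
  have "homeomorphic_map ?Q ?W G"
  proof (rule continuous_imp_homeomorphic_map)
    show "continuous_map ?Q ?W G"
    proof (rule continuous_map_from_collapse)
      show "G None \<in> topspace ?W"
        by (simp add: G_def topspace_collapse)
      have "G \<circ> collapse_map (points L) = g"
        by (auto simp: G_def g_def fun_eq_iff)
      then show "continuous_map (realization ?K) ?W (G \<circ> collapse_map (points L))"
        using cont_g by simp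
    qed
    have "compactin (powertop_real UNIV) (points ?K)"
      using L(1,2) C by (intro compact_closed_realization) auto
    then have "compact_space (realization ?K)"
      by (simp add: compact_space_def compactin_subtopology realization_def)
    note image_compactin[OF this[unfolded compact_space_def]
        quotient_imp_continuous_map[OF quotient_map_collapse[OF neq]]]
    then show "compact_space ?Q"
      unfolding compact_space_def quotient_imp_surjective_map[OF quotient_map_collapse[OF neq]] .
    show "Hausdorff_space ?W"
      by (rule Hausdorff_sphere_bouquet)
    have out: "\<exists>F\<in>C. ?supp x = F \<and> g x = Some (idx F, \<Phi> F x) \<and> \<Phi> F x \<noteq> base_point
        \<and> (\<Sum>j\<le>d. (x \<circ> od F) j) = 1 \<and> 0 < Min ((x \<circ> od F) ` {..d})"
      if x: "x \<in> points ?K" "x \<notin> points L" for x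
      using supp_mem[OF x] x base_iff[OF supp_mem[OF x] x(1)] sum1[OF supp_mem[OF x] x(1)]
        min_pos[OF supp_mem[OF x] x(1)]
      by (auto simp: g_def)
    show "inj_on G (topspace ?Q)"
    proof (rule inj_onI)
      fix z w assume z: "z \<in> topspace ?Q" and w: "w \<in> topspace ?Q" and eq: "G z = G w"
      have none_eq: "u = None" if "u \<in> topspace ?Q" "G u = None" for u
      proof (rule ccontr)
        assume "u \<noteq> None"
        then obtain x where "u = Some x" "x \<in> points ?K" "x \<notin> points L"
          using \<open>u \<in> topspace ?Q\<close> unfolding topspace_collapse by blast
        then show False
          using out[of x] \<open>G u = None\<close> by (auto simp: G_def)
      qed
      show "z = w"
      proof (cases "G z")
        case None
        then show ?thesis
          using none_eq[OF z] none_eq[OF w] eq None by simp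
      next
        case (Some jp)
        moreover have G0: "G None = None"
          by (simp add: G_def)
        ultimately have "G z \<noteq> G None" "G w \<noteq> G None"
          using eq by simp_all
        then have "z \<noteq> None" "w \<noteq> None"
          by (metis, metis)
        then obtain x y where x: "z = Some x" "x \<in> points ?K" "x \<notin> points L"
          and y: "w = Some y" "y \<in> points ?K" "y \<notin> points L"
          using z w unfolding topspace_collapse by blast
        obtain F where F: "F \<in> C" "?supp x = F" "g x = Some (idx F, \<Phi> F x)"
          "(\<Sum>j\<le>d. (x \<circ> od F) j) = 1" "0 < Min ((x \<circ> od F) ` {..d})"
          using out[OF x(2,3)] by blast
        obtain F' where F': "F' \<in> C" "?supp y = F'" "g y = Some (idx F', \<Phi> F' y)"
          "(\<Sum>j\<le>d. (y \<circ> od F') j) = 1" "0 < Min ((y \<circ> od F') ` {..d})"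
          using out[OF y(2,3)] by blast
        have "idx F = idx F'" and \<Phi>eq: "\<Phi> F x = \<Phi> F' y"
          using eq F(3) F'(3) by (simp_all add: G_def x(1) y(1))
        then have "F = F'"
          using bij_betw_imp_inj_on[OF idx] F(1) F'(1) by (meson inj_onD)
        have xy: "x (od F i) = y (od F i)" if "i \<le> d" for i
          using stereo_inj[OF F(4,5) F'(4,5) _ that] \<Phi>eq \<open>F = F'\<close> by (simp add: \<Phi>_def)
        have "x v = y v" for v
        proof (cases "v \<in> F")
          case True
          then obtain i where "i \<le> d" "v = od F i"
            using bij_betw_imp_surj_on[OF od[OF F(1)]] by blast
          then show ?thesis
            using xy by blast
        next
          case False
          then have "x v = 0" "y v = 0"
            using F(2) F'(2) \<open>F = F'\<close> by blast+
          then show ?thesis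
            by simp
        qed
        then show ?thesis
          using x(1) y(1) by blast
      qed
    qed
    show "G ` topspace ?Q = topspace ?W"
    proof
      show "G ` topspace ?Q \<subseteq> topspace ?W"
        using continuous_map_image_subset_topspace \<open>continuous_map ?Q ?W G\<close> by blast
      show "topspace ?W \<subseteq> G ` topspace ?Q"
      proof
        fix u assume u: "u \<in> topspace ?W"
        show "u \<in> G ` topspace ?Q"
        proof (cases u)
          case None
          then show ?thesis
            by (intro image_eqI[of _ _ None]) (simp_all add: G_def topspace_collapse)
        next
          case (Some jp)
          obtain j p where "jp = (j, p)"
            by (cases jp)
          with u Some have p: "j < card C" "p \<in> topspace (nsphere d)" "p \<noteq> base_point"
            unfolding topspace_collapse by auto
          obtain F where F: "F \<in> C" "idx F = j"
            using bij_betw_imp_surj_on[OF idx] p(1) by (metis imageE lessThan_iff)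
          obtain y where y: "\<And>i. 0 < y i" "(\<Sum>j\<le>d. y j) = 1" "stereo d y = p"
            using stereo_surj[OF p(2,3)] by blast
          define x where "x v = (if v \<in> F then y (inv_into {..d} (od F) v) else 0)" for v
          have bij: "bij_betw (od F) {..d} F"
            by (rule od[OF F(1)])
          have xo: "(x \<circ> od F) i = y i" if "i \<le> d" for i
            using that bij_betw_inv_into_left[OF bij, of i] bij_betw_apply[OF bij, of i] by (simp add: x_def)
          have supp: "?supp x = F"
            using y(1) by (auto simp: x_def) (metis less_irrefl)
          have "sum x F = (\<Sum>i\<le>d. (x \<circ> od F) i)"
            using sum.reindex_bij_betw[OF bij, of x] by (simp add: o_def)
          also have "\<dots> = 1"
            using xo y(2) by simp
          finally have s1: "sum x F = 1" .
          have "sum x F = sum x ?E"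
            using E F(1) supp by (intro sum.mono_neutral_left) auto
          moreover have "\<forall>v. v \<notin> ?E \<longrightarrow> x v = 0" "\<forall>v. 0 \<le> x v"
            using F(1) y(1) by (auto simp: x_def less_imp_le)
          ultimately have xK: "x \<in> points ?K" and xL: "x \<notin> points L"
            using s1 supp F(1) LC(2) unfolding inK inL by auto
          have "stereo d (x \<circ> od F) = stereo d y"
          proof -
            have "(x \<circ> od F) ` {..d} = y ` {..d}"
              using xo by (intro image_cong) auto
            moreover have "(\<Sum>j\<le>d. ((x \<circ> od F) j - (x \<circ> od F) 0)\<^sup>2) = (\<Sum>j\<le>d. (y j - y 0)\<^sup>2)"
              using xo by (intro sum.cong) auto
            ultimately show ?thesis
              using xo by (simp only: stereo_def fun_eq_iff Let_def) simp
          qed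
          then have "G (Some x) = u"
            using xL supp F(2) y(3) Some \<open>jp = (j, p)\<close> by (simp add: G_def g_def \<Phi>_def)
          moreover have "Some x \<in> topspace ?Q"
            using xK xL by (simp add: topspace_collapse)
          ultimately show ?thesis
            by blast
        qed
      qed
    qed
  qed
  then show ?thesis
    by (rule homeomorphic_map_imp_homeomorphic_space)
qed

text \<open>The simplex is filtered as \<open>L\<close>, \<open>L \<union> S1\<close>,
  \<open>L \<union> S1 \<union> C\<close>, \<open>Pow E\<close>. The pairs in \<open>S1\<close> go
  into the collapsed part, the pairs in \<open>S2\<close> are then dropped from the total space
  relative to \<open>L \<union> S1\<close>, and what remains is a bouquet with one sphere for each
  cell in \<open>C\<close>.\<close>

theorem morse_family_collapse:
  fixes E :: "'v set" and L :: "'v set set"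
  assumes E: "finite E" "L \<subseteq> Pow E" "down_closed L" and ne: "points L \<noteq> {}"
    and M: "morse_family (Pow E - L) (Suc d) k"
  shows "collapse (realization (Pow E)) (points L) homotopy_equivalent_space
    sphere_bouquet k d"
proof -
  obtain S1 C S2 where S: "Pow E - L = S1 \<union> C \<union> S2" "expansion S1" "expansion S2"
    and C: "finite C" "card C = k" "\<forall>\<sigma>\<in>C. finite \<sigma> \<and> card \<sigma> = Suc d"
    and cards: "\<forall>\<sigma>\<in>S1. card \<sigma> \<le> Suc d" "\<forall>\<sigma>\<in>S2. Suc d \<le> card \<sigma>"
    and disj: "S1 \<inter> C = {}" "S1 \<inter> S2 = {}" "C \<inter> S2 = {}"
    using morse_family_split[OF M] by (elim exE conjE) (rule that)
  have P: "Pow E = (L \<union> S1 \<union> C) \<union> S2" and LS: "L \<inter> (S1 \<union> C \<union> S2) = {}"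
    using S(1) E(2) by blast+
  have fin: "finite \<sigma>" if "\<sigma> \<in> Pow E" for \<sigma>
    using that E(1) finite_subset by blast
  have dcP: "down_closed (Pow E)"
    by (auto simp: down_closed_def)
  \<comment> \<open>Across the threshold \<open>Suc d\<close>, containment would force equality;
    this justifies the attaching order \<open>S1\<close>, \<open>C\<close>,
    \<open>S2\<close>.\<close>
  have low: "\<not> t \<subseteq> s" if "s \<in> Pow E" "s \<noteq> t" "card s \<le> Suc d" "Suc d \<le> card t" for s t
    using that fin[of s] psubset_card_mono[of s t] by auto
  have PE: "S1 \<subseteq> Pow E" "C \<subseteq> Pow E" "S2 \<subseteq> Pow E"
    using S(1) by blast+
  have dc2: "down_closed (L \<union> (S1 \<union> C))"
  proof (rule down_closed_Un_initial[of L "S1 \<union> C" S2])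
    show "down_closed (L \<union> (S1 \<union> C \<union> S2))"
      using dcP P by (simp add: Un_assoc)
    show "\<not> t \<subseteq> s" if "s \<in> S1 \<union> C" "t \<in> S2" for s t
      using that PE disj cards C(3) by (intro low) auto
  qed (use E(3) LS in auto)
  have dc1: "down_closed (L \<union> S1)"
  proof (rule down_closed_Un_initial[of L S1 C])
    show "\<not> t \<subseteq> s" if "s \<in> S1" "t \<in> C" for s t
      using that PE disj cards C(3) by (intro low) auto
  qed (use E(3) dc2 LS in auto)
  have ne1: "points (L \<union> S1) \<noteq> {}"
    using ne realization_mono[of L "L \<union> S1"] by blast
  have LS1: "L \<union> S1 \<subseteq> Pow E" "L \<inter> S1 = {}"
    using Un_least[OF E(2) PE(1)] LS by auto
  have P2: "(L \<union> (S1 \<union> C)) \<union> S2 = Pow E" "(L \<union> (S1 \<union> C)) \<inter> S2 = {}" "L \<union> S1 \<subseteq> L \<union> (S1 \<union> C)"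
    subgoal by (simp only: P Un_assoc)
    subgoal using LS disj by auto
    subgoal by auto
    done
  have step1: "collapse (realization (Pow E)) (points L) homotopy_equivalent_space
      collapse (realization (Pow E)) (points (L \<union> S1))"
    by (rule conjunct1[OF expansion_collapse_equivalences[OF S(2) E(1) LS1(1) dc1 E(3) E(3)
          subset_refl LS1(2) ne]])
  have "collapse (realization (L \<union> (S1 \<union> C))) (points (L \<union> S1))
      homotopy_equivalent_space
      collapse (realization ((L \<union> (S1 \<union> C)) \<union> S2)) (points (L \<union> S1))"
    by (rule conjunct2[OF expansion_collapse_equivalences[OF S(3) E(1) _ _ dc2 dc1 P2(3,2) ne1]])
       (simp_all only: P2(1) dcP subset_refl)
  then have step2: "collapse (realization (Pow E)) (points (L \<union> S1))
      homotopy_equivalent_space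
      collapse (realization (L \<union> (S1 \<union> C))) (points (L \<union> S1))"
    unfolding P2(1) by (rule iffD1[OF homotopy_equivalent_space_sym])
  have step3: "collapse (realization ((L \<union> S1) \<union> C)) (points (L \<union> S1))
      homeomorphic_space sphere_bouquet (card C) d"
  proof (rule collapse_homeomorphic_sphere_bouquet)
    show "finite (L \<union> S1)"
      using LS1(1) by (rule finite_subset) (simp only: finite_Pow_iff E(1))
    show "finite F" if "F \<in> L \<union> S1" for F
      using fin LS1(1) that by blast
    show "(L \<union> S1) \<inter> C = {}"
      using LS disj by blast
    show "down_closed ((L \<union> S1) \<union> C)"
      using dc2 by (simp only: Un_assoc)
    show "finite C" "\<And>F. F \<in> C \<Longrightarrow> finite F \<and> card F = Suc d"
      using C by blast+
  qed (fact dc1 ne1)+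
  show ?thesis
    using homotopy_eqv_trans[OF homotopy_eqv_trans[OF step1 step2]
        homeomorphic_imp_homotopy_equivalent_space[OF step3[unfolded Un_assoc]]] C(2)
    by simp
qed

section \<open>Near-perfect matchings\<close>

definition edges_on :: "'a set \<Rightarrow> 'a set set" where
  "edges_on V = {e. e \<subseteq> V \<and> card e = 2}"

lemma edges_onE:
  assumes "e \<in> edges_on V"
  obtains i j where "e = {i, j}" "i \<noteq> j" "i \<in> V" "j \<in> V"
  using assms unfolding edges_on_def card_2_iff by auto

lemma insert_in_edges_on: "{i, j} \<in> edges_on V \<longleftrightarrow> i \<in> V \<and> j \<in> V \<and> i \<noteq> j"
  by (auto simp: edges_on_def card_2_iff doubleton_eq_iff)

lemma finite_edges_on: "finite V \<Longrightarrow> finite (edges_on V)"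
  unfolding edges_on_def by (rule finite_subset[of _ "Pow V"]) auto

text \<open>A matching is encoded as an involution on \<open>V\<close> whose set of fixed points is the set \<open>U\<close> of
  vertices it misses.\<close>

definition matches :: "'a set \<Rightarrow> 'a set set \<Rightarrow> 'a set \<Rightarrow> ('a \<Rightarrow> 'a) \<Rightarrow> bool" where
  "matches V G U p \<longleftrightarrow> U \<subseteq> V \<and>
    (\<forall>i\<in>V. p i \<in> V \<and> p (p i) = i \<and> (p i = i \<longleftrightarrow> i \<in> U) \<and> (i \<notin> U \<longrightarrow> {i, p i} \<in> G))"

definition matchable :: "'a set \<Rightarrow> 'a set set \<Rightarrow> 'a set \<Rightarrow> bool" where
  "matchable V G U \<longleftrightarrow> (\<exists>p. matches V G U p)"

lemma matchesD:
  assumes "matches V G U p"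
  shows "U \<subseteq> V" "\<And>i. i \<in> V \<Longrightarrow> p i \<in> V" "\<And>i. i \<in> V \<Longrightarrow> p (p i) = i"
    "\<And>i. i \<in> V \<Longrightarrow> p i = i \<longleftrightarrow> i \<in> U" "\<And>i. i \<in> V \<Longrightarrow> i \<notin> U \<Longrightarrow> {i, p i} \<in> G"
  using assms by (auto simp: matches_def)

lemma matchableE:
  assumes "matchable V G U"
  obtains p where "matches V G U p"
  using assms unfolding matchable_def by blast

lemma matchable_subset: "matchable V G U \<Longrightarrow> U \<subseteq> V"
  by (auto simp: matchable_def matches_def)

lemma matchable_mono: "matchable V G U \<Longrightarrow> G \<subseteq> H \<Longrightarrow> matchable V H U"
  unfolding matchable_def matches_def by blast

section \<open>Parity, alternating paths and the exchange property\<close>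

lemma even_card_involution:
  assumes "finite S" and "\<And>i. i \<in> S \<Longrightarrow> p i \<in> S" "\<And>i. i \<in> S \<Longrightarrow> p (p i) = i"
    "\<And>i. i \<in> S \<Longrightarrow> p i \<noteq> i"
  shows "even (card S)"
  using assms
proof (induction "card S" arbitrary: S rule: less_induct)
  case less
  show ?case
  proof (cases "S = {}")
    case False
    then obtain i where i: "i \<in> S"
      by blast
    let ?S = "S - {i, p i}"
    have c: "card ?S + 2 = card S"
    proof -
      have "{i, p i} \<subseteq> S" "card {i, p i} = 2"
        using i less.prems(2)[OF i] less.prems(4)[OF i, symmetric] by auto
      then show ?thesis
        using card_Diff_subset[of "{i, p i}" S] card_mono[OF less.prems(1), of "{i, p i}"] by simp
    qed
    have "p j \<in> ?S" if "j \<in> ?S" for j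
      using that less.prems(2,3)[of j] less.prems(3)[OF i] by auto
    then have "even (card ?S)"
      using less.prems c by (intro less.hyps) auto
    then show ?thesis
      using c by presburger
  qed simp
qed

text \<open>Mostly used in contrapositive form: an odd set without missed vertices is left by some
  edge of the matching.\<close>

lemma even_card_matches:
  assumes "matches V G U p" "finite V" "S \<subseteq> V" "S \<inter> U = {}" "\<And>i. i \<in> S \<Longrightarrow> p i \<in> S"
  shows "even (card S)"
proof (rule even_card_involution)
  show "p (p i) = i" "p i \<noteq> i" if "i \<in> S" for i
    using that matchesD(3,4)[OF assms(1), of i] assms(3,4) by auto
qed (use assms finite_subset in auto)

text \<open>\<open>S\<close> is the component of \<open>t\<close> in the union of the two matchings, a path with ends \<open>t\<close> and \<open>x\<close>.\<close>

lemma alternating_path: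
  assumes "finite V" and p: "\<And>i. i \<in> V \<Longrightarrow> p i \<in> V \<and> p (p i) = i"
    and q: "\<And>i. i \<in> V \<Longrightarrow> q i \<in> V \<and> q (q i) = i" and t: "t \<in> V" "q t = t"
  shows "\<exists>S x. S \<subseteq> V \<and> t \<in> S \<and> x \<in> S \<and> (\<forall>i\<in>S. p i \<in> S \<and> q i \<in> S) \<and>
    ((\<forall>i\<in>S. (p i = i \<longleftrightarrow> i = x) \<and> (q i = i \<longleftrightarrow> i = t)) \<or>
     (x \<noteq> t \<and> (\<forall>i\<in>S. p i \<noteq> i \<and> (q i = i \<longleftrightarrow> i = t \<or> i = x))))"
  using assms
proof (induction "card V" arbitrary: V q t rule: less_induct)
  case less
  note p = less.prems(2) and q = less.prems(3) and t = less.prems(4,5)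
  define s where "s = p t"
  have s: "s \<in> V" "p s = t"
    using p[OF t(1)] by (auto simp: s_def)
  consider "s = t" | "s \<noteq> t" "q s = s" | "s \<noteq> t" "q s \<noteq> s"
    by blast
  then show ?case
  proof cases
    case 1
    then show ?thesis
      using t by (intro exI[of _ "{t}"] exI[of _ t]) (auto simp: s_def)
  next
    case 2
    then show ?thesis
      using t s by (intro exI[of _ "{t, s}"] exI[of _ s]) (auto simp: s_def)
  next
    case 3
    define s' where "s' = q s"
    have s': "s' \<in> V" "q s' = s" "s' \<noteq> s" "s' \<noteq> t"
      using q[OF s(1)] 3 t by (auto simp: s'_def)
    let ?V = "V - {t, s}"
    \<comment> \<open>With \<open>t\<close> and \<open>s\<close> deleted, \<open>s'\<close> has lost
      its partner under \<open>q\<close>. It becomes a fixed point of \<open>q'\<close> and the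
      start of the remaining, shorter path.\<close>
    define q' where "q' = q(s' := s')"
    have "card ?V < card V"
      using less.prems(1) t(1) by (intro psubset_card_mono) auto
    moreover have "finite ?V"
      using less.prems(1) by simp
    moreover have "p i \<in> ?V \<and> p (p i) = i" if "i \<in> ?V" for i
      using that p[of i] s s_def by auto
    moreover have "q' i \<in> ?V \<and> q' (q' i) = i" if i: "i \<in> ?V" for i
    proof (cases "i = s'")
      case True
      then show ?thesis
        using i by (simp add: q'_def)
    next
      case False
      have "q i \<noteq> t" "q i \<noteq> s" "q i \<noteq> s'"
        using i q[of i] t s' False s'_def by auto
      then show ?thesis
        using i q[of i] False by (simp add: q'_def)
    qed
    moreover have "s' \<in> ?V" "q' s' = s'"
      using s' by (auto simp: q'_def)
    ultimately obtain S x where S: "S \<subseteq> ?V" "s' \<in> S" "x \<in> S" "\<forall>i\<in>S. p i \<in> S \<and> q' i \<in> S"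
      and alt: "(\<forall>i\<in>S. (p i = i \<longleftrightarrow> i = x) \<and> (q' i = i \<longleftrightarrow> i = s')) \<or>
         (x \<noteq> s' \<and> (\<forall>i\<in>S. p i \<noteq> i \<and> (q' i = i \<longleftrightarrow> i = s' \<or> i = x)))"
      using less.hyps[of ?V q' s'] by (elim meta_impE exE conjE) auto
    have x: "x \<noteq> t" "x \<noteq> s"
      using S(1,3) by auto
    have qs: "q i \<in> insert t (insert s S)" if "i \<in> insert t (insert s S)" for i
    proof -
      consider "i = t" | "i = s" | "i \<in> S" "i = s'" | "i \<in> S" "i \<noteq> s'"
        using \<open>i \<in> insert t (insert s S)\<close> by blast
      then show ?thesis
      proof cases
        case 4
        then have "q i = q' i"
          by (simp add: q'_def)
        then show ?thesis
          using S(4) 4 by simp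
      qed (use t S(2) s' s'_def in auto)
    qed
    have ps: "p i \<in> insert t (insert s S)" if "i \<in> insert t (insert s S)" for i
      using that s s_def S(4) by auto
    have fixp: "p i = i \<longleftrightarrow> i \<in> S \<and> p i = i" if "i \<in> insert t (insert s S)" for i
      using that s s_def 3 by auto
    have fixq: "q i = i \<longleftrightarrow> i = t \<or> (i \<in> S \<and> i \<noteq> s' \<and> q' i = i)" if "i \<in> insert t (insert s S)" for i
      using that t 3 s' S(1) by (auto simp: q'_def)
    have "(\<forall>i\<in>insert t (insert s S). (p i = i \<longleftrightarrow> i = x) \<and> (q i = i \<longleftrightarrow> i = t)) \<or>
     (x \<noteq> t \<and> (\<forall>i\<in>insert t (insert s S). p i \<noteq> i \<and> (q i = i \<longleftrightarrow> i = t \<or> i = x)))"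
      using alt
    proof
      assume a: "\<forall>i\<in>S. (p i = i \<longleftrightarrow> i = x) \<and> (q' i = i \<longleftrightarrow> i = s')"
      show ?thesis
      proof (intro disjI1 ballI conjI)
        fix i assume i: "i \<in> insert t (insert s S)"
        show "p i = i \<longleftrightarrow> i = x"
          using fixp[OF i] a S(3) by blast
        show "q i = i \<longleftrightarrow> i = t"
          using fixq[OF i] a by blast
      qed
    next
      assume a: "x \<noteq> s' \<and> (\<forall>i\<in>S. p i \<noteq> i \<and> (q' i = i \<longleftrightarrow> i = s' \<or> i = x))"
      show ?thesis
      proof (intro disjI2 ballI conjI)
        fix i assume i: "i \<in> insert t (insert s S)"
        show "p i \<noteq> i"
          using fixp[OF i] a by blast
        show "q i = i \<longleftrightarrow> i = t \<or> i = x"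
          using fixq[OF i] a S(3) by blast
      qed (fact x)
    qed
    moreover have "insert t (insert s S) \<subseteq> V"
      using S(1) t(1) s(1) by blast
    ultimately show ?thesis
      using S(3) ps qs by (intro exI[of _ "insert t (insert s S)"] exI[of _ x]) blast
  qed
qed

lemma matches_swap:
  assumes "matches V G U p" "matches V G W q" "S \<subseteq> V" "\<And>i. i \<in> S \<Longrightarrow> p i \<in> S \<and> q i \<in> S"
  shows "matches V G ((W \<inter> S) \<union> (U - S)) (\<lambda>i. if i \<in> S then q i else p i)"
proof -
  have "p i \<notin> S" if "i \<in> V" "i \<notin> S" for i
    using that matchesD(3)[OF assms(1), of i] assms(4)[of "p i"] by auto
  then show ?thesis
    using assms unfolding matches_def by auto
qed

text \<open>The two matchings are swapped along the alternating path that starts at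
  \<open>t\<close>. Its other end \<open>x\<close> is missed either by the first matching
  (\<open>across\<close>) or by the second (\<open>within\<close>). The structural facts about D and
  A below are drawn from this exchange, usually by ruling out one of the two cases.\<close>

lemma matchable_exchange:
  assumes "matchable V G U" "matchable V G W" "finite V" "t \<in> W" "t \<notin> U"
  obtains (across) x where "x \<in> U" "x \<notin> W" "matchable V G (insert t (U - {x}))"
      "matchable V G (insert x (W - {t}))"
    | (within) x where "x \<in> W" "x \<noteq> t" "x \<notin> U" "matchable V G (insert t (insert x U))"
      "matchable V G (W - {t, x})"
proof -
  obtain p q where p: "matches V G U p" and q: "matches V G W q"
    using assms(1,2) by (meson matchableE)
  note pD = matchesD[OF p] and qD = matchesD[OF q]
  have t: "t \<in> V" "q t = t"
    using assms(4) qD(1,4) by auto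
  obtain S x where S: "S \<subseteq> V" "t \<in> S" "x \<in> S" "\<forall>i\<in>S. p i \<in> S \<and> q i \<in> S"
    and alt: "(\<forall>i\<in>S. (p i = i \<longleftrightarrow> i = x) \<and> (q i = i \<longleftrightarrow> i = t)) \<or>
     (x \<noteq> t \<and> (\<forall>i\<in>S. p i \<noteq> i \<and> (q i = i \<longleftrightarrow> i = t \<or> i = x)))"
    using alternating_path[of V p q t] assms(3) pD(2,3) qD(2,3) t by (elim meta_impE exE conjE) auto
  have pq: "matches V G ((W \<inter> S) \<union> (U - S)) (\<lambda>i. if i \<in> S then q i else p i)"
    by (rule matches_swap[OF p q S(1)]) (use S(4) in blast)
  have qp: "matches V G ((U \<inter> S) \<union> (W - S)) (\<lambda>i. if i \<in> S then p i else q i)"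
    by (rule matches_swap[OF q p S(1)]) (use S(4) in blast)
  have fixp: "p i = i \<longleftrightarrow> i \<in> U" and fixq: "q i = i \<longleftrightarrow> i \<in> W" if "i \<in> S" for i
    using that S(1) pD(4) qD(4) by blast+
  from alt show thesis
  proof
    assume a: "\<forall>i\<in>S. (p i = i \<longleftrightarrow> i = x) \<and> (q i = i \<longleftrightarrow> i = t)"
    then have US: "U \<inter> S = {x}" and WS: "W \<inter> S = {t}"
      using fixp fixq S(2,3) by blast+
    have "x \<noteq> t"
      using US assms(5) by blast
    moreover have "U - S = U - {x}" "W - S = W - {t}"
      using US WS by blast+
    ultimately show thesis
      using across[of x] pq qp US WS unfolding matchable_def by auto
  next
    assume a: "x \<noteq> t \<and> (\<forall>i\<in>S. p i \<noteq> i \<and> (q i = i \<longleftrightarrow> i = t \<or> i = x))"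
    then have US: "U \<inter> S = {}" and WS: "W \<inter> S = {t, x}"
      using fixp fixq S(2,3) by blast+
    moreover have "U - S = U" "W - S = W - {t, x}"
      using US WS by blast+
    ultimately show thesis
      using within[of x] a pq qp unfolding matchable_def by auto
  qed
qed

lemma matchable_add_edge:
  assumes "matchable V G (insert a (insert b U))" "a \<noteq> b" "a \<notin> U" "b \<notin> U" "{a, b} \<in> G"
  shows "matchable V G U"
proof -
  obtain p where p: "matches V G (insert a (insert b U)) p"
    using assms(1) by (rule matchableE)
  note pD = matchesD[OF p]
  have "p i \<noteq> a" "p i \<noteq> b" if "i \<in> V" "i \<noteq> a" "i \<noteq> b" for i
    using that pD(1,3,4) by (metis insert_iff subsetD)+
  then have "matches V G U (p(a := b, b := a))"
    using assms pD unfolding matches_def by (auto simp: insert_commute)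
  then show ?thesis
    unfolding matchable_def by blast
qed

lemma matchable_delete_edge:
  assumes "matches V G U p" "a \<in> V" "a \<notin> U"
  shows "matchable V (G - {{a, p a}}) (insert a (insert (p a) U))"
proof -
  note pD = matchesD[OF assms(1)]
  have ne: "p a \<noteq> a" "p (p a) = a" "p a \<in> V"
    using pD assms(2,3) by auto
  have other: "p i \<noteq> a" "p i \<noteq> p a" if "i \<in> V" "i \<noteq> a" "i \<noteq> p a" for i
    using that pD(3)[of i] ne by auto
  then have "matches V (G - {{a, p a}}) (insert a (insert (p a) U)) (p(a := a, p a := p a))"
    using assms pD ne unfolding matches_def by (auto simp: doubleton_eq_iff)
  then show ?thesis
    unfolding matchable_def by blast
qed

text \<open>A matching that exists only in the larger graph must use the new edge; dropping that
  edge leaves \<open>a\<close> and \<open>b\<close> missed in addition.\<close>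

lemma matchable_insert_edge:
  assumes "a \<noteq> b" "matchable V (insert {a, b} G) U" "\<not> matchable V G U"
  shows "a \<in> V" "b \<in> V" "a \<notin> U" "b \<notin> U" "matchable V G (insert a (insert b U))"
proof -
  obtain p where p: "matches V (insert {a, b} G) U p"
    using assms(2) by (rule matchableE)
  note pD = matchesD[OF p]
  have "\<exists>i\<in>V. i \<notin> U \<and> {i, p i} \<notin> G"
  proof (rule ccontr)
    assume "\<not> ?thesis"
    then have "matches V G U p"
      using pD unfolding matches_def by blast
    then show False
      using assms(3) unfolding matchable_def by blast
  qed
  then obtain i where "i \<in> V" "i \<notin> U" "{i, p i} = {a, b}"
    using pD(5) by blast
  then have ab: "a \<in> V" "a \<notin> U" "p a = b"
    using pD(2-4)[of i] pD(4)[of "p i"] by (auto simp: doubleton_eq_iff)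
  then show "a \<in> V" "a \<notin> U" "b \<in> V" "b \<notin> U"
    using pD(2-4)[of a] pD(4)[of b] by auto
  show "matchable V G (insert a (insert b U))"
    using matchable_delete_edge[OF p ab(1,2)] matchable_mono unfolding ab(3) by blast
qed

lemma matchable_glue:
  assumes "matchable V1 G U1" "matchable V2 G U2" "V1 \<inter> V2 = {}"
  shows "matchable (V1 \<union> V2) G (U1 \<union> U2)"
proof -
  obtain p q where "matches V1 G U1 p" "matches V2 G U2 q"
    using assms(1,2) by (meson matchableE)
  then have "matches (V1 \<union> V2) G (U1 \<union> U2) (\<lambda>i. if i \<in> V1 then p i else q i)"
    using assms(3) unfolding matches_def by (auto simp: disjoint_iff subset_iff)
  then show ?thesis
    unfolding matchable_def by blast
qed

lemma matchable_restrict: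
  "matchable V (G \<inter> edges_on V) U \<longleftrightarrow> matchable V G U"
proof
  assume "matchable V G U"
  then obtain p where p: "matches V G U p"
    by (rule matchableE)
  then have "matches V (G \<inter> edges_on V) U p"
    unfolding matches_def by (auto simp: insert_in_edges_on)
  then show "matchable V (G \<inter> edges_on V) U"
    unfolding matchable_def by blast
qed (auto elim: matchable_mono)

section \<open>Factor criticality in terms of matchable sets\<close>

definition all_matchable :: "'a set \<Rightarrow> 'a set set \<Rightarrow> bool" where
  "all_matchable V G \<longleftrightarrow> (\<forall>v\<in>V. matchable V G {v})"

lemma odd_card_matchable:
  assumes "matchable V G {v}" "finite V"
  shows "odd (card V)"
proof -
  obtain p where p: "matches V G {v} p"
    using assms(1) by (rule matchableE)
  have "v \<in> V"
    using matchesD(1)[OF p] by blast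
  have "even (card (V - {v}))"
  proof (rule even_card_matches[OF p assms(2)])
    fix i assume i: "i \<in> V - {v}"
    then have "p i = v \<Longrightarrow> i = v"
      using matchesD(3)[OF p, of i] matchesD(4)[OF p \<open>v \<in> V\<close>] by auto
    then show "p i \<in> V - {v}"
      using i matchesD(2)[OF p, of i] by blast
  qed auto
  then show ?thesis
    using card_Suc_Diff1[OF assms(2) \<open>v \<in> V\<close>] even_Suc by metis
qed

lemma odd_card_all_matchable:
  assumes "all_matchable V G" "finite V" "V \<noteq> {}"
  shows "odd (card V)"
proof -
  obtain v where "v \<in> V"
    using assms(3) by blast
  then have "matchable V G {v}"
    using assms(1) by (simp add: all_matchable_def)
  then show ?thesis
    using assms(2) by (rule odd_card_matchable)
qed

lemma perfect_matching_imp_matchable: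
  assumes "v \<in> V" "G \<subseteq> edges_on V" "perfect_matching (V - {v}) {e \<in> G. v \<notin> e} M"
  shows "matchable V G {v}"
proof -
  have M: "M \<subseteq> {e \<in> G. v \<notin> e}" and ex1: "\<And>i. i \<in> V - {v} \<Longrightarrow> \<exists>!e. e \<in> M \<and> i \<in> e"
    using assms(3) by (auto simp: perfect_matching_def)
  have "\<exists>j. j \<in> V \<and> j \<noteq> v \<and> j \<noteq> i \<and> {i, j} \<in> M" if i: "i \<in> V - {v}" for i
  proof -
    obtain e where e: "e \<in> M" "i \<in> e"
      using ex1[OF i] by blast
    then have eG: "e \<in> edges_on V" "e \<in> G" "v \<notin> e"
      using M assms(2) by blast+
    from eG(1) obtain a b where ab: "e = {a, b}" "a \<noteq> b" "a \<in> V" "b \<in> V"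
      by (rule edges_onE)
    show ?thesis
    proof (cases "i = a")
      case True
      then show ?thesis
        using ab e(1) eG(3) by (intro exI[of _ b]) auto
    next
      case False
      then have "i = b"
        using e(2) ab by blast
      then show ?thesis
        using ab e(1) eG(3) by (intro exI[of _ a]) (auto simp: insert_commute)
    qed
  qed
  then obtain f where f: "\<And>i. i \<in> V - {v} \<Longrightarrow> f i \<in> V \<and> f i \<noteq> v \<and> f i \<noteq> i \<and> {i, f i} \<in> M"
    by metis
  have ff: "f (f i) = i" if i: "i \<in> V - {v}" for i
  proof -
    have fi: "f i \<in> V - {v}"
      using f[OF i] by blast
    have "{f i, f (f i)} = {i, f i}"
      using ex1[OF fi] f[OF i] f[OF fi] by blast
    then show ?thesis
      using f[OF i] by (auto simp: doubleton_eq_iff)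
  qed
  have "matches V G {v} (f(v := v))"
    using assms(1) f ff M unfolding matches_def by auto
  then show ?thesis
    unfolding matchable_def by blast
qed

lemma matchable_imp_perfect_matching:
  assumes "v \<in> V" "matchable V G {v}"
  shows "\<exists>M. perfect_matching (V - {v}) {e \<in> G. v \<notin> e} M"
proof -
  obtain p where p: "matches V G {v} p"
    using assms(2) by (rule matchableE)
  note pD = matchesD[OF p]
  let ?M = "(\<lambda>i. {i, p i}) ` (V - {v})"
  have nv: "p i \<noteq> v" if "i \<in> V - {v}" for i
    using that pD(3)[of i] pD(4)[OF assms(1)] by auto
  have "perfect_matching (V - {v}) {e \<in> G. v \<notin> e} ?M"
    unfolding perfect_matching_def
  proof (intro conjI ballI)
    show "?M \<subseteq> {e \<in> G. v \<notin> e}"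
      using pD(5) nv by auto
    fix i assume i: "i \<in> V - {v}"
    show "\<exists>!e. e \<in> ?M \<and> i \<in> e"
    proof (rule ex1I[of _ "{i, p i}"])
      fix e assume "e \<in> ?M \<and> i \<in> e"
      then obtain j where "j \<in> V - {v}" "e = {j, p j}" "i \<in> {j, p j}"
        by blast
      then show "e = {i, p i}"
        using pD(3)[of j] by auto
    qed (use i in auto)
  qed
  then show ?thesis
    by blast
qed

lemma factor_critical_iff_all_matchable:
  assumes "finite V" "V \<noteq> {}" "G \<subseteq> edges_on V"
  shows "factor_critical V G \<longleftrightarrow> all_matchable V G"
proof
  assume fc: "factor_critical V G"
  show "all_matchable V G"
    unfolding all_matchable_def
  proof
    fix v assume v: "v \<in> V"
    then obtain M where "perfect_matching (V - {v}) {e \<in> G. v \<notin> e} M"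
      using fc unfolding factor_critical_def by (elim conjE bspec[elim_format] exE) auto
    then show "matchable V G {v}"
      by (rule perfect_matching_imp_matchable[OF v assms(3)])
  qed
next
  assume am: "all_matchable V G"
  show "factor_critical V G"
    unfolding factor_critical_def
  proof (intro conjI ballI)
    show "odd (card V)"
      by (rule odd_card_all_matchable[OF am assms(1,2)])
    fix v assume v: "v \<in> V"
    then have "matchable V G {v}"
      using am by (simp add: all_matchable_def)
    then show "\<exists>M. perfect_matching (V - {v}) {e \<in> G. v \<notin> e} M"
      by (rule matchable_imp_perfect_matching[OF v])
  qed
qed

text \<open>For a graph with a near-perfect matching the next two sets are \<open>D(G)\<close> and \<open>A(G)\<close> of the
  Gallai-Edmonds decomposition; two vertices of \<open>D(G)\<close> are separated iff they lie in different
  components of the graph induced on \<open>D(G)\<close>.\<close>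

definition deficient :: "'a set \<Rightarrow> 'a set set \<Rightarrow> 'a set" where
  "deficient V G = {v \<in> V. matchable V G {v}}"

definition boundary :: "'a set \<Rightarrow> 'a set set \<Rightarrow> 'a set" where
  "boundary V G = {a \<in> V - deficient V G. \<exists>u\<in>deficient V G. {u, a} \<in> G}"

definition separated :: "'a set \<Rightarrow> 'a set set \<Rightarrow> 'a \<Rightarrow> 'a \<Rightarrow> bool" where
  "separated V G u w \<longleftrightarrow> u \<noteq> w \<and> (\<exists>v\<in>V - deficient V G. matchable V G {u, w, v})"

lemma deficient_subset: "deficient V G \<subseteq> V"
  by (auto simp: deficient_def)

lemma deficient_mono: "G \<subseteq> H \<Longrightarrow> deficient V G \<subseteq> deficient V H"
  using matchable_mono unfolding deficient_def by blast

lemma mem_deficient: "matchable V G {v} \<Longrightarrow> v \<in> deficient V G"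
  using matchable_subset[of V G "{v}"] by (simp add: deficient_def)

lemma deficientD: "v \<in> deficient V G \<Longrightarrow> matchable V G {v}"
  by (simp add: deficient_def)

text \<open>Let \<open>u\<close> in D be a neighbour of \<open>a\<close>. Exchanging with a matching
  that misses \<open>u\<close> alone, \<open>u\<close> can replace only \<open>v\<close>, because
  the replaced vertex lies in D. Then \<open>u\<close>, \<open>a\<close>, \<open>b\<close> are
  missed, and adding the edge \<open>ua\<close> puts \<open>b\<close> into D.\<close>

lemma not_matchable_boundary:
  assumes "finite V" "a \<in> boundary V G" "b \<in> V - deficient V G" "a \<noteq> b" "v \<noteq> a" "v \<noteq> b"
  shows "\<not> matchable V G {a, b, v}"
proof
  assume m: "matchable V G {a, b, v}"
  obtain u where u: "u \<in> deficient V G" "{u, a} \<in> G" and a: "a \<in> V - deficient V G"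
    using assms(2) by (auto simp: boundary_def)
  have ne: "u \<noteq> a" "u \<noteq> b"
    using u(1) a assms(3) by auto
  have red: "b \<in> deficient V G" if "matchable V G {u, a, b}"
    using matchable_add_edge[of V G u a "{b}"] that u(2) ne assms(4) by (simp add: mem_deficient)
  show False
  proof (cases "u = v")
    case True
    then show ?thesis
      using red m assms(3) by (simp add: insert_commute)
  next
    case False
    then have u': "u \<notin> {a, b, v}"
      using ne by blast
    show ?thesis
    proof (cases rule: matchable_exchange[OF m deficientD[OF u(1)] assms(1) singletonI u', case_names across within])
      case (across x)
      have "x \<in> deficient V G"
        using across(4) by (simp add: mem_deficient)
      then have "x = v"
        using across(1) a assms(3) by blast
      then have "matchable V G {u, a, b}"
        using across(3) assms(5,6) by (simp add: insert_Diff_if)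
      then show ?thesis
        using red assms(3) by blast
    next
      case (within x)
      then show ?thesis by simp
    qed
  qed
qed

lemma separated_sym: "separated V G u w \<longleftrightarrow> separated V G w u"
  unfolding separated_def by (simp add: insert_commute eq_commute)

text \<open>In a matching that misses \<open>u\<close>, \<open>w\<close>, \<open>v\<close>, the
  vertex \<open>t\<close> can be exchanged with \<open>u\<close> or \<open>w\<close>, but not with
  \<open>v\<close>, which is outside D. Hence not being separated is an equivalence relation on D,
  and the components of D are available without speaking of paths.\<close>

lemma separated_trans:
  assumes "finite V" "separated V G u w" "t \<in> deficient V G" "u \<in> deficient V G" "w \<in> deficient V G"
  shows "separated V G u t \<or> separated V G t w"
proof (cases "t = u \<or> t = w")
  case True
  then show ?thesis
    using assms(2) by (auto)
next
  case False
  obtain v where v: "v \<in> V - deficient V G" "matchable V G {u, w, v}" and uw: "u \<noteq> w"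
    using assms(2) by (auto simp: separated_def)
  have ne: "t \<noteq> v" "u \<noteq> v" "w \<noteq> v"
    using assms(3-5) v(1) by auto
  then have t: "t \<notin> {u, w, v}"
    using False by blast
  show ?thesis
  proof (cases rule: matchable_exchange[OF v(2) deficientD[OF assms(3)] assms(1) singletonI t, case_names across within])
    case (across x)
    have "x \<noteq> v"
      using across(4) v(1) mem_deficient[of V G v] by auto
    then consider "x = u" | "x = w"
      using across(1) by blast
    then show ?thesis
    proof cases
      case 1
      then have "matchable V G {t, w, v}"
        using across(3) uw ne by (simp add: insert_Diff_if)
      then show ?thesis
        using v(1) False by (auto simp: separated_def)
    next
      case 2
      then have "matchable V G {u, t, v}"
        using across(3) uw ne by (simp add: insert_Diff_if insert_commute)
      then show ?thesis
        using v(1) False by (auto simp: separated_def)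
    qed
  next
    case (within x)
    then show ?thesis by simp
  qed
qed

lemma adjacent_not_separated:
  assumes "{u, w} \<in> G" "u \<in> deficient V G" "w \<in> deficient V G"
  shows "\<not> separated V G u w"
proof
  assume "separated V G u w"
  then obtain v where v: "v \<in> V - deficient V G" "matchable V G {u, w, v}" and uw: "u \<noteq> w"
    by (auto simp: separated_def)
  have "matchable V G {v}"
    using matchable_add_edge[of V G u w "{v}"] v uw assms by auto
  from mem_deficient[OF this] show False
    using v(1) by blast
qed

text \<open>If the edge \<open>ab\<close> were needed, deleting it would leave \<open>a\<close> and
  \<open>b\<close> missed as well, and \<open>not_matchable_boundary\<close> excludes this, directly
  or after an exchange.\<close>

lemma boundary_edge_irrelevant:
  assumes "finite V" "a \<in> boundary V G" "b \<in> boundary V G" "a \<noteq> b"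
  shows "matchable V (insert {a, b} G) {v} \<longleftrightarrow> matchable V G {v}"
    and "deficient V (insert {a, b} G) = deficient V G"
    and "boundary V (insert {a, b} G) = boundary V G"
    and "x \<noteq> y \<Longrightarrow> x \<in> deficient V G \<Longrightarrow> y \<in> deficient V G \<Longrightarrow> w \<in> V - deficient V G \<Longrightarrow>
      matchable V (insert {a, b} G) {x, y, w} \<longleftrightarrow> matchable V G {x, y, w}"
proof -
  have ab: "a \<in> V - deficient V G" "b \<in> V - deficient V G"
    using assms(2,3) by (auto simp: boundary_def)
  show 1: "matchable V (insert {a, b} G) {v} \<longleftrightarrow> matchable V G {v}" for v
  proof
    assume m: "matchable V (insert {a, b} G) {v}"
    show "matchable V G {v}"
    proof (rule ccontr)
      assume n: "\<not> matchable V G {v}"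
      note e = matchable_insert_edge[OF assms(4) m n]
      show False
        using not_matchable_boundary[OF assms(1,2) ab(2) assms(4), of v] e(3-5) by auto
    qed
  qed (auto elim: matchable_mono)
  then show 2: "deficient V (insert {a, b} G) = deficient V G"
    by (simp add: deficient_def)
  show "boundary V (insert {a, b} G) = boundary V G"
    unfolding boundary_def 2 using ab by (auto simp: doubleton_eq_iff)
  show "matchable V (insert {a, b} G) {x, y, w} \<longleftrightarrow> matchable V G {x, y, w}"
    if xy: "x \<noteq> y" "x \<in> deficient V G" "y \<in> deficient V G" and w: "w \<in> V - deficient V G"
  proof
    assume m: "matchable V (insert {a, b} G) {x, y, w}"
    show "matchable V G {x, y, w}"
    proof (rule ccontr)
      assume n: "\<not> matchable V G {x, y, w}"
      note e = matchable_insert_edge[OF assms(4) m n]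
      have ne: "x \<noteq> y" "a \<noteq> x" "a \<noteq> y" "a \<noteq> w" "b \<noteq> x" "b \<noteq> y" "b \<noteq> w" "x \<noteq> w" "y \<noteq> w"
        using xy w e(3,4) by auto
      have bad: "\<not> matchable V G {a, b, x}" "\<not> matchable V G {a, w, x}" "\<not> matchable V G {b, w, x}"
        using not_matchable_boundary[OF assms(1,2) ab(2) assms(4), of x]
          not_matchable_boundary[OF assms(1,2) w, of x] not_matchable_boundary[OF assms(1,3) w, of x] ne
        by simp_all
      have y: "y \<in> {a, b, x, y, w}" "y \<notin> {x}"
        using ne by blast+
      show False
      \<comment> \<open>Five vertices are missed. The exchange at \<open>y\<close> against a
        matching missing only \<open>x\<close> removes \<open>y\<close> and one of \<open>a\<close>,
        \<open>b\<close>, \<open>w\<close>; the other two, together with \<open>x\<close>, form a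
        forbidden triple.\<close>
      proof (cases rule: matchable_exchange[OF deficientD[OF xy(2)] e(5) assms(1) y, case_names across within])
        case (across x')
        then show ?thesis by simp
      next
        case (within x')
        then consider "x' = a" | "x' = b" | "x' = w"
          by blast
        then show ?thesis
        proof cases
          case 1
          then have "{a, b, x, y, w} - {y, x'} = {b, w, x}"
            using ne assms(4) by auto
          then show ?thesis
            using within(5) bad by simp
        next
          case 2
          then have "{a, b, x, y, w} - {y, x'} = {a, w, x}"
            using ne assms(4) by auto
          then show ?thesis
            using within(5) bad by simp
        next
          case 3
          then have "{a, b, x, y, w} - {y, x'} = {a, b, x}"
            using ne assms(4) by auto
          then show ?thesis
            using within(5) bad by simp
        qed
      qed
    qed
  qed (auto elim: matchable_mono)
qed

text \<open>Not an instance of the preceding lemma for the smaller graph, since it must first be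
  shown that \<open>a\<close> and \<open>b\<close> still lie in the boundary there.\<close>

lemma boundary_edge_remove:
  assumes "finite V" "a \<in> boundary V G" "b \<in> boundary V G" "a \<noteq> b"
  shows "deficient V (G - {{a, b}}) = deficient V G"
    and "boundary V (G - {{a, b}}) = boundary V G"
proof -
  have ab: "a \<in> V - deficient V G" "b \<in> V - deficient V G"
    using assms(2,3) by (auto simp: boundary_def)
  have "matchable V (G - {{a, b}}) {v}" if "matchable V G {v}" for v
  proof (rule ccontr)
    assume n: "\<not> matchable V (G - {{a, b}}) {v}"
    have "matchable V (insert {a, b} (G - {{a, b}})) {v}"
      by (rule matchable_mono[OF that]) blast
    note e = matchable_insert_edge[OF assms(4) this n]
    have "matchable V G {a, b, v}"
      by (rule matchable_mono[OF e(5)]) blast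
    then show False
      using not_matchable_boundary[OF assms(1,2) ab(2) assms(4), of v] e(3,4) by auto
  qed
  then have "matchable V (G - {{a, b}}) {v} \<longleftrightarrow> matchable V G {v}" for v
    using matchable_mono[of V "G - {{a, b}}" "{v}" G] by blast
  then show 1: "deficient V (G - {{a, b}}) = deficient V G"
    by (simp add: deficient_def)
  show "boundary V (G - {{a, b}}) = boundary V G"
    unfolding boundary_def 1 using ab by (auto simp: doubleton_eq_iff)
qed

section \<open>Graphs with an indispensable edge\<close>

text \<open>What remains of a factor critical graph after deletion of an indispensable edge
  \<open>xy\<close>. A vertex \<open>v\<close> outside D was missed only by matchings through
  \<open>xy\<close>; without that edge they miss \<open>x\<close>, \<open>y\<close> and
  \<open>v\<close>.\<close>

definition tight :: "'a set \<Rightarrow> 'a \<Rightarrow> 'a \<Rightarrow> 'a set set \<Rightarrow> bool" where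
  "tight V x y G \<longleftrightarrow> x \<in> deficient V G \<and> y \<in> deficient V G \<and> V - deficient V G \<noteq> {} \<and>
    (\<forall>v\<in>V - deficient V G. matchable V G {x, y, v})"

lemma tight_iff:
  assumes "x \<in> V" "y \<in> V" "x \<noteq> y"
  shows "tight V x y G \<longleftrightarrow> all_matchable V (insert {x, y} G) \<and> \<not> all_matchable V G"
proof
  assume t: "tight V x y G"
  have "matchable V (insert {x, y} G) {v}" if v: "v \<in> V" for v
  proof (cases "v \<in> deficient V G")
    case True
    show ?thesis
      by (rule matchable_mono[OF deficientD[OF True] subset_insertI])
  next
    case False
    then have m: "matchable V G {x, y, v}" and ne: "v \<noteq> x" "v \<noteq> y"
      using t v by (auto simp: tight_def)
    have "matchable V (insert {x, y} G) {x, y, v}"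
      by (rule matchable_mono[OF m subset_insertI])
    then show ?thesis
      by (rule matchable_add_edge) (use ne assms(3) in auto)
  qed
  moreover have "\<exists>v\<in>V. \<not> matchable V G {v}"
    using t by (auto simp: tight_def deficient_def)
  ultimately show "all_matchable V (insert {x, y} G) \<and> \<not> all_matchable V G"
    by (auto simp: all_matchable_def)
next
  assume a: "all_matchable V (insert {x, y} G) \<and> \<not> all_matchable V G"
  have *: "v \<noteq> x \<and> v \<noteq> y \<and> matchable V G {x, y, v}" if "v \<in> V" "\<not> matchable V G {v}" for v
  proof -
    have "matchable V (insert {x, y} G) {v}"
      using a that(1) by (simp add: all_matchable_def)
    from matchable_insert_edge[OF assms(3) this that(2)] show ?thesis
      by auto
  qed
  then have "x \<in> deficient V G" "y \<in> deficient V G"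
    using assms by (auto simp: deficient_def)
  moreover have "V - deficient V G \<noteq> {}"
    using a by (auto simp: deficient_def all_matchable_def)
  ultimately show "tight V x y G"
    using * by (auto simp: tight_def deficient_def)
qed

lemma tight_boundary_edge:
  assumes "finite V" "a \<in> boundary V G" "b \<in> boundary V G" "a \<noteq> b" "x \<noteq> y" "tight V x y G"
  shows "tight V x y (insert {a, b} G)" and "tight V x y (G - {{a, b}})"
proof -
  note i = boundary_edge_irrelevant[OF assms(1-4)] and r = boundary_edge_remove[OF assms(1-4)]
  show "tight V x y (insert {a, b} G)"
    using assms(5,6) i(4)[of x y] unfolding tight_def i(2) by blast
  let ?H = "G - {{a, b}}"
  have ab: "a \<in> boundary V ?H" "b \<in> boundary V ?H"
    using assms(2,3) r(2) by auto
  have "matchable V ?H {x, y, v}" if v: "v \<in> V - deficient V G" for v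
  proof -
    have "matchable V G {x, y, v}"
      using assms(6) v by (simp add: tight_def)
    then have "matchable V (insert {a, b} ?H) {x, y, v}"
      by (rule matchable_mono) blast
    moreover have "x \<in> deficient V ?H" "y \<in> deficient V ?H" "v \<in> V - deficient V ?H"
      using assms(6) v unfolding r(1) by (simp_all add: tight_def)
    ultimately show ?thesis
      using boundary_edge_irrelevant(4)[OF assms(1) ab assms(4,5)] by blast
  qed
  then show "tight V x y ?H"
    using assms(6) unfolding tight_def r(1) by blast
qed

text \<open>For \<open>v\<close> in D, the component of \<open>v\<close> in the graph induced on
  D.\<close>

definition kin :: "'a set \<Rightarrow> 'a set set \<Rightarrow> 'a \<Rightarrow> 'a set" where
  "kin V G v = {w \<in> deficient V G. \<not> separated V G v w}"

lemma kin_refl: "v \<in> deficient V G \<Longrightarrow> v \<in> kin V G v"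
  by (simp add: kin_def separated_def)

lemma kin_eq:
  assumes "finite V" "v \<in> deficient V G" "u \<in> kin V G v"
  shows "kin V G u = kin V G v"
proof -
  have u: "u \<in> deficient V G" "\<not> separated V G v u" "\<not> separated V G u v"
    using assms(3) separated_sym[of V G u v] by (auto simp: kin_def)
  have "separated V G u w \<longleftrightarrow> separated V G v w" if "w \<in> deficient V G" for w
    using separated_trans[OF assms(1), of G u w v] separated_trans[OF assms(1), of G v w u]
      assms(2) u that by auto
  then show ?thesis
    by (auto simp: kin_def)
qed

text \<open>A matching that misses only \<open>v\<close> cannot leave the component of
  \<open>v\<close>: an edge from a vertex \<open>w\<close> of it to a vertex outside D could be
  deleted, and the three vertices then missed would show that \<open>v\<close> and \<open>w\<close>
  are separated.\<close>

lemma kin_matchable: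
  assumes "finite V" "v \<in> deficient V G"
  shows "matchable (kin V G v) G {v}"
proof -
  obtain p where p: "matches V G {v} p"
    using deficientD[OF assms(2)] by (rule matchableE)
  note pD = matchesD[OF p]
  have closed: "p w \<in> kin V G v" if w: "w \<in> kin V G v" for w
  proof (cases "w = v")
    case True
    then show ?thesis
      using pD(1) pD(4)[of v] w by auto
  next
    case False
    have wD: "w \<in> deficient V G" "w \<in> V" "\<not> separated V G v w"
      using w deficient_subset[of V G] by (auto simp: kin_def)
    have "p w \<in> deficient V G"
    proof (rule ccontr)
      assume n: "p w \<notin> deficient V G"
      have "matchable V (G - {{w, p w}}) {w, p w, v}"
        using matchable_delete_edge[OF p wD(2)] False by simp
      then have "matchable V G {w, p w, v}"
        by (rule matchable_mono) blast
      then have "matchable V G {v, w, p w}"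
        by (simp add: insert_commute)
      then have "separated V G v w"
        using False n pD(2)[OF wD(2)] by (auto simp: separated_def)
      then show False
        using wD(3) by blast
    qed
    moreover have "\<not> separated V G w (p w)"
      using pD(5)[OF wD(2)] False wD(1) calculation by (intro adjacent_not_separated) auto
    ultimately show ?thesis
      using separated_trans[OF assms(1), of G v "p w" w] wD assms(2) by (auto simp: kin_def)
  qed
  have "kin V G v \<subseteq> V"
    using deficient_subset[of V G] by (auto simp: kin_def)
  then have "matches (kin V G v) G {v} p"
    using closed pD kin_refl[OF assms(2)] unfolding matches_def by blast
  then show ?thesis
    unfolding matchable_def by blast
qed

lemma odd_card_kin:
  assumes "finite V" "v \<in> deficient V G"
  shows "odd (card (kin V G v))"
proof -
  have "finite (kin V G v)"
    using assms(1) deficient_subset[of V G] by (auto simp: kin_def intro: finite_subset)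
  then show ?thesis
    by (rule odd_card_matchable[OF kin_matchable[OF assms]])
qed

lemma matched_within_kin_or_boundary:
  assumes "finite V" "matches V G U p" "i \<in> deficient V G" "i \<notin> U"
  shows "p i \<in> kin V G i \<or> p i \<in> boundary V G"
proof -
  note pD = matchesD[OF assms(2)]
  have i: "i \<in> V"
    using assms(3) deficient_subset[of V G] by blast
  have e: "{i, p i} \<in> G"
    by (rule pD(5)[OF i assms(4)])
  show ?thesis
  proof (cases "p i \<in> deficient V G")
    case True
    then show ?thesis
      using adjacent_not_separated[OF e assms(3) True] by (simp add: kin_def)
  next
    case False
    then show ?thesis
      using assms(3) e pD(2)[OF i] by (auto simp: boundary_def)
  qed
qed

text \<open>A component of D is odd, so a matching whose missed vertex lies elsewhere must leave it,
  and an edge that leaves it ends in A.\<close>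

lemma kin_exit:
  assumes "finite V" "matches V G {u} q" "w \<in> deficient V G" "separated V G u w"
  obtains i where "i \<in> kin V G w" "i \<noteq> u" "q i \<in> boundary V G"
proof -
  have u: "u \<notin> kin V G w"
    using assms(4) separated_sym[of V G u w] by (auto simp: kin_def)
  have sub: "kin V G w \<subseteq> V"
    using deficient_subset[of V G] by (auto simp: kin_def)
  obtain i where i: "i \<in> kin V G w" "q i \<notin> kin V G w"
    using even_card_matches[OF assms(2,1) sub] u odd_card_kin[OF assms(1,3)] by blast
  have "i \<in> deficient V G" "i \<noteq> u"
    using i(1) u by (auto simp: kin_def)
  then have "q i \<in> boundary V G"
    using matched_within_kin_or_boundary[OF assms(1,2), of i] kin_eq[OF assms(1,3) i(1)] i(2) by auto
  then show thesis
    using that i(1) \<open>i \<noteq> u\<close> by blast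
qed

lemma tight_separated: "x \<noteq> y \<Longrightarrow> tight V x y G \<Longrightarrow> separated V G x y"
  by (auto simp: tight_def separated_def)

lemma tight_boundary_nonempty:
  assumes "finite V" "x \<noteq> y" "tight V x y G"
  shows "boundary V G \<noteq> {}"
proof -
  obtain q where q: "matches V G {x} q"
    using assms(3) deficientD[of x V G] by (auto simp: tight_def elim: matchableE)
  have "y \<in> deficient V G"
    using assms(3) by (simp add: tight_def)
  from kin_exit[OF assms(1) q this tight_separated[OF assms(2,3)]] show ?thesis
    by blast
qed

abbreviation star :: "'a \<Rightarrow> 'a set \<Rightarrow> 'a set set" where
  "star z X \<equiv> (\<lambda>k. {z, k}) ` X"

text \<open>In a matching missing \<open>x\<close>, every component of D other than that of
  \<open>x\<close> must contain the partner of \<open>z\<close>. So there is only one such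
  component, namely that of \<open>y\<close>, and \<open>z\<close> is the only link from
  \<open>X\<close> and \<open>Y\<close> to the rest.\<close>

lemma tight_structure:
  fixes V :: "'a set" and x y z :: 'a and G :: "'a set set"
  defines "Y \<equiv> {w \<in> deficient V G. separated V G x w}"
  defines "X \<equiv> deficient V G - Y" and "Z \<equiv> V - deficient V G"
  assumes V: "finite V" "x \<noteq> y" "G \<subseteq> edges_on V" and t: "tight V x y G" and z: "boundary V G = {z}"
  shows "x \<in> X" "y \<in> Y" "z \<in> Z" "all_matchable X G" "all_matchable Y G" "all_matchable Z G"
    "\<exists>k\<in>X. {z, k} \<in> G" "\<exists>k\<in>Y. {z, k} \<in> G"
    "G \<subseteq> edges_on X \<union> edges_on Y \<union> edges_on Z \<union> star z X \<union> star z Y"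
proof -
  let ?D = "deficient V G"
  have D: "x \<in> ?D" "y \<in> ?D" "?D \<subseteq> V"
    using t deficient_subset[of V G] by (auto simp: tight_def)
  have sep: "separated V G x y" "separated V G y x"
    using tight_separated[OF V(2) t] separated_sym[of V G x y] by auto
  have X: "X = kin V G x"
    unfolding X_def Y_def kin_def by blast
  obtain q where q: "matches V G {x} q"
    using deficientD[OF D(1)] by (rule matchableE)
  obtain q' where q': "matches V G {y} q'"
    using deficientD[OF D(2)] by (rule matchableE)
  have qz: "q z \<in> kin V G w \<and> {z, q z} \<in> G" if w: "w \<in> ?D" "separated V G x w" for w
  proof -
    obtain i where i: "i \<in> kin V G w" "i \<noteq> x" "q i = z"
      using kin_exit[OF V(1) q w] z by blast
    have "i \<in> V"
      using i(1) D(3) by (auto simp: kin_def)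
    then have "q z = i" "{i, q i} \<in> G"
      using i matchesD(3,5)[OF q, of i] by auto
    then show ?thesis
      using i by (simp add: insert_commute)
  qed
  have kinY: "kin V G w = kin V G (q z)" if "w \<in> ?D" "separated V G x w" for w
    using kin_eq[OF V(1) that(1)] qz[OF that] by blast
  have Y: "Y = kin V G y"
  proof
    show "Y \<subseteq> kin V G y"
    proof
      fix w assume "w \<in> Y"
      then have w: "w \<in> ?D" "separated V G x w"
        by (auto simp: Y_def)
      have "kin V G w = kin V G y"
        using kinY[OF w] kinY[OF D(2) sep(1)] by simp
      then show "w \<in> kin V G y"
        using kin_refl[OF w(1)] by simp
    qed
    show "kin V G y \<subseteq> Y"
    proof
      fix w assume "w \<in> kin V G y"
      then have w: "w \<in> ?D" "\<not> separated V G w y"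
        using separated_sym[of V G w y] by (auto simp: kin_def)
      then show "w \<in> Y"
        using separated_trans[OF V(1) sep(1) w(1) D(1,2)] by (auto simp: Y_def)
    qed
  qed
  show "x \<in> X" "y \<in> Y" "z \<in> Z"
    using X Y D kin_refl z by (auto simp: Z_def boundary_def)
  have split: "?D = X \<union> Y" "X \<inter> Y = {}" "V = X \<union> Y \<union> Z"
    using D(3) by (auto simp: X_def Y_def Z_def)
  have am: "all_matchable (kin V G v) G" if "v \<in> ?D" for v
    unfolding all_matchable_def
  proof
    fix u assume "u \<in> kin V G v"
    then have "u \<in> ?D" "kin V G u = kin V G v"
      using kin_eq[OF V(1) that] by (auto simp: kin_def)
    then show "matchable (kin V G v) G {u}"
      using kin_matchable[OF V(1), of u G] by simp
  qed
  show "all_matchable X G" "all_matchable Y G"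
    using am D X Y by auto
  show "\<exists>k\<in>Y. {z, k} \<in> G"
    using qz[OF D(2) sep(1)] Y by blast
  \<comment> \<open>The same argument with \<open>x\<close> and \<open>y\<close> interchanged yields
    the edge from \<open>z\<close> into \<open>X\<close>.\<close>
  obtain i where i: "i \<in> kin V G x" "i \<noteq> y" "q' i = z"
    using kin_exit[OF V(1) q' D(1) sep(2)] z by blast
  have "i \<in> V"
    using i(1) D(3) by (auto simp: kin_def)
  then have "{z, i} \<in> G"
    using i matchesD(5)[OF q', of i] by (auto simp: insert_commute)
  then show "\<exists>k\<in>X. {z, k} \<in> G"
    using i(1) X by blast
  have kinX: "kin V G i = X" if "i \<in> X" for i
    using that kin_eq[OF V(1) D(1)] X by blast
  have kinY': "kin V G i = Y" if "i \<in> Y" for i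
    using that kin_eq[OF V(1) D(2)] Y by blast
  have cross_kin: "j \<in> K \<or> j = z" if "{i, j} \<in> G" "i \<in> ?D" "kin V G i = K" for i j K
  proof (cases "j \<in> ?D")
    case True
    then show ?thesis
      using adjacent_not_separated[OF that(1,2)] that(3) by (auto simp: kin_def)
  next
    case False
    moreover have "j \<in> V"
      using that(1) V(3) insert_in_edges_on[of i j V] by blast
    ultimately have "j \<in> boundary V G"
      using that by (auto simp: boundary_def)
    then show ?thesis
      using z by blast
  qed
  have cross: "j \<in> X \<or> j = z" if "{i, j} \<in> G" "i \<in> X" for i j
    by (rule cross_kin[OF that(1) _ kinX[OF that(2)]]) (use that(2) split(1) in blast)
  have cross': "j \<in> Y \<or> j = z" if "{i, j} \<in> G" "i \<in> Y" for i j
    by (rule cross_kin[OF that(1) _ kinY'[OF that(2)]]) (use that(2) split(1) in blast)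
  show "G \<subseteq> edges_on X \<union> edges_on Y \<union> edges_on Z \<union> star z X \<union> star z Y"
  proof
    fix e assume e: "e \<in> G"
    then obtain i j where ij: "e = {i, j}" "i \<noteq> j" "i \<in> V" "j \<in> V"
      using V(3) edges_onE by blast
    have e': "{i, j} \<in> G" "{j, i} \<in> G"
      using e ij(1) by (simp_all add: insert_commute)
    consider "i \<in> X" | "i \<in> Y" | "j \<in> X" | "j \<in> Y" | "i \<in> Z" "j \<in> Z"
      using ij(3,4) split(3) by blast
    then show "e \<in> edges_on X \<union> edges_on Y \<union> edges_on Z \<union> star z X \<union> star z Y"
    proof cases
      case 1
      then show ?thesis
        using cross[OF e'(1)] ij(1,2) by (auto simp: insert_in_edges_on insert_commute)
    next
      case 2
      then show ?thesis
        using cross'[OF e'(1)] ij(1,2) by (auto simp: insert_in_edges_on insert_commute)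
    next
      case 3
      then show ?thesis
        using cross[OF e'(2)] ij(1,2) by (auto simp: insert_in_edges_on insert_commute)
    next
      case 4
      then show ?thesis
        using cross'[OF e'(2)] ij(1,2) by (auto simp: insert_in_edges_on insert_commute)
    next
      case 5
      then show ?thesis
        using ij(1,2) by (auto simp: insert_in_edges_on)
    qed
  qed
  show "all_matchable Z G"
    unfolding all_matchable_def
  proof
    fix v assume v: "v \<in> Z"
    obtain p where p: "matches V G {x, y, v} p"
      using t v unfolding tight_def Z_def by (auto elim: matchableE)
    note pD = matchesD[OF p]
    have exit_edge: "p j \<in> K" if "j \<in> K" "K = X \<or> K = Y" "p j \<noteq> z" "j \<notin> {x, y, v}" for j K
    proof -
      have "{j, p j} \<in> G"
        using that pD(5) split(3) by blast
      then show ?thesis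
        using that cross cross' by blast
    qed
    \<comment> \<open>Parity: \<open>K\<close> is odd and contains exactly one missed vertex. If one
      more vertex were matched to \<open>z\<close>, an odd number would remain, with no way out of
      \<open>K\<close>.\<close>
    have no: "p z \<notin> K" if K: "K = X \<and> c = x \<or> K = Y \<and> c = y" for K c
    proof
      assume pz: "p z \<in> K"
      have zV: "z \<in> V" "z \<notin> K"
        using \<open>z \<in> Z\<close> K split(1) by (auto simp: Z_def)
      have "v \<notin> X \<union> Y"
        using v split(1) unfolding Z_def by blast
      moreover have "x \<notin> Y" "y \<notin> X"
        using split(2) \<open>x \<in> X\<close> \<open>y \<in> Y\<close> by blast+
      moreover have "K = X \<or> K = Y"
        using K by blast
      moreover have "c \<in> K"
        using K \<open>x \<in> X\<close> \<open>y \<in> Y\<close> by blast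
      moreover have "K \<subseteq> V"
        using K split(3) by blast
      ultimately have c: "c \<in> K" "K \<inter> {x, y, v} = {c}" "K \<subseteq> V" "K = X \<or> K = Y"
        using K by (safe; blast)+
      have cV: "c \<in> V"
        using c(1,3) by blast
      have pc: "p c = c"
        using pD(4)[OF cV] c(2) by blast
      have ne: "p z \<noteq> c"
      proof
        assume "p z = c"
        then have "p c = z"
          using pD(3)[OF zV(1)] by simp
        then show False
          using pc c(1) zV(2) by simp
      qed
      have "p j \<in> K - {c, p z}" if j: "j \<in> K - {c, p z}" for j
      proof -
        have jV: "j \<in> V" and ju: "j \<notin> {x, y, v}"
          using j c by blast+
        have "p j \<noteq> z"
        proof
          assume "p j = z"
          then have "p z = j"
            using pD(3)[OF jV] by (rule subst)
          then show False
            using j by blast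
        qed
        moreover have "p j \<noteq> p z"
        proof
          assume "p j = p z"
          then have "p (p z) = j"
            using pD(3)[OF jV] by (rule subst)
          then have "z = j"
            unfolding pD(3)[OF zV(1)] .
          then show False
            using j zV(2) by blast
        qed
        moreover have "p j \<noteq> c"
        proof
          assume "p j = c"
          then have "p c = j"
            using pD(3)[OF jV] by (rule subst)
          then show False
            using j pc by blast
        qed
        moreover have "p j \<in> K"
          using exit_edge[of j K] j c(4) ju calculation(1) by blast
        ultimately show ?thesis
          by blast
      qed
      then have "even (card (K - {c, p z}))"
        using c by (intro even_card_matches[OF p V(1)]) auto
      moreover have "finite K"
        using c(3) V(1) finite_subset by blast
      then have "card (K - {c, p z}) + 2 = card K"
        using card_Diff_subset[of "{c, p z}" K] card_mono[of K "{c, p z}"] c(1) pz ne by auto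
      moreover have "odd (card K)"
        using c(4) X Y odd_card_kin[OF V(1) D(1)] odd_card_kin[OF V(1) D(2)] by auto
      ultimately show False
        by presburger
    qed
    have "p i \<in> Z" if i: "i \<in> Z" for i
    proof (rule ccontr)
      assume n: "p i \<notin> Z"
      have iV: "i \<in> V"
        using i by (simp add: Z_def)
      have piD: "p i \<in> X \<or> p i \<in> Y"
        using n pD(2)[OF iV] split(3) by blast
      then have iu: "i \<notin> {x, y, v}"
        using n i pD(4)[OF iV] by auto
      have "{p i, i} \<in> G"
        using pD(5)[OF iV iu] by (simp add: insert_commute)
      moreover have "i \<notin> X" "i \<notin> Y"
        using i split(1) by (auto simp: Z_def)
      ultimately have "i = z"
        using piD cross cross' by blast
      then show False
        using piD no[of X x] no[of Y y] by blast
    qed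
    moreover have "Z \<subseteq> V"
      by (auto simp: Z_def)
    moreover have "x \<notin> Z" "y \<notin> Z"
      using D by (auto simp: Z_def)
    ultimately have "matches Z G {v} p"
      using pD v unfolding matches_def by blast
    then show "matchable Z G {v}"
      unfolding matchable_def by blast
  qed
qed

lemma matchable_three:
  assumes "matchable X G {a}" "matchable Y G {b}" "matchable Z G {c}"
    "X \<inter> Y = {}" "X \<inter> Z = {}" "Y \<inter> Z = {}"
  shows "matchable (X \<union> Y \<union> Z) G {a, b, c}"
proof -
  have XY: "matchable (X \<union> Y) G ({a} \<union> {b})"
    using assms(1,2,4) by (rule matchable_glue)
  have "(X \<union> Y) \<inter> Z = {}"
    using assms(5,6) by blast
  with XY assms(3) have "matchable (X \<union> Y \<union> Z) G (({a} \<union> {b}) \<union> {c})"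
    by (rule matchable_glue)
  then show ?thesis
    by (simp add: insert_commute)
qed

lemma odd_part_exit:
  assumes "matches V G U p" "finite V" "S \<subseteq> V" "odd (card S)" "S \<inter> U = {}"
    and "\<And>i j. {i, j} \<in> G \<Longrightarrow> i \<in> S \<Longrightarrow> j \<in> S \<or> j = z"
  shows "p z \<in> S"
proof -
  obtain i where i: "i \<in> S" "p i \<notin> S"
    using even_card_matches[OF assms(1-3,5)] assms(4) by blast
  then have "i \<in> V" "i \<notin> U"
    using assms(3,5) by blast+
  then have "p i = z" and "p (p i) = i"
    using assms(6)[OF _ i(1)] i(2) matchesD(3,5)[OF assms(1)] by blast+
  then show ?thesis
    using i(1) by simp
qed

text \<open>The converse of \<open>tight_structure\<close>. Matching \<open>z\<close> into one of
  \<open>X\<close>, \<open>Y\<close> frees any vertex of the other. A matching missing only a vertex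
  of \<open>Z\<close> would need the single exit \<open>z\<close> for both odd parts, and one
  missing two vertices of \<open>X\<close> and one of \<open>Z\<close> needs it for \<open>Y\<close>
  while \<open>X\<close> keeps an odd remainder.\<close>

lemma glued_tight:
  fixes X Y Z :: "'a set" and G :: "'a set set"
  defines "V \<equiv> X \<union> Y \<union> Z"
  assumes fin: "finite X" "finite Y" "finite Z" and disj: "X \<inter> Y = {}" "X \<inter> Z = {}" "Y \<inter> Z = {}"
    and xyz: "x \<in> X" "y \<in> Y" "z \<in> Z"
    and am: "all_matchable X G" "all_matchable Y G" "all_matchable Z G"
    and ex: "\<exists>k\<in>X. {z, k} \<in> G" "\<exists>k\<in>Y. {z, k} \<in> G"
    and sub: "G \<subseteq> edges_on X \<union> edges_on Y \<union> edges_on Z \<union> star z X \<union> star z Y"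
  shows "tight V x y G" "deficient V G = X \<union> Y" "boundary V G = {z}"
    "{w \<in> deficient V G. separated V G x w} = Y"
proof -
  have fV: "finite V"
    using fin by (simp add: V_def)
  have XV: "X \<subseteq> V" "Y \<subseteq> V"
    by (auto simp: V_def)
  have zn: "z \<notin> X" "z \<notin> Y"
    using xyz disj by blast+
  have edge: "{i, j} \<in> G \<Longrightarrow> {i, j} \<in> edges_on X \<or> {i, j} \<in> edges_on Y \<or> {i, j} \<in> edges_on Z \<or>
      (\<exists>k\<in>X. {i, j} = {z, k}) \<or> (\<exists>k\<in>Y. {i, j} = {z, k})" for i j
    using sub by blast
  have cX: "j \<in> X \<or> j = z" if "{i, j} \<in> G" "i \<in> X" for i j
    using edge[OF that(1)] that(2) disj zn unfolding insert_in_edges_on doubleton_eq_iff by blast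
  have cY: "j \<in> Y \<or> j = z" if "{i, j} \<in> G" "i \<in> Y" for i j
    using edge[OF that(1)] that(2) disj zn unfolding insert_in_edges_on doubleton_eq_iff by blast
  have cZ: "j \<in> Z \<or> i = z" if "{i, j} \<in> G" "i \<in> Z" for i j
    using edge[OF that(1)] that(2) disj zn unfolding insert_in_edges_on doubleton_eq_iff by blast
  have am': "matchable X G {a}" "matchable Y G {b}" "matchable Z G {c}"
    if "a \<in> X" "b \<in> Y" "c \<in> Z" for a b c
    using am that by (auto simp: all_matchable_def)
  have odd: "odd (card X)" "odd (card Y)"
    using odd_card_all_matchable am fin xyz by blast+
  have three: "matchable V G {a, b, c}" if "a \<in> X" "b \<in> Y" "c \<in> Z" for a b c
    unfolding V_def using am'[OF that] disj by (rule matchable_three)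
  have inD: "v \<in> deficient V G" if v: "v \<in> X \<union> Y" for v
  proof -
    have "matchable V G {v}"
    proof (cases "v \<in> X")
      case True
      obtain k where k: "k \<in> Y" "{z, k} \<in> G"
        using ex(2) by blast
      have "matchable V G {z, k, v}"
        using three[OF True k(1) xyz(3)] by (simp add: insert_commute)
      then show ?thesis
        by (rule matchable_add_edge) (use k True zn disj in auto)
    next
      case False
      with v have vY: "v \<in> Y"
        by blast
      obtain k where k: "k \<in> X" "{z, k} \<in> G"
        using ex(1) by blast
      have "matchable V G {z, k, v}"
        using three[OF k(1) vY xyz(3)] by (simp add: insert_commute)
      then show ?thesis
        by (rule matchable_add_edge) (use k vY zn disj in auto)
    qed
    then show ?thesis
      by (rule mem_deficient)
  qed
  have notD: "\<not> matchable V G {v}" if v: "v \<in> Z" for v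
  proof
    assume "matchable V G {v}"
    then obtain p where p: "matches V G {v} p"
      by (rule matchableE)
    have X: "X \<inter> {v} = {}" and Y: "Y \<inter> {v} = {}"
      using v disj by blast+
    have "p z \<in> X"
      by (rule odd_part_exit[OF p fV XV(1) odd(1) X cX])
    moreover have "p z \<in> Y"
      by (rule odd_part_exit[OF p fV XV(2) odd(2) Y cY])
    ultimately show False
      using disj(1) by blast
  qed
  show D: "deficient V G = X \<union> Y"
  proof
    show "deficient V G \<subseteq> X \<union> Y"
      using notD by (auto simp: deficient_def V_def)
  qed (use inD in blast)
  have VD: "V - deficient V G = Z"
    unfolding D using disj by (auto simp: V_def)
  show "tight V x y G"
    unfolding tight_def VD using inD three xyz by blast
  show "boundary V G = {z}"
  proof
    show "boundary V G \<subseteq> {z}"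
      unfolding boundary_def VD D using cX cY disj by blast
    show "{z} \<subseteq> boundary V G"
      unfolding boundary_def VD D using ex xyz(3) zn by (auto simp: insert_commute V_def)
  qed
  have sepY: "separated V G x w" if "w \<in> Y" for w
    unfolding separated_def VD using three[OF xyz(1) that xyz(3)] xyz that disj by blast
  have notX: "\<not> separated V G x w" if w: "w \<in> X" for w
  proof
    assume "separated V G x w"
    then obtain v where v: "v \<in> Z" "matchable V G {x, w, v}" and xw: "x \<noteq> w"
      unfolding separated_def VD by blast
    obtain p where p: "matches V G {x, w, v} p"
      using v(2) by (rule matchableE)
    note pD = matchesD[OF p]
    have "Y \<inter> {x, w, v} = {}"
      using v(1) w xyz(1) disj by blast
    then have "p z \<in> Y"
      by (rule odd_part_exit[OF p fV XV(2) odd(2) _ cY])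
    have c: "card (X - {x, w}) + 2 = card X"
      using card_Diff_subset[of "{x, w}" X] card_mono[of X "{x, w}"] fin(1) xyz(1) w xw by simp
    have "even (card (X - {x, w}))"
    proof (rule even_card_matches[OF p fV])
      show "X - {x, w} \<subseteq> V" "(X - {x, w}) \<inter> {x, w, v} = {}"
        using XV v(1) disj by blast+
      fix i assume i: "i \<in> X - {x, w}"
      then have iV: "i \<in> V" and iu: "i \<notin> {x, w, v}"
        using XV v(1) disj by blast+
      have fixed: "p x = x" "p w = w"
        using pD(4) XV xyz(1) w by blast+
      have "p i \<noteq> c" if "p c = c" "i \<noteq> c" for c
      proof
        assume "p i = c"
        then have "p c = i"
          using pD(3)[OF iV] by (rule subst)
        then show False
          using that by simp
      qed
      then have "p i \<noteq> x" "p i \<noteq> w"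
        using fixed i by blast+
      moreover have "p i \<noteq> z"
      proof
        assume "p i = z"
        then have "p z = i"
          using pD(3)[OF iV] by (rule subst)
        then show False
          using \<open>p z \<in> Y\<close> i disj(1) by blast
      qed
      ultimately show "p i \<in> X - {x, w}"
        using cX[OF pD(5)[OF iV iu]] i by blast
    qed
    then show False
      using c odd(1) by presburger
  qed
  show "{w \<in> deficient V G. separated V G x w} = Y"
    unfolding D using sepY notX by blast
qed

section \<open>Fibres as joins of smaller families\<close>

definition fc_graphs :: "'a set \<Rightarrow> 'a set set set" where
  "fc_graphs V = {G. G \<subseteq> edges_on V \<and> all_matchable V G}"

definition nonempty_subsets :: "'a set \<Rightarrow> 'a set set" where
  "nonempty_subsets B = {s. s \<subseteq> B \<and> s \<noteq> {}}"

definition tight_graphs :: "'a set \<Rightarrow> 'a \<Rightarrow> 'a \<Rightarrow> 'a set set set" where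
  "tight_graphs V x y = {G. G \<subseteq> edges_on V - {{x, y}} \<and> tight V x y G}"

text \<open>Once D, A = {z} and \<open>Y\<close> are fixed, the graph is five independent choices:
  three factor critical graphs and two nonempty stars. The factor critical parts are where the
  induction enters.\<close>

lemma tight_fiber:
  fixes X Y Z :: "'a set"
  defines "V \<equiv> X \<union> Y \<union> Z"
  assumes fin: "finite X" "finite Y" "finite Z" and disj: "X \<inter> Y = {}" "X \<inter> Z = {}" "Y \<inter> Z = {}"
    and xyz: "x \<in> X" "y \<in> Y" "z \<in> Z"
  shows "{G \<in> tight_graphs V x y. deficient V G = X \<union> Y \<and> boundary V G = {z} \<and>
      {w \<in> deficient V G. separated V G x w} = Y} =
    join (join (fc_graphs X) (fc_graphs Y))
      (join (fc_graphs Z) (join (nonempty_subsets (star z X)) (nonempty_subsets (star z Y))))"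
    (is "?F = ?J")
proof
  have fV: "finite V" and ne: "x \<noteq> y"
    using fin xyz disj by (auto simp: V_def)
  show "?F \<subseteq> ?J"
  proof
    fix G assume G: "G \<in> ?F"
    then have e: "G \<subseteq> edges_on V" and t: "tight V x y G" and b: "boundary V G = {z}"
      and D: "deficient V G = X \<union> Y" and S: "{w \<in> X \<union> Y. separated V G x w} = Y"
      by (auto simp: tight_graphs_def)
    have eqs: "X \<union> Y - Y = X" "V - (X \<union> Y) = Z"
      using disj by (auto simp: V_def)
    note st = tight_structure[OF fV ne e t b, unfolded D S eqs]
    have in_crit: "G \<inter> edges_on W \<in> fc_graphs W" if "all_matchable W G" for W
      using that matchable_restrict[of W G] by (simp add: fc_graphs_def all_matchable_def)
    have eq: "G = ((G \<inter> edges_on X) \<union> (G \<inter> edges_on Y)) \<union>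
        ((G \<inter> edges_on Z) \<union> ((G \<inter> star z X) \<union> (G \<inter> star z Y)))"
      using st(9) by blast
    have *: "G \<inter> star z X \<in> nonempty_subsets (star z X)" "G \<inter> star z Y \<in> nonempty_subsets (star z Y)"
      using st(7,8) unfolding nonempty_subsets_def by blast+
    show "G \<in> ?J"
      by (subst eq, intro joinI in_crit st(4-6) *)
  qed
  show "?J \<subseteq> ?F"
  proof
    fix G assume "G \<in> ?J"
    then obtain HX HY HZ SX SY where G: "G = (HX \<union> HY) \<union> (HZ \<union> (SX \<union> SY))"
      and H: "HX \<in> fc_graphs X" "HY \<in> fc_graphs Y" "HZ \<in> fc_graphs Z"
      and SX: "SX \<subseteq> star z X" "SX \<noteq> {}" and SY: "SY \<subseteq> star z Y" "SY \<noteq> {}"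
      unfolding nonempty_subsets_def by (elim joinE CollectE conjE) (rule that; simp)
    have am: "all_matchable W G" if "H \<in> fc_graphs W" "H \<subseteq> G" for W H
      using that matchable_mono[of W H _ G] by (auto simp: fc_graphs_def all_matchable_def)
    have sub: "G \<subseteq> edges_on X \<union> edges_on Y \<union> edges_on Z \<union> star z X \<union> star z Y"
      using G H SX(1) SY(1) unfolding fc_graphs_def by blast
    have "\<exists>k\<in>X. {z, k} \<in> G" "\<exists>k\<in>Y. {z, k} \<in> G"
      using G SX SY by blast+
    note gt = glued_tight[OF fin disj xyz am[OF H(1)] am[OF H(2)] am[OF H(3)] this sub, folded V_def]
    have "edges_on X \<union> edges_on Y \<union> edges_on Z \<union> star z X \<union> star z Y \<subseteq> edges_on V - {{x, y}}"
    proof (intro Un_least subsetI)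
      have zn: "z \<notin> X" "z \<notin> Y" "x \<notin> Y" "y \<notin> X" "x \<notin> Z" "y \<notin> Z"
        using xyz disj by blast+
      show "e \<in> edges_on V - {{x, y}}" if "e \<in> edges_on X" for e
        using that zn by (auto simp: edges_on_def V_def)
      show "e \<in> edges_on V - {{x, y}}" if "e \<in> edges_on Y" for e
        using that zn by (auto simp: edges_on_def V_def)
      show "e \<in> edges_on V - {{x, y}}" if "e \<in> edges_on Z" for e
        using that zn by (auto simp: edges_on_def V_def)
      show "e \<in> edges_on V - {{x, y}}" if "e \<in> star z X" for e
        using that zn xyz by (auto simp: insert_in_edges_on V_def doubleton_eq_iff)
      show "e \<in> edges_on V - {{x, y}}" if "e \<in> star z Y" for e
        using that zn xyz by (auto simp: insert_in_edges_on V_def doubleton_eq_iff)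
    qed
    then have "G \<in> tight_graphs V x y"
      using sub gt(1) G unfolding tight_graphs_def by blast
    then show "G \<in> ?F"
      using gt(2-4) G by blast
  qed
qed

section \<open>The number of critical graphs\<close>

text \<open>The double factorial (2k-1)!!, with index shifted so that the induction runs over
  \<open>k\<close>.\<close>

definition odd_product :: "nat \<Rightarrow> nat" where
  "odd_product k = (\<Prod>i<k. 2 * i + 1)"

lemma odd_product_Suc: "odd_product (Suc k) = odd_product k * (2 * k + 1)"
  by (simp add: odd_product_def)

lemma odd_product_0: "odd_product 0 = 1"
  by (simp add: odd_product_def)

lemma fact_double: "fact (2 * k) = odd_product k * 2 ^ k * fact k"
  by (induction k) (simp_all add: odd_product_0 odd_product_Suc algebra_simps)

text \<open>The number of unmatched graphs on \<open>N\<close> vertices; the value 0 for even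
  \<open>N\<close> reflects that there are no factor critical graphs of positive even order.\<close>

definition cell_count :: "nat \<Rightarrow> nat" where
  "cell_count N = (if odd N then (odd_product (N div 2))\<^sup>2 else 0)"

text \<open>Equal to the central binomial coefficient (2k choose k) divided by 4^k.\<close>

definition central :: "nat \<Rightarrow> real" where
  "central k = real ((odd_product k)\<^sup>2) / fact (2 * k)"

lemma central_eq: "central k = real (odd_product k) / (2 ^ k * fact k)"
proof -
  have "odd_product k \<noteq> 0"
    by (simp add: odd_product_def)
  moreover have "(fact (2 * k) :: real) = real (odd_product k) * (2 ^ k * fact k)"
    using arg_cong[OF fact_double[of k], of real] by simp
  ultimately show ?thesis
    by (simp add: central_def power2_eq_square)
qed

lemma central_pochhammer: "central k = pochhammer (1 / 2) k / fact k"
proof -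
  have "pochhammer (1 / 2 :: real) k = real (odd_product k) / 2 ^ k"
    by (induction k) (simp_all add: odd_product_0 odd_product_Suc pochhammer_Suc field_simps)
  then show ?thesis
    by (simp add: central_eq)
qed

text \<open>The square of (1-t)^(-1/2) is 1/(1-t). In coefficients this is the Vandermonde identity
  for rising factorials at 1/2 + 1/2 = 1.\<close>

lemma sum_central_convolution: "(\<Sum>a\<le>j. central a * central (j - a)) = 1"
proof -
  have "fact j = pochhammer (1 / 2 + 1 / 2 :: real) j"
    by (simp add: pochhammer_fact)
  also have "\<dots> = (\<Sum>a\<le>j. real (j choose a) * pochhammer (1 / 2) a * pochhammer (1 / 2) (j - a))"
    by (rule pochhammer_binomial_sum)
  also have "\<dots> = (\<Sum>a\<le>j. fact j * (central a * central (j - a)))"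
    by (intro sum.cong) (simp_all add: central_pochhammer binomial_fact field_simps)
  also have "\<dots> = fact j * (\<Sum>a\<le>j. central a * central (j - a))"
    by (simp add: sum_distrib_left)
  finally show ?thesis
    by simp
qed

text \<open>Partial sums correspond to multiplication by 1/(1-t), so the right-hand side is the
  coefficient of t^j in (1-t)^(-3/2).\<close>

lemma sum_central: "(\<Sum>a\<le>j. central a) = real (odd_product (Suc j)) / (2 ^ j * fact j)"
proof (induction j)
  case 0
  then show ?case
    by (simp add: odd_product_def central_def)
next
  case (Suc j)
  have "(\<Sum>a\<le>Suc j. central a) = real (odd_product (Suc j)) / (2 ^ j * fact j) + central (Suc j)"
    using Suc by simp
  also have "\<dots> = real (odd_product (Suc (Suc j))) / (2 ^ Suc j * fact (Suc j))"
  proof -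
    define c d N where "c = real (odd_product (Suc j))" and "d = 2 ^ j * (fact j :: real)"
      and "N = 2 * real (Suc j)"
    have N: "N \<noteq> 0" and D: "2 ^ Suc j * (fact (Suc j) :: real) = d * N"
      by (simp_all add: N_def d_def)
    have "c / d + c / (d * N) = (c * N + c) / (d * N)"
      using N by (simp add: add_divide_distrib)
    moreover have "real (odd_product (Suc (Suc j))) = c * N + c"
      unfolding odd_product_Suc[of "Suc j"] c_def N_def by (simp add: algebra_simps)
    ultimately show ?thesis
      unfolding central_eq D d_def[symmetric] c_def[symmetric] by simp
  qed
  finally show ?case .
qed

lemma sum_even_support:
  fixes f :: "nat \<Rightarrow> nat"
  assumes "\<And>i. odd i \<Longrightarrow> f i = 0"
  shows "(\<Sum>i\<le>2 * j. f i) = (\<Sum>a\<le>j. f (2 * a))"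
  by (induction j) (simp_all add: assms)

lemma choose_even_real:
  assumes "a \<le> j"
  shows "real (2 * j choose 2 * a) = fact (2 * j) / (fact (2 * a) * fact (2 * (j - a)))"
  using assms binomial_fact[of "2 * a" "2 * j"] by (simp add: diff_mult_distrib2)

lemma cell_count_odd: "cell_count (Suc (2 * a)) = (odd_product a)\<^sup>2"
  by (simp add: cell_count_def)

text \<open>Distributes the \<open>s\<close> vertices of D other than \<open>x\<close> and
  \<open>y\<close> between the parts \<open>X\<close> and \<open>Y\<close>. The binomial coefficient
  turns the counts into a convolution of \<open>central\<close>.\<close>

lemma cell_count_convolution:
  "(\<Sum>i\<le>s. (s choose i) * (cell_count (Suc i) * cell_count (Suc (s - i)))) =
    (if even s then fact s else 0)"
proof (cases "even s")
  case True
  then obtain j where s: "s = 2 * j"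
    by blast
  have "(\<Sum>i\<le>s. (s choose i) * (cell_count (Suc i) * cell_count (Suc (s - i)))) =
      (\<Sum>a\<le>j. (2 * j choose (2 * a)) * (cell_count (Suc (2 * a)) * cell_count (Suc (2 * j - 2 * a))))"
    unfolding s by (rule sum_even_support) (simp add: cell_count_def)
  also have "real \<dots> = (\<Sum>a\<le>j. fact (2 * j) * (central a * central (j - a)))"
    unfolding of_nat_sum
  proof (rule sum.cong)
    fix a assume "a \<in> {..j}"
    then have a: "a \<le> j" and e: "2 * j - 2 * a = 2 * (j - a)"
      by auto
    show "real ((2 * j choose (2 * a)) * (cell_count (Suc (2 * a)) * cell_count (Suc (2 * j - 2 * a)))) =
        fact (2 * j) * (central a * central (j - a))"
      unfolding e of_nat_mult choose_even_real[OF a] cell_count_odd by (simp add: central_def)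
  qed simp
  also have "\<dots> = fact (2 * j)"
    unfolding sum_distrib_left[symmetric] sum_central_convolution by simp
  finally have eq: "real (\<Sum>i\<le>s. (s choose i) * (cell_count (Suc i) * cell_count (Suc (s - i)))) = real (fact s)"
    by (simp add: s)
  show ?thesis
    using True eq[unfolded of_nat_eq_iff] by simp
next
  case False
  then have "cell_count (Suc i) * cell_count (Suc (s - i)) = 0" if "i \<le> s" for i
    using that by (auto simp: cell_count_def)
  then show ?thesis
    using False by simp
qed

text \<open>Adds the third part: \<open>i\<close> of the 2j vertices other than \<open>x\<close>,
  \<open>y\<close>, \<open>z\<close> go to D, the others to \<open>Z\<close>. The first factor is
  the value of the preceding convolution.\<close>

lemma cell_count_triple:
  "(\<Sum>i\<le>2 * j. (2 * j choose i) * ((if even i then fact i else 0) * cell_count (Suc (2 * j - i)))) =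
    odd_product j * odd_product (Suc j)"
proof -
  have "(\<Sum>i\<le>2 * j. (2 * j choose i) * ((if even i then fact i else 0) * cell_count (Suc (2 * j - i)))) =
      (\<Sum>a\<le>j. (2 * j choose (2 * a)) * ((if even (2 * a) then fact (2 * a) else 0) * cell_count (Suc (2 * j - 2 * a))))"
    by (rule sum_even_support) simp
  also have "real \<dots> = (\<Sum>a\<le>j. fact (2 * j) * central (j - a))"
    unfolding of_nat_sum
  proof (rule sum.cong)
    fix a assume "a \<in> {..j}"
    then have a: "a \<le> j" and e: "2 * j - 2 * a = 2 * (j - a)"
      by auto
    show "real ((2 * j choose (2 * a)) * ((if even (2 * a) then fact (2 * a) else 0) * cell_count (Suc (2 * j - 2 * a)))) =
        fact (2 * j) * central (j - a)"
      unfolding e of_nat_mult choose_even_real[OF a] cell_count_odd by (simp add: central_def)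
  qed simp
  also have "\<dots> = fact (2 * j) * (\<Sum>a\<le>j. central (j - a))"
    by (rule sum_distrib_left[symmetric])
  also have "(\<Sum>a\<le>j. central (j - a)) = (\<Sum>a\<le>j. central a)"
    by (rule sum.reindex_bij_witness[of _ "\<lambda>a. j - a" "\<lambda>a. j - a"]) auto
  also have "fact (2 * j) * (\<Sum>a\<le>j. central a) = real (odd_product j * odd_product (Suc j))"
    unfolding sum_central using arg_cong[OF fact_double[of j], of real] by simp
  finally show ?thesis
    unfolding of_nat_eq_iff .
qed

section \<open>Summation over all decompositions of the vertex set\<close>

lemma sum_Pow_card:
  fixes f :: "nat \<Rightarrow> nat"
  assumes "finite S"
  shows "(\<Sum>T\<in>Pow S. f (card T)) = (\<Sum>i\<le>card S. (card S choose i) * f i)"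
proof -
  have "(\<Sum>T\<in>Pow S. f (card T)) = (\<Sum>i\<le>card S. \<Sum>T | T \<in> Pow S \<and> card T = i. f (card T))"
    using assms by (intro sum.group[symmetric]) (auto intro: card_mono)
  also have "\<dots> = (\<Sum>i\<le>card S. (card S choose i) * f i)"
  proof (rule sum.cong)
    fix i
    have "(\<Sum>T | T \<in> Pow S \<and> card T = i. f (card T)) = card {T. T \<subseteq> S \<and> card T = i} * f i"
      by simp
    then show "(\<Sum>T | T \<in> Pow S \<and> card T = i. f (card T)) = (card S choose i) * f i"
      using n_subsets[OF assms, of i] by simp
  qed simp
  finally show ?thesis .
qed

text \<open>The number of unmatched graphs in the fibre with given D, A = {z} and \<open>Y\<close>.
  Impossible data count 0, so the sums may run over all subsets of \<open>V\<close>.\<close>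

definition split_count :: "'a set \<Rightarrow> 'a \<Rightarrow> 'a \<Rightarrow> 'a set \<Rightarrow> 'a \<Rightarrow> 'a set \<Rightarrow> nat" where
  "split_count V x y D z Y = (if x \<in> D - Y \<and> y \<in> Y \<and> Y \<subseteq> D \<and> z \<in> V - D
    then cell_count (card (D - Y)) * cell_count (card Y) * cell_count (card (V - D)) else 0)"

lemma sum_split_count:
  assumes V: "finite V" "x \<in> V" "y \<in> V" "x \<noteq> y" "odd (card V)" "1 < card V"
  shows "(\<Sum>D\<in>Pow V. \<Sum>z\<in>V. \<Sum>Y\<in>Pow V. split_count V x y D z Y) = cell_count (card V)"
proof -
  have c2: "card {x, y} = 2" "{x, y} \<subseteq> V"
    using V(2-4) by auto
  have "card V \<noteq> 2"
    using V(5) by auto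
  then have "3 \<le> card V"
    using V(6) by linarith
  then have "card V = 2 * ((card V - 3) div 2) + 3"
    using V(5) by presburger
  \<comment> \<open>Apart from \<open>x\<close>, \<open>y\<close> and \<open>z\<close> there are 2j
    vertices to distribute.\<close>
  then obtain j where j: "card V = 2 * j + 3"
    by (rule that)
  have for_z: "(\<Sum>D\<in>Pow V. \<Sum>Y\<in>Pow V. split_count V x y D z Y) = odd_product j * odd_product (Suc j)"
    if z: "z \<in> V - {x, y}" for z
  proof -
    let ?W = "V - {x, y, z}"
    have "card {x, y, z} = 3" "{x, y, z} \<subseteq> V"
      using V(2-4) z by auto
    then have cW: "card ?W = 2 * j"
      using V(1) j by (simp add: card_Diff_subset)
    have fW: "finite ?W"
      using V(1) by simp
    have "(\<Sum>D\<in>Pow V. \<Sum>Y\<in>Pow V. split_count V x y D z Y) =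
        (\<Sum>S\<in>Pow ?W. \<Sum>Y\<in>Pow V. split_count V x y ({x, y} \<union> S) z Y)"
    \<comment> \<open>A nonzero term requires that D contain \<open>x\<close> and \<open>y\<close>
      but not \<open>z\<close>, so D is \<open>{x, y} \<union> S\<close> with \<open>S\<close> among
      the 2j free vertices; similarly \<open>Y\<close> is \<open>insert y T\<close> below.\<close>
    proof (rule sum.reindex_bij_witness_not_neutral[symmetric, where S' = "{}"
          and T' = "{D \<in> Pow V. \<not> ({x, y} \<subseteq> D \<and> z \<notin> D)}"
          and i = "\<lambda>D. D - {x, y}" and j = "\<lambda>S. {x, y} \<union> S"])
      show "(\<Sum>Y\<in>Pow V. split_count V x y D z Y) = 0" if "D \<in> {D \<in> Pow V. \<not> ({x, y} \<subseteq> D \<and> z \<notin> D)}" for D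
        using that by (intro sum.neutral) (auto simp: split_count_def)
    qed (use z V c2 in auto)
    also have "\<dots> = (\<Sum>S\<in>Pow ?W. (if even (card S) then fact (card S) else 0) * cell_count (Suc (card ?W - card S)))"
    proof (rule sum.cong)
      fix S assume "S \<in> Pow ?W"
      then have S: "S \<subseteq> ?W" and fS: "finite S"
        using fW finite_subset by blast+
      have "(\<Sum>Y\<in>Pow V. split_count V x y ({x, y} \<union> S) z Y) =
          (\<Sum>T\<in>Pow S. split_count V x y ({x, y} \<union> S) z (insert y T))"
      proof (rule sum.reindex_bij_witness_not_neutral[symmetric, where S' = "{}"
            and T' = "{Y \<in> Pow V. \<not> (y \<in> Y \<and> x \<notin> Y \<and> Y \<subseteq> {x, y} \<union> S)}"
            and i = "\<lambda>Y. Y - {y}" and j = "insert y"])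
        show "split_count V x y ({x, y} \<union> S) z Y = 0"
          if "Y \<in> {Y \<in> Pow V. \<not> (y \<in> Y \<and> x \<notin> Y \<and> Y \<subseteq> {x, y} \<union> S)}" for Y
          using that by (auto simp: split_count_def)
      qed (use S z V c2 in auto)
      also have "\<dots> = (\<Sum>T\<in>Pow S. cell_count (Suc (card T)) * cell_count (Suc (card S - card T))
          * cell_count (Suc (card ?W - card S)))"
      proof (rule sum.cong)
        fix T assume "T \<in> Pow S"
        then have T: "T \<subseteq> S" and fT: "finite T"
          using fS finite_subset by blast+
        have "{x, y} \<union> S - insert y T = insert x (S - T)"
          using S T V(4) by auto
        moreover have "V - ({x, y} \<union> S) = insert z (?W - S)"
          using S z by auto
        moreover have "card (insert x (S - T)) = Suc (card S - card T)"
          using S fS T fT by (subst card_insert_disjoint) (auto simp: card_Diff_subset)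
        moreover have "card (insert z (?W - S)) = Suc (card ?W - card S)"
          using S fS fW by (subst card_insert_disjoint) (auto simp: card_Diff_subset)
        moreover have "card (insert y T) = Suc (card T)"
          using S T fT by (subst card_insert_disjoint) auto
        moreover have "x \<in> insert x (S - T)" "insert y T \<subseteq> {x, y} \<union> S" "z \<in> insert z (?W - S)"
          using T by auto
        ultimately show "split_count V x y ({x, y} \<union> S) z (insert y T) =
            cell_count (Suc (card T)) * cell_count (Suc (card S - card T))
            * cell_count (Suc (card ?W - card S))"
          unfolding split_count_def by (simp add: mult.commute)
      qed simp
      also have "\<dots> = (\<Sum>T\<in>Pow S. cell_count (Suc (card T)) * cell_count (Suc (card S - card T)))
          * cell_count (Suc (card ?W - card S))"
        by (rule sum_distrib_right[symmetric])
      finally show "(\<Sum>Y\<in>Pow V. split_count V x y ({x, y} \<union> S) z Y) =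
          (if even (card S) then fact (card S) else 0) * cell_count (Suc (card ?W - card S))"
        unfolding sum_Pow_card[OF fS, of "\<lambda>i. cell_count (Suc i) * cell_count (Suc (card S - i))"]
          cell_count_convolution .
    qed simp
    also have "\<dots> = odd_product j * odd_product (Suc j)"
      using sum_Pow_card[OF fW, of "\<lambda>i. (if even i then fact i else 0) * cell_count (Suc (2 * j - i))"]
        cell_count_triple[of j] unfolding cW by (rule trans)
    finally show ?thesis .
  qed
  have "(\<Sum>D\<in>Pow V. \<Sum>z\<in>V. \<Sum>Y\<in>Pow V. split_count V x y D z Y) =
      (\<Sum>z\<in>V. \<Sum>D\<in>Pow V. \<Sum>Y\<in>Pow V. split_count V x y D z Y)"
    by (rule sum.swap)
  also have "\<dots> = (\<Sum>z\<in>V - {x, y}. \<Sum>D\<in>Pow V. \<Sum>Y\<in>Pow V. split_count V x y D z Y)"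
  proof (rule sum.mono_neutral_right)
    show "\<forall>z\<in>V - (V - {x, y}). (\<Sum>D\<in>Pow V. \<Sum>Y\<in>Pow V. split_count V x y D z Y) = 0"
      by (intro ballI sum.neutral) (auto simp: split_count_def)
  qed (use V(1) in auto)
  also have "\<dots> = card (V - {x, y}) * (odd_product j * odd_product (Suc j))"
    using for_z by simp
  also have "card (V - {x, y}) = 2 * j + 1"
    using V(1) c2 j by (subst card_Diff_subset) auto
  \<comment> \<open>The number of choices of \<open>z\<close> is precisely the factor missing from a
    perfect square.\<close>
  also have "(2 * j + 1) * (odd_product j * odd_product (Suc j)) = (odd_product (Suc j))\<^sup>2"
    by (simp only: odd_product_Suc power2_eq_square mult_ac)
  also have "\<dots> = cell_count (card V)"
    using cell_count_odd[of "Suc j"] by (simp add: j numeral_3_eq_3)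
  finally show ?thesis .
qed

section \<open>The acyclic matching, by induction on the vertex set\<close>

lemma finite_fc_graphs: "finite V \<Longrightarrow> finite (fc_graphs V)"
  unfolding fc_graphs_def
  by (rule finite_subset[of _ "Pow (edges_on V)"]) (auto simp: finite_edges_on)

lemma fc_graphs_even:
  assumes "finite V" "V \<noteq> {}" "even (card V)"
  shows "fc_graphs V = {}"
  using odd_card_all_matchable[OF _ assms(1,2)] assms(3) unfolding fc_graphs_def by blast

text \<open>For parts of orders 2a+1, 2b+1, 2c+1 the critical cells have 3a + 3b + 3c + 2 edges,
  while the union has 2(a+b+c+1) + 1 vertices; the difference of 1 is the edge \<open>xy\<close>,
  which is added later. If a part has even order, the family is empty and the count is zero.\<close>

lemma morse_family_tight_fiber:
  fixes X Y Z :: "'a set"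
  assumes fin: "finite X" "finite Y" "finite Z" and disj: "X \<inter> Y = {}" "X \<inter> Z = {}" "Y \<inter> Z = {}"
    and xyz: "x \<in> X" "y \<in> Y" "z \<in> Z"
    and IH: "\<And>W. W \<in> {X, Y, Z} \<Longrightarrow>
      morse_family (fc_graphs W) (3 * (card W div 2)) (cell_count (card W))"
  shows "morse_family (join (join (fc_graphs X) (fc_graphs Y))
      (join (fc_graphs Z) (join (nonempty_subsets (star z X)) (nonempty_subsets (star z Y)))))
    (3 * (card (X \<union> Y \<union> Z) div 2) - 1)
    (cell_count (card X) * cell_count (card Y) * cell_count (card Z))"
    (is "morse_family ?J _ _")
proof (cases "odd (card X) \<and> odd (card Y) \<and> odd (card Z)")
  case False
  then have "fc_graphs X = {} \<or> fc_graphs Y = {} \<or> fc_graphs Z = {}"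
    using fc_graphs_even[OF fin(1)] fc_graphs_even[OF fin(2)]
      fc_graphs_even[OF fin(3)] xyz by blast
  then have "?J = {}"
    using join_empty by metis
  moreover have "cell_count (card X) * cell_count (card Y) * cell_count (card Z) = 0"
    using False by (auto simp: cell_count_def)
  ultimately show ?thesis
    by (simp only: morse_family.empty)
next
  case True
  then obtain a b c where abc: "card X = 2 * a + 1" "card Y = 2 * b + 1" "card Z = 2 * c + 1"
    by (elim conjE oddE)
  have "card (X \<union> Y \<union> Z) = card (X \<union> Y) + card Z" "card (X \<union> Y) = card X + card Y"
    using fin disj by (auto intro!: card_Un_disjoint)
  then have "card (X \<union> Y \<union> Z) = 2 * (a + b + c + 1) + 1"
    using abc by simp
  then have dim: "3 * (card (X \<union> Y \<union> Z) div 2) - 1 =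
      (3 * (card X div 2) + 3 * (card Y div 2)) + (3 * (card Z div 2) + (1 + 1))"
    using abc by simp
  have zn: "z \<notin> X" "z \<notin> Y"
    using xyz disj by blast+
  have star: "morse_family (nonempty_subsets (star z W)) 1 1" if "finite W" "w \<in> W" for W w
    unfolding nonempty_subsets_def using that by (intro morse_family_nonempty_subsets[of _ "{z, w}"]) auto
  have sub_star: "s \<subseteq> star z W" if "s \<in> nonempty_subsets (star z W)" for s W
    using that by (simp add: nonempty_subsets_def)
  have sub_edges: "s \<subseteq> edges_on W" if "s \<in> fc_graphs W" for s W
    using that by (simp add: fc_graphs_def)
  have sub_join: "s \<subseteq> B \<union> B'" if "s \<in> join S T" "\<And>s. s \<in> S \<Longrightarrow> s \<subseteq> B" "\<And>t. t \<in> T \<Longrightarrow> t \<subseteq> B'"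
    for s B B' and S T :: "'a set set set"
    using that(1) that(2,3) by (elim joinE) blast
  have disj_edges: "edges_on W \<inter> edges_on W' = {}" if "W \<inter> W' = {}" for W W' :: "'a set"
    using that by (auto simp: edges_on_def card_2_iff)
  have disj_star: "edges_on W \<inter> star z W' = {}" if "W \<inter> W' = {} \<or> z \<notin> W" for W W' :: "'a set"
    using that by (auto simp: insert_in_edges_on)
  have J1: "morse_family (join (fc_graphs X) (fc_graphs Y))
      (3 * (card X div 2) + 3 * (card Y div 2)) (cell_count (card X) * cell_count (card Y))"
    by (rule morse_family_join[OF IH IH sub_edges sub_edges disj_edges]) (use disj in auto)
  have J2: "morse_family (join (nonempty_subsets (star z X)) (nonempty_subsets (star z Y))) (1 + 1) (1 * 1)"
    by (rule morse_family_join[OF star[OF fin(1) xyz(1)] star[OF fin(2) xyz(2)] sub_star sub_star])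
       (use disj zn in \<open>auto simp: doubleton_eq_iff\<close>)
  have J3: "morse_family (join (fc_graphs Z) (join (nonempty_subsets (star z X)) (nonempty_subsets (star z Y))))
      (3 * (card Z div 2) + (1 + 1)) (cell_count (card Z) * (1 * 1))"
  proof (rule morse_family_join[OF IH J2 sub_edges])
    show "t \<subseteq> star z X \<union> star z Y" if "t \<in> join (nonempty_subsets (star z X)) (nonempty_subsets (star z Y))" for t
      by (rule sub_join[OF that sub_star sub_star])
    show "edges_on Z \<inter> (star z X \<union> star z Y) = {}"
      using disj_star[of Z X] disj_star[of Z Y] disj by (simp add: Int_Un_distrib Int_commute)
  qed auto
  have "morse_family ?J ((3 * (card X div 2) + 3 * (card Y div 2)) + (3 * (card Z div 2) + (1 + 1)))
      (cell_count (card X) * cell_count (card Y) * (cell_count (card Z) * (1 * 1)))"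
  proof (rule morse_family_join[OF J1 J3])
    show "s \<subseteq> edges_on X \<union> edges_on Y" if "s \<in> join (fc_graphs X) (fc_graphs Y)" for s
      by (rule sub_join[OF that sub_edges sub_edges])
    show "t \<subseteq> edges_on Z \<union> (star z X \<union> star z Y)"
      if "t \<in> join (fc_graphs Z) (join (nonempty_subsets (star z X)) (nonempty_subsets (star z Y)))" for t
      by (rule sub_join[OF that sub_edges sub_join[OF _ sub_star sub_star]])
    show "(edges_on X \<union> edges_on Y) \<inter> (edges_on Z \<union> (star z X \<union> star z Y)) = {}"
      using disj_star[of X X] disj_star[of X Y] disj_star[of Y X] disj_star[of Y Y]
        disj_edges[OF disj(2)] disj_edges[OF disj(3)] zn
      by (simp add: Int_Un_distrib Int_Un_distrib2)
  qed
  then show ?thesis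
    unfolding dim by simp
qed

lemma finite_tight_graphs: "finite V \<Longrightarrow> finite (tight_graphs V x y)"
  unfolding tight_graphs_def
  by (rule finite_subset[of _ "Pow (edges_on V)"]) (auto simp: finite_edges_on)

lemma tight_graphs_finite: "finite V \<Longrightarrow> G \<in> tight_graphs V x y \<Longrightarrow> finite G"
  unfolding tight_graphs_def using finite_edges_on[of V] by (auto intro: finite_subset)

text \<open>D is kept fixed because the definition also involves its complement; the same holds for
  \<open>separated_mono\<close>. This is why the fibres are nested rather than taken in one
  step.\<close>

lemma boundary_mono:
  assumes "G \<subseteq> H" "deficient V G = deficient V H"
  shows "boundary V G \<subseteq> boundary V H"
  using assms unfolding boundary_def by blast

lemma separated_mono:
  assumes "G \<subseteq> H" "deficient V G = deficient V H" "separated V G u w"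
  shows "separated V H u w"
proof -
  obtain v where v: "v \<in> V - deficient V G" "matchable V G {u, w, v}" and "u \<noteq> w"
    using assms(3) unfolding separated_def by blast
  have "matchable V H {u, w, v}"
    by (rule matchable_mono[OF v(2) assms(1)])
  then show ?thesis
    using v(1) \<open>u \<noteq> w\<close> assms(2) unfolding separated_def by auto
qed

lemma morse_family_tight_boundary_singleton:
  assumes V: "finite V" "x \<noteq> y" and D: "D \<subseteq> V"
    and IH: "\<And>W. W \<subset> V \<Longrightarrow> W \<noteq> {} \<Longrightarrow>
      morse_family (fc_graphs W) (3 * (card W div 2)) (cell_count (card W))"
  shows "morse_family {G \<in> tight_graphs V x y. deficient V G = D \<and> boundary V G = {z}}
    (3 * (card V div 2) - 1) (\<Sum>Y\<in>Pow V. split_count V x y D z Y)"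
    (is "morse_family ?F _ _")
proof (rule morse_family_fibers[where \<phi> = "\<lambda>G. {w \<in> deficient V G. separated V G x w}"])
  show "finite (Pow V)" "(\<lambda>G. {w \<in> deficient V G. separated V G x w}) ` ?F \<subseteq> Pow V"
    using V(1) deficient_subset[of V] by auto
  show "{w \<in> deficient V G. separated V G x w} \<le> {w \<in> deficient V H. separated V H x w}"
    if "G \<in> ?F" "H \<in> ?F" "G \<subseteq> H" for G H
    using separated_mono[OF that(3)] that(1,2) by auto
  fix Y assume "Y \<in> Pow V"
  let ?FY = "{G \<in> ?F. {w \<in> deficient V G. separated V G x w} = Y}"
  show "morse_family ?FY (3 * (card V div 2) - 1) (split_count V x y D z Y)"
  proof (cases "x \<in> D - Y \<and> y \<in> Y \<and> Y \<subseteq> D \<and> z \<in> V - D")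
    case True
    let ?X = "D - Y" and ?Z = "V - D"
    have eqs: "?X \<union> Y = D" "D \<union> ?Z = V"
      using True D by auto
    have fin: "finite ?X" "finite Y" "finite ?Z"
      using V(1) D \<open>Y \<in> Pow V\<close> by (auto intro: finite_subset)
    have disj: "?X \<inter> Y = {}" "?X \<inter> ?Z = {}" "Y \<inter> ?Z = {}"
      using True by auto
    have xyz: "x \<in> ?X" "y \<in> Y" "z \<in> ?Z"
      using True by auto
    have "z \<in> V" "z \<notin> ?X" "z \<notin> Y" "x \<in> V" "x \<notin> ?Z" "?X \<subseteq> V" "Y \<subseteq> V"
      using True D by auto
    then have "?X \<subset> V" "Y \<subset> V" "?Z \<subset> V"
      by blast+
    then have small: "W \<subset> V \<and> W \<noteq> {}" if "W \<in> {?X, Y, ?Z}" for W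
      using that xyz by (elim insertE) auto
    have conj: "?FY = {G \<in> tight_graphs V x y. deficient V G = D \<and> boundary V G = {z} \<and>
        {w \<in> deficient V G. separated V G x w} = Y}"
      by (intro Collect_cong) auto
    have FY: "?FY = join (join (fc_graphs ?X) (fc_graphs Y))
      (join (fc_graphs ?Z) (join (nonempty_subsets (star z ?X)) (nonempty_subsets (star z Y))))"
      unfolding conj by (rule tight_fiber[OF fin disj xyz, unfolded eqs])
    have sc: "split_count V x y D z Y = cell_count (card ?X) * cell_count (card Y) * cell_count (card ?Z)"
      unfolding split_count_def using True by (rule if_P)
    show ?thesis
      unfolding FY sc
    proof (rule morse_family_tight_fiber[OF fin disj xyz, unfolded eqs])
      show "morse_family (fc_graphs W) (3 * (card W div 2)) (cell_count (card W))"
        if "W \<in> {?X, Y, ?Z}" for W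
        using small[OF that] by (intro IH) simp_all
    qed
  next
    case False
    have "?FY = {}"
    proof (rule ccontr)
      assume "?FY \<noteq> {}"
      then obtain G where G: "G \<in> tight_graphs V x y" "deficient V G = D" "boundary V G = {z}"
        and Y: "{w \<in> D. separated V G x w} = Y"
        by blast
      have "G \<subseteq> edges_on V" "tight V x y G"
        using G(1) by (auto simp: tight_graphs_def)
      note st = tight_structure(1-3)[OF V this G(3), unfolded G(2) Y]
      then show False
        using False Y by blast
    qed
    moreover have "split_count V x y D z Y = 0"
      unfolding split_count_def using False by (rule if_not_P)
    ultimately show ?thesis
      by (simp only: morse_family.empty)
  qed
qed

text \<open>Fibres over D, then over A, and for singletons A over \<open>Y\<close>. If A has two
  elements, toggling the edge between them preserves D, A and tightness, so the whole fibre is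
  matched.\<close>

lemma morse_family_tight_graphs:
  assumes V: "finite V" "x \<in> V" "y \<in> V" "x \<noteq> y" "odd (card V)" "1 < card V"
    and IH: "\<And>W. W \<subset> V \<Longrightarrow> W \<noteq> {} \<Longrightarrow>
      morse_family (fc_graphs W) (3 * (card W div 2)) (cell_count (card W))"
  shows "morse_family (tight_graphs V x y) (3 * (card V div 2) - 1) (cell_count (card V))"
proof -
  let ?T = "tight_graphs V x y" and ?c = "3 * (card V div 2) - 1"
  let ?s = "\<lambda>D z. \<Sum>Y\<in>Pow V. split_count V x y D z Y"
  let ?k = "\<lambda>D A. if \<exists>z\<in>V. A = {z} then ?s D (the_elem A) else 0"
  have "morse_family ?T ?c (\<Sum>D\<in>Pow V. \<Sum>A\<in>Pow V. ?k D A)"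
  proof (rule morse_family_fibers[where \<phi> = "deficient V"])
    show "finite (Pow V)" "deficient V ` ?T \<subseteq> Pow V"
      using V(1) deficient_subset[of V] by auto
    show "deficient V G \<le> deficient V H" if "G \<subseteq> H" for G H
      by (rule deficient_mono[OF that])
    fix D assume D: "D \<in> Pow V"
    show "morse_family {G \<in> ?T. deficient V G = D} ?c (\<Sum>A\<in>Pow V. ?k D A)"
    proof (rule morse_family_fibers[where \<phi> = "boundary V"])
      show "finite (Pow V)" "boundary V ` {G \<in> ?T. deficient V G = D} \<subseteq> Pow V"
        using V(1) by (auto simp: boundary_def)
      show "boundary V G \<le> boundary V H"
        if "G \<in> {G \<in> ?T. deficient V G = D}" "H \<in> {G \<in> ?T. deficient V G = D}" "G \<subseteq> H" for G H
        using that by (intro boundary_mono) auto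
      fix A assume A: "A \<in> Pow V"
      have eq: "{G \<in> {G \<in> ?T. deficient V G = D}. boundary V G = A} =
          {G \<in> ?T. deficient V G = D \<and> boundary V G = A}"
        by blast
      consider z where "z \<in> V" "A = {z}" | "A = {}" | a b where "a \<in> A" "b \<in> A" "a \<noteq> b"
        using A by blast
      then show "morse_family {G \<in> {G \<in> ?T. deficient V G = D}. boundary V G = A} ?c (?k D A)"
        unfolding eq
      proof cases
        case (1 z)
        then show "morse_family {G \<in> ?T. deficient V G = D \<and> boundary V G = A} ?c (?k D A)"
          using morse_family_tight_boundary_singleton[OF V(1,4) _ IH, of D z] D by simp
      next
        case 2
        then have "{G \<in> ?T. deficient V G = D \<and> boundary V G = A} = {}"
          using tight_boundary_nonempty[OF V(1,4)] by (auto simp: tight_graphs_def)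
        moreover have "?k D A = 0"
          using 2 by simp
        ultimately show "morse_family {G \<in> ?T. deficient V G = D \<and> boundary V G = A} ?c (?k D A)"
          by (simp only: morse_family.empty)
      next
        case (3 a b)
        let ?F = "{G \<in> ?T. deficient V G = D \<and> boundary V G = A}"
        have "morse_family ?F ?c 0"
        proof (rule morse_family_toggle[where f = "{a, b}"])
          show "finite ?F"
            using finite_tight_graphs[OF V(1)] by simp
          fix G assume G: "G \<in> ?F"
          then show "finite G"
            using tight_graphs_finite[OF V(1)] by blast
          have ab: "a \<in> boundary V G" "b \<in> boundary V G" and t: "tight V x y G"
            and e: "G \<subseteq> edges_on V - {{x, y}}"
            using G 3 by (auto simp: tight_graphs_def)
          \<comment> \<open>The toggled edge is not \<open>xy\<close>, since \<open>x\<close> and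
            \<open>y\<close> lie in D and \<open>a\<close>, \<open>b\<close> do not.\<close>
          have "{a, b} \<in> edges_on V - {{x, y}}"
            using ab 3(3) t by (auto simp: insert_in_edges_on boundary_def tight_def doubleton_eq_iff)
          then show "insert {a, b} G \<in> ?F"
            using G e tight_boundary_edge(1)[OF V(1) ab 3(3) V(4) t]
              boundary_edge_irrelevant(2,3)[OF V(1) ab 3(3)] by (simp add: tight_graphs_def)
          show "G - {{a, b}} \<in> ?F"
            using G e tight_boundary_edge(2)[OF V(1) ab 3(3) V(4) t]
              boundary_edge_remove[OF V(1) ab 3(3)] by (auto simp: tight_graphs_def)
        qed
        moreover have "?k D A = 0"
          using 3 by auto
        ultimately show "morse_family ?F ?c (?k D A)"
          by (simp only:)
      qed
    qed
  qed
  moreover have "(\<Sum>A\<in>Pow V. ?k D A) = (\<Sum>z\<in>V. ?s D z)" for D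
  proof -
    have "(\<Sum>A\<in>Pow V. ?k D A) = (\<Sum>A\<in>(\<lambda>z. {z}) ` V. ?k D A)"
      using V(1) by (intro sum.mono_neutral_right) auto
    also have "\<dots> = (\<Sum>z\<in>V. ?s D z)"
      by (subst sum.reindex) (auto intro!: sum.cong)
    finally show ?thesis .
  qed
  ultimately show ?thesis
    using sum_split_count[OF V] by simp
qed

theorem morse_family_fc_graphs:
  assumes "finite V" "V \<noteq> {}"
  shows "morse_family (fc_graphs V) (3 * (card V div 2)) (cell_count (card V))"
  using assms
proof (induction "card V" arbitrary: V rule: less_induct)
  case less
  show ?case
  proof (cases "even (card V)")
    case True
    then show ?thesis
      using fc_graphs_even[OF less.prems True]
      by (simp add: cell_count_def morse_family.empty)
  next
    case False
    show ?thesis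
    \<comment> \<open>The base of the induction: the edgeless graph on one vertex is factor
      critical, and the empty set of edges is the only critical cell.\<close>
    proof (cases "card V = 1")
      case True
      then obtain v where v: "V = {v}"
        by (rule card_1_singletonE)
      have "edges_on V = {}"
        by (auto simp: v edges_on_def subset_singleton_iff)
      moreover have "matches V {} {v} id"
        by (simp add: v matches_def)
      then have "all_matchable V {}"
        by (auto simp: all_matchable_def matchable_def v)
      ultimately have "fc_graphs V = {{}}"
        by (auto simp: fc_graphs_def)
      then show ?thesis
        using morse_family.critical[of "{}" 0] True
        by (simp add: cell_count_def odd_product_0)
    next
      case ne1: False
      have "card V \<noteq> 0"
        using False by (metis even_zero)
      then have c1: "1 < card V"
        using ne1 by linarith
      then obtain x y where xy: "x \<in> V" "y \<in> V" "x \<noteq> y"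
        by (metis One_nat_def card_le_Suc0_iff_eq less.prems(1) not_less)
      let ?e = "{x, y}"
      have IH: "morse_family (fc_graphs W) (3 * (card W div 2)) (cell_count (card W))"
        if "W \<subset> V" "W \<noteq> {}" for W
      proof (rule less.hyps)
        show "card W < card V"
          by (rule psubset_card_mono[OF less.prems(1) that(1)])
        show "finite W"
          by (rule finite_subset[OF psubset_imp_subset[OF that(1)] less.prems(1)])
      qed (fact that(2))
      have T: "morse_family (tight_graphs V x y) (3 * (card V div 2) - 1) (cell_count (card V))"
        by (rule morse_family_tight_graphs[OF less.prems(1) xy False c1 IH])
      let ?R = "{G \<in> fc_graphs V. ?e \<in> G \<and> G - {?e} \<notin> fc_graphs V}"
      have e: "?e \<in> edges_on V"
        using xy by (simp add: insert_in_edges_on)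
      have R: "(\<lambda>G. {?e} \<union> G) ` tight_graphs V x y = ?R"
      proof
        show "(\<lambda>G. {?e} \<union> G) ` tight_graphs V x y \<subseteq> ?R"
        proof (rule image_subsetI)
          fix G assume "G \<in> tight_graphs V x y"
          then have G: "G \<subseteq> edges_on V" "?e \<notin> G" "tight V x y G"
            unfolding tight_graphs_def by blast+
          have del: "insert ?e G - {?e} = G"
            using G(2) by blast
          have "insert ?e G \<in> fc_graphs V" "G \<notin> fc_graphs V"
            using G(1,3) e unfolding tight_iff[OF xy] fc_graphs_def by blast+
          then show "{?e} \<union> G \<in> ?R"
            using del by simp
        qed
        show "?R \<subseteq> (\<lambda>G. {?e} \<union> G) ` tight_graphs V x y"
        proof
          fix G assume G: "G \<in> ?R"
          then have G': "?e \<in> G" "G \<subseteq> edges_on V" "all_matchable V G" "G - {?e} \<subseteq> edges_on V"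
            by (auto simp: fc_graphs_def)
          have nG: "\<not> all_matchable V (G - {?e})"
            using G G'(4) by (simp add: fc_graphs_def)
          have ins: "insert ?e (G - {?e}) = G"
            using G'(1) by blast
          have "tight V x y (G - {?e})"
            unfolding tight_iff[OF xy] ins using G'(3) nG by blast
          then have "G - {?e} \<in> tight_graphs V x y"
            using G'(2) unfolding tight_graphs_def by blast
          moreover have "G = {?e} \<union> (G - {?e})"
            using ins by simp
          ultimately show "G \<in> (\<lambda>G. {?e} \<union> G) ` tight_graphs V x y"
            by (intro image_eqI[where x = "G - {?e}"])
        qed
      qed
      have "morse_family ((\<lambda>G. {?e} \<union> G) ` tight_graphs V x y)
          (card {?e} + (3 * (card V div 2) - 1)) (cell_count (card V))"
        by (rule morse_family_join_face[OF T]) (auto simp: tight_graphs_def)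
      moreover have "card {?e} + (3 * (card V div 2) - 1) = 3 * (card V div 2)"
        using c1 by simp
      ultimately have mR: "morse_family ?R (3 * (card V div 2)) (cell_count (card V))"
        unfolding R by simp
      have up: "H \<in> fc_graphs V" if "G \<in> fc_graphs V" "G \<subseteq> H" "H \<subseteq> edges_on V" for G H
        using that matchable_mono[OF _ that(2)] by (auto simp: fc_graphs_def all_matchable_def)
      have mT: "morse_family (fc_graphs V - ?R) (3 * (card V div 2)) 0"
      proof (rule morse_family_toggle[where f = ?e])
        show "finite (fc_graphs V - ?R)"
          by (rule finite_Diff[OF finite_fc_graphs[OF less.prems(1)]])
        fix G assume G: "G \<in> fc_graphs V - ?R"
        then have Ge: "G \<subseteq> edges_on V" and Gc: "G \<in> fc_graphs V"
          by (simp_all add: fc_graphs_def)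
        show "finite G"
          by (rule finite_subset[OF Ge finite_edges_on[OF less.prems(1)]])
        have i: "insert ?e G \<in> fc_graphs V"
          by (rule up[OF Gc subset_insertI insert_subsetI[OF e Ge]])
        have d: "G - {?e} \<in> fc_graphs V"
        proof (cases "?e \<in> G")
          case True
          then show ?thesis
            using G by blast
        next
          case False
          then show ?thesis
            using G by simp
        qed
        then have "insert ?e G - {?e} \<in> fc_graphs V"
          by simp
        with i show "insert ?e G \<in> fc_graphs V - ?R"
          by blast
        show "G - {?e} \<in> fc_graphs V - ?R"
          using d by blast
      qed
      have "morse_family (?R \<union> (fc_graphs V - ?R)) (3 * (card V div 2)) (cell_count (card V) + 0)"
      \<comment> \<open>The graphs in which \<open>xy\<close> is indispensable come first. A toggled
        graph remains factor critical without \<open>xy\<close>, and then so does every larger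
        graph.\<close>
      proof (rule morse_family.union[OF mR mT])
        fix s t assume s: "s \<in> ?R" and t: "t \<in> fc_graphs V - ?R"
        show "\<not> t \<subseteq> s"
        proof
          assume ts: "t \<subseteq> s"
          have "t - {?e} \<in> fc_graphs V"
          proof (cases "?e \<in> t")
            case True
            then show ?thesis
              using t by blast
          next
            case False
            then show ?thesis
              using t by simp
          qed
          moreover have "t - {?e} \<subseteq> s - {?e}" "s - {?e} \<subseteq> edges_on V"
            using ts s by (auto simp: fc_graphs_def)
          ultimately have "s - {?e} \<in> fc_graphs V"
            by (rule up)
          then show False
            using s by blast
        qed
      qed
      moreover have "?R \<union> (fc_graphs V - ?R) = fc_graphs V"
        by blast
      ultimately show ?thesis
        by simp
    qed
  qed
qed

section \<open>The quotient complex\<close>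

lemma double_factorial_eq_odd_product: "double_factorial (2 * int k - 1) = odd_product k"
proof -
  have "{i::nat. odd i \<and> int i \<le> 2 * int k - 1} = (\<lambda>i. 2 * i + 1) ` {..<k}"
    by (auto elim!: oddE)
  then show ?thesis
    unfolding double_factorial_def odd_product_def
    by (simp add: prod.reindex inj_on_def)
qed

lemma all_edges_eq: "all_edges n = edges_on {1..n}"
  by (simp add: all_edges_def edges_on_def)

lemma NFC_eq:
  assumes "1 \<le> n"
  shows "NFC n = Pow (edges_on {1..n}) - fc_graphs {1..n}"
  using factor_critical_iff_all_matchable[of "{1..n}"] assms
  unfolding NFC_def full_simplex_def fc_graphs_def all_edges_eq by auto

text \<open>The edgeless graph is factor critical here, so the subcomplex is empty, and the simplex
  on no vertices has no points. Both sides of the theorem are the empty space, read as a sphere of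
  dimension -1.\<close>

lemma FC_1: "FC 1 = trivial_topology"
proof -
  have E: "all_edges 1 = {}"
    by (auto simp: all_edges_def subset_singleton_iff)
  have "factor_critical {1..1::nat} {}"
    by (auto simp: factor_critical_def perfect_matching_def)
  then have "NFC 1 = {}"
    by (auto simp: NFC_def full_simplex_def E[unfolded One_nat_def])
  moreover have "points (full_simplex 1) = {}"
    by (auto simp: realization_def full_simplex_def E[unfolded One_nat_def])
  ultimately have "topspace (FC 1) = {}"
    unfolding FC_def complex_quotient_def by (simp add: topspace_final_topology)
  then show ?thesis
    by simp
qed

theorem theorem1p7:
  fixes m n :: nat
  assumes "m \<ge> 1" and "n = 2 * m - 1"
  shows "FC n homotopy_equivalent_space
           wedge_of_spheres ((double_factorial (int n - 2))\<^sup>2) (3 * int m - 4)"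
proof (cases "m = 1")
  case True
  have "wedge_of_spheres N (3 * int m - 4) = trivial_topology" for N
    using True by (simp add: wedge_of_spheres_def)
  moreover have "FC n = trivial_topology"
    using assms(2) True FC_1 by simp
  ultimately show ?thesis
    by (simp add: homeomorphic_imp_homotopy_equivalent_space homeomorphic_empty_space_eq)
next
  case False
  define k where "k = m - 1"
  have k: "1 \<le> k" "m = Suc k" "n = 2 * k + 1"
    using assms False by (auto simp: k_def)
  let ?V = "{1..n}"
  let ?E = "edges_on ?V"
  have L: "NFC n = Pow ?E - fc_graphs ?V"
    by (rule NFC_eq) (simp add: k(3))
  have "morse_family (fc_graphs ?V) (3 * (card ?V div 2)) (cell_count (card ?V))"
    by (rule morse_family_fc_graphs) (simp_all add: k(3))
  \<comment> \<open>A cell with 3k edges has dimension 3k-1, which is 3m-4 for m = k+1.\<close>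
  moreover have "3 * (card ?V div 2) = Suc (3 * k - 1)"
    using k by simp
  moreover have "cell_count (card ?V) = (odd_product k)\<^sup>2"
    by (simp add: k(3) cell_count_def)
  moreover have "Pow ?E - NFC n = fc_graphs ?V"
    unfolding L by (auto simp: fc_graphs_def)
  ultimately have M: "morse_family (Pow ?E - NFC n) (Suc (3 * k - 1)) ((odd_product k)\<^sup>2)"
    by (simp only:)
  \<comment> \<open>For n at least 3 a single edge is not factor critical: if vertex 1 is missed,
    vertex 3 has no partner. So the collapsed subcomplex has points, as the collapsing argument
    requires.\<close>
  have edge: "{1, 2} \<in> ?E" and empty: "{{1, 2}} \<notin> fc_graphs ?V"
  proof -
    show "{1, 2} \<in> ?E"
      using k by (simp add: insert_in_edges_on)
    show "{{1, 2}} \<notin> fc_graphs ?V"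
    proof
      assume "{{1, 2}} \<in> fc_graphs ?V"
      then have "matchable ?V {{1, 2}} {1}"
        using k by (auto simp: fc_graphs_def all_matchable_def)
      then obtain p where p: "matches ?V {{1, 2}} {1} p"
        by (rule matchableE)
      have "{3, p 3} = {1, 2}"
        using matchesD(5)[OF p, of 3] k by simp
      then show False
        by (auto simp: doubleton_eq_iff)
    qed
  qed
  then have F: "{{1, 2}} \<in> NFC n"
    unfolding L by blast
  have "(\<lambda>v. if v = {1, 2} then 1 else 0) \<in> points (NFC n)"
    using F by (auto simp: realization_def intro!: bexI[of _ "{{1, 2}}"])
  then have ne: "points (NFC n) \<noteq> {}"
    by blast
  have "down_closed (NFC n)"
    unfolding down_closed_def using NFC_subcomplex by blast
  then have "collapse (realization (Pow ?E)) (points (NFC n)) homotopy_equivalent_space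
      sphere_bouquet ((odd_product k)\<^sup>2) (3 * k - 1)"
    by (intro morse_family_collapse[OF _ _ _ ne M]) (auto simp: finite_edges_on L)
  moreover have "FC n = collapse (realization (Pow ?E)) (points (NFC n))"
    using F unfolding FC_def complex_quotient_def full_simplex_def all_edges_eq by auto
  moreover have "double_factorial (int n - 2) = odd_product k"
    using double_factorial_eq_odd_product[of k] by (simp add: k(3) algebra_simps)
  moreover have "wedge_of_spheres N (3 * int m - 4) = sphere_bouquet N (3 * k - 1)" for N
  proof -
    have "\<not> 3 * int m - 4 < 0" "nat (3 * int m - 4) = 3 * k - 1"
      using k by auto
    then show ?thesis
      unfolding wedge_of_spheres_def by (simp only: if_False)
  qed
  ultimately show ?thesis
    by simp
qed

end
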